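(* Let $L|K$ be a finite Galois field extension with Galois group $G$ and let $n:=\exp(G)$ be the exponent of $G$. Then $L$ has a co-Galois grading over $K$ if and only if the following conditions are satisfied: 1. $|\mu_n(L)|=n$ and $|\mu_{\operatorname{er}(n)}(K)|=\operatorname{er}(n)$. 2. $|\operatorname{H}^1(G,\mu_n(L))|=|\mu_n(K)|\,|G|/n$.
   Context: $\mu_m(F)=\{x\in F^\times:x^m=1\}$ for a field $F$; $G$ acts on $\mu_n(L)$ by the Galois action and $\operatorname{H}^1$ is group cohomology. For $n\in\mathbb N$, $n\ge1$, let $\operatorname{r}(n)$ be the product of the distinct prime factors of $n$; the extended reduction is $\operatorname{er}(n)=\operatorname{r}(n)$ if $4\nmid n$ and $\operatorname{er}(n)=2\operatorname{r}(n)$ if $4\mid n$. Let $D$ be an abelian group (written additively). A unitary $D$-grading of $L$ over $K$ is a grading $L=\bigoplus_{d\in D}L_d$ ($K$-subspaces with $L_dL_e\subseteq L_{d+e}$) with $L_0=K$ and such that each $L_d$ contains a unit of $L$. For a subgroup $D'\subseteq D$ put $L_{D'}=\bigoplus_{d\in D'}L_d$. A co-Galois grading of $L$ over $K$ is a unitary $D$-grading, for some abelian group $D$, such that the $\ell$-primary component $D[\ell^\infty]$ is $0$ if $\operatorname{char}K=\ell>0$, and every intermediate field $K\subseteq E\subseteq L$ is of the form $E=L_{D'}$ for some subgroup $D'\subseteq D$. *)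

theory Defs
  imports "HOL-Computational_Algebra.Primes" "HOL-Algebra.Algebra"
begin

section \<open>Radical and extended reduction\<close>

definition reduction :: "nat \<Rightarrow> nat"
  where "reduction n = \<Prod>(prime_factors n)"

definition extended_reduction :: "nat \<Rightarrow> nat"
  where "extended_reduction n = (if 4 dvd n then 2 * reduction n else reduction n)"


section \<open>Groups, fields, Galois extensions\<close>

definition group_exponent :: "('g, 'm) monoid_scheme \<Rightarrow> nat"
  where "group_exponent G = (LEAST e. 0 < e \<and> (\<forall>g\<in>carrier G. g [^]\<^bsub>G\<^esub> e = \<one>\<^bsub>G\<^esub>))"

text \<open>The additive order of 1; \<^const>\<open>group.ord\<close> returns 0 on elements of infinite order.\<close>
definition ring_characteristic :: "('a, 'b) ring_scheme \<Rightarrow> nat"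
  where "ring_characteristic R = group.ord (add_monoid R) \<one>\<^bsub>R\<^esub>"

definition roots_of_one :: "nat \<Rightarrow> ('a, 'b) ring_scheme \<Rightarrow> 'a set"
  where "roots_of_one m F = {x \<in> carrier (mult_of F). x [^]\<^bsub>F\<^esub> m = \<one>\<^bsub>F\<^esub>}"

text \<open>\<open>L\<close> over \<open>K\<close> is Galois if \<open>K\<close> is the fixed field of its automorphism group.
  Automorphisms are extensional functions on the carrier, as in \<^const>\<open>AutoGroup\<close>.\<close>
definition galois_group :: "('a, 'b) ring_scheme \<Rightarrow> 'a set \<Rightarrow> ('a \<Rightarrow> 'a) monoid"
  where "galois_group L K = BijGroup (carrier L)
    \<lparr>carrier := {\<sigma> \<in> ring_hom L L \<inter> Bij (carrier L). \<forall>x\<in>K. \<sigma> x = x}\<rparr>"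

definition finite_galois_extension :: "('a, 'b) ring_scheme \<Rightarrow> 'a set \<Rightarrow> bool"
  where "finite_galois_extension L K \<longleftrightarrow>
    field L \<and> subfield K L \<and> ring.finite_dimension L K (carrier L) \<and>
    {x \<in> carrier L. \<forall>\<sigma>\<in>carrier (galois_group L K). \<sigma> x = x} = K"


section \<open>First group cohomology\<close>

text \<open>\<open>M\<close> is an abelian group, written multiplicatively, on which \<open>G\<close> acts by
  automorphisms via \<open>\<phi>\<close>. Cochains are extensional functions, so that each of them
  is counted once.\<close>

definition crossed_homs ::
  "('g, 'b) monoid_scheme \<Rightarrow> ('m, 'c) monoid_scheme \<Rightarrow> ('g \<Rightarrow> 'm \<Rightarrow> 'm) \<Rightarrow> ('g \<Rightarrow> 'm) set"
  where "crossed_homs G M \<phi> = {f \<in> carrier G \<rightarrow>\<^sub>E carrier M.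
    \<forall>g\<in>carrier G. \<forall>h\<in>carrier G. f (g \<otimes>\<^bsub>G\<^esub> h) = f g \<otimes>\<^bsub>M\<^esub> \<phi> g (f h)}"

definition principal_crossed_homs ::
  "('g, 'b) monoid_scheme \<Rightarrow> ('m, 'c) monoid_scheme \<Rightarrow> ('g \<Rightarrow> 'm \<Rightarrow> 'm) \<Rightarrow> ('g \<Rightarrow> 'm) set"
  where "principal_crossed_homs G M \<phi> =
    (\<lambda>m. \<lambda>g\<in>carrier G. \<phi> g m \<otimes>\<^bsub>M\<^esub> inv\<^bsub>M\<^esub> m) ` carrier M"

definition crossed_hom_group ::
  "('g, 'b) monoid_scheme \<Rightarrow> ('m, 'c) monoid_scheme \<Rightarrow> ('g \<Rightarrow> 'm \<Rightarrow> 'm) \<Rightarrow> ('g \<Rightarrow> 'm) monoid"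
  where "crossed_hom_group G M \<phi> =
    \<lparr>carrier = crossed_homs G M \<phi>,
     monoid.mult = \<lambda>f f'. \<lambda>g\<in>carrier G. f g \<otimes>\<^bsub>M\<^esub> f' g,
     one = \<lambda>g\<in>carrier G. \<one>\<^bsub>M\<^esub>\<rparr>"

definition H1 ::
  "('g, 'b) monoid_scheme \<Rightarrow> ('m, 'c) monoid_scheme \<Rightarrow> ('g \<Rightarrow> 'm \<Rightarrow> 'm) \<Rightarrow> ('g \<Rightarrow> 'm) set monoid"
  where "H1 G M \<phi> = crossed_hom_group G M \<phi> Mod principal_crossed_homs G M \<phi>"

definition roots_of_one_group :: "nat \<Rightarrow> ('a, 'b) ring_scheme \<Rightarrow> 'a monoid"
  where "roots_of_one_group m F = (mult_of F)\<lparr>carrier := roots_of_one m F\<rparr>"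


section \<open>Gradings\<close>

text \<open>The grading group \<open>D\<close> is written multiplicatively, following the library's convention
  for abelian groups as objects; its neutral element plays the role of 0.

  \<open>graded_part L A S\<close> is the sum of the \<open>A d\<close> for \<open>d \<in> S\<close>; \<open>S\<close> may be infinite.\<close>

definition graded_part :: "('a, 'b) ring_scheme \<Rightarrow> ('d \<Rightarrow> 'a set) \<Rightarrow> 'd set \<Rightarrow> 'a set"
  where "graded_part L A S = {finsum L f F | f F. finite F \<and> F \<subseteq> S \<and> f \<in> Pi F A}"

text \<open>The locale \<^locale>\<open>subalgebra\<close> of the library requires only an additive subgroup that is
  closed under scalars from \<open>K\<close>: it describes \<open>K\<close>-subspaces. The last conjunct says that the
  sum of the \<open>A d\<close> is direct.\<close>
definition grading ::
  "('a, 'b) ring_scheme \<Rightarrow> 'a set \<Rightarrow> ('d, 'c) monoid_scheme \<Rightarrow> ('d \<Rightarrow> 'a set) \<Rightarrow> bool"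
  where "grading L K D A \<longleftrightarrow>
    comm_group D \<and>
    (\<forall>d\<in>carrier D. subalgebra K (A d) L) \<and>
    (\<forall>d\<in>carrier D. \<forall>e\<in>carrier D. \<forall>x\<in>A d. \<forall>y\<in>A e. x \<otimes>\<^bsub>L\<^esub> y \<in> A (d \<otimes>\<^bsub>D\<^esub> e)) \<and>
    graded_part L A (carrier D) = carrier L \<and>
    (\<forall>F f. finite F \<and> F \<subseteq> carrier D \<and> f \<in> Pi F A \<and> finsum L f F = \<zero>\<^bsub>L\<^esub> \<longrightarrow>
      (\<forall>d\<in>F. f d = \<zero>\<^bsub>L\<^esub>))"

definition unitary_grading ::
  "('a, 'b) ring_scheme \<Rightarrow> 'a set \<Rightarrow> ('d, 'c) monoid_scheme \<Rightarrow> ('d \<Rightarrow> 'a set) \<Rightarrow> bool"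
  where "unitary_grading L K D A \<longleftrightarrow>
    grading L K D A \<and> A \<one>\<^bsub>D\<^esub> = K \<and> (\<forall>d\<in>carrier D. A d \<inter> Units L \<noteq> {})"

definition primary_component :: "('d, 'c) monoid_scheme \<Rightarrow> nat \<Rightarrow> 'd set"
  where "primary_component D l = {d \<in> carrier D. \<exists>k::nat. d [^]\<^bsub>D\<^esub> (l ^ k) = \<one>\<^bsub>D\<^esub>}"

definition co_galois_grading ::
  "('a, 'b) ring_scheme \<Rightarrow> 'a set \<Rightarrow> ('d, 'c) monoid_scheme \<Rightarrow> ('d \<Rightarrow> 'a set) \<Rightarrow> bool"
  where "co_galois_grading L K D A \<longleftrightarrow>
    unitary_grading L K D A \<and>
    (\<forall>l. ring_characteristic (L\<lparr>carrier := K\<rparr>) = l \<and> 0 < l \<longrightarrow> primary_component D l = {\<one>\<^bsub>D\<^esub>}) \<and>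
    (\<forall>E. subfield E L \<and> K \<subseteq> E \<longrightarrow> (\<exists>D'. subgroup D' D \<and> E = graded_part L A D'))"

text \<open>HOL cannot quantify over the carrier type of \<open>D\<close> inside a formula. Nothing is lost by
  taking that type to be the one of \<open>L\<close>, since choosing a unit in each component embeds \<open>D\<close>
  into \<open>L\<close>: see \<open>has_co_galois_gradingI\<close> below.\<close>
definition has_co_galois_grading :: "('a, 'b) ring_scheme \<Rightarrow> 'a set \<Rightarrow> bool"
  where "has_co_galois_grading L K \<longleftrightarrow> (\<exists>(D :: 'a monoid) A. co_galois_grading L K D A)"

lemma graded_part_reindex:
  assumes L: "field L" and inj: "inj_on h S"
    and A: "\<And>d. d \<in> h ` S \<Longrightarrow> A d \<subseteq> carrier L"
  shows "graded_part L (A \<circ> h) S = graded_part L A (h ` S)"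
proof -
  interpret field L by (rule L)
  show ?thesis
  proof (rule subset_antisym; rule subsetI)
    fix x assume "x \<in> graded_part L (A \<circ> h) S"
    then obtain f F where F: "finite F" "F \<subseteq> S" "f \<in> Pi F (A \<circ> h)" "x = finsum L f F"
      by (auto simp: graded_part_def)
    define g where "g = f \<circ> the_inv_into F h"
    have injF: "inj_on h F" using inj F(2) by (rule inj_on_subset)
    have gh: "g (h d) = f d" if "d \<in> F" for d
      using that injF by (simp add: g_def the_inv_into_f_f)
    have g: "g \<in> Pi (h ` F) A" using F(3) gh by (auto simp: Pi_iff)
    have "g x \<in> carrier L" if "x \<in> h ` F" for x
      using Pi_mem[OF g that] A[of x] that F(2) by blast
    then have "g \<in> h ` F \<rightarrow> carrier L" by simp
    then have "finsum L g (h ` F) = finsum L (\<lambda>d. g (h d)) F"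
      using injF by (rule add.finprod_reindex)
    also have "\<dots> = finsum L f F"
    proof (rule finsum_cong')
      show "f \<in> F \<rightarrow> carrier L"
      proof
        fix x assume "x \<in> F"
        then have "f x \<in> A (h x)" "h x \<in> h ` S" using F(2,3) by auto
        then show "f x \<in> carrier L" using A by blast
      qed
    qed (simp_all add: gh)
    finally have "x = finsum L g (h ` F)" using F(4) by simp
    moreover have "finite (h ` F)" "h ` F \<subseteq> h ` S" using F by auto
    ultimately show "x \<in> graded_part L A (h ` S)"
      using g unfolding graded_part_def by blast
  next
    fix x assume "x \<in> graded_part L A (h ` S)"
    then obtain f F where F: "finite F" "F \<subseteq> h ` S" "f \<in> Pi F A" "x = finsum L f F"
      by (auto simp: graded_part_def)
    obtain F' where F': "F' \<subseteq> S" "F = h ` F'" "finite F'"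
      using finite_subset_image[OF F(1,2)] by blast
    have injF: "inj_on h F'" using inj F'(1) by (rule inj_on_subset)
    have "f x \<in> carrier L" if "x \<in> F" for x
      using Pi_mem[OF F(3) that] A[of x] that F(2) by blast
    then have "f \<in> h ` F' \<rightarrow> carrier L" using F'(2) by simp
    then have "finsum L f (h ` F') = finsum L (\<lambda>d. f (h d)) F'"
      using injF by (rule add.finprod_reindex)
    then have "x = finsum L (\<lambda>d. f (h d)) F'" using F(4) F'(2) by simp
    moreover have "(\<lambda>d. f (h d)) \<in> Pi F' (A \<circ> h)" using F(3) F'(2) by auto
    ultimately show "x \<in> graded_part L (A \<circ> h) S"
      using F' unfolding graded_part_def by blast
  qed
qed

lemma grading_component_subset:
  assumes "grading L K D A" "d \<in> carrier D"
  shows "A d \<subseteq> carrier L"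
proof -
  have "subalgebra K (A d) L" using assms by (auto simp: grading_def)
  from subgroup.subset[OF subalgebra.axioms(1)[OF this]] show ?thesis by simp
qed

lemma co_galois_grading_transport:
  assumes L: "field L" and co: "co_galois_grading L K D A"
    and D': "comm_group D'" and h: "h \<in> iso D' D"
  shows "co_galois_grading L K D' (A \<circ> h)"
proof -
  interpret field L by (rule L)
  have unitary: "unitary_grading L K D A" using co by (simp add: co_galois_grading_def)
  have gr: "grading L K D A" using unitary by (simp add: unitary_grading_def)
  have comm: "comm_group D" using gr by (simp add: grading_def)
  have D: "group D" using comm by (rule comm_group.axioms(2))
  have D'g: "group D'" using D' by (rule comm_group.axioms(2))
  have hom: "h \<in> hom D' D" and bij: "bij_betw h (carrier D') (carrier D)"
    using h by (auto simp: iso_def)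
  have inj: "inj_on h (carrier D')" and im: "h ` carrier D' = carrier D"
    using bij by (auto simp: bij_betw_def)
  have hc: "h d \<in> carrier D" if "d \<in> carrier D'" for d using that im by auto
  have h1: "h \<one>\<^bsub>D'\<^esub> = \<one>\<^bsub>D\<^esub>" using hom_one[OF hom D'g D] .
  have Asub: "A d \<subseteq> carrier L" if "d \<in> carrier D" for d
    using grading_component_subset[OF gr that] .
  have part: "graded_part L (A \<circ> h) S = graded_part L A (h ` S)" if "S \<subseteq> carrier D'" for S
  proof (rule graded_part_reindex[OF L])
    show "inj_on h S" using inj that by (rule inj_on_subset)
    show "A d \<subseteq> carrier L" if "d \<in> h ` S" for d using Asub hc that \<open>S \<subseteq> carrier D'\<close> by auto
  qed
  have "grading L K D' (A \<circ> h)"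
    unfolding grading_def
  proof (intro conjI ballI allI impI)
    show "comm_group D'" by (rule D')
    show "subalgebra K ((A \<circ> h) d) L" if "d \<in> carrier D'" for d
      using gr hc[OF that] by (simp add: grading_def)
    show "x \<otimes>\<^bsub>L\<^esub> y \<in> (A \<circ> h) (d \<otimes>\<^bsub>D'\<^esub> e)"
      if "d \<in> carrier D'" "e \<in> carrier D'" "x \<in> (A \<circ> h) d" "y \<in> (A \<circ> h) e" for d e x y
      using gr hc[OF that(1)] hc[OF that(2)] that(3,4)
      by (simp add: grading_def hom_mult[OF hom that(1,2)])
    show "graded_part L (A \<circ> h) (carrier D') = carrier L"
      using gr by (simp add: part im grading_def)
    fix F f d
    assume F: "finite F \<and> F \<subseteq> carrier D' \<and> f \<in> Pi F (A \<circ> h) \<and> finsum L f F = \<zero>\<^bsub>L\<^esub>"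
      and d: "d \<in> F"
    define g where "g = f \<circ> the_inv_into F h"
    have injF: "inj_on h F" using inj F by (blast intro: inj_on_subset)
    have gh: "g (h d) = f d" if "d \<in> F" for d
      using that injF by (simp add: g_def the_inv_into_f_f)
    have g: "g \<in> Pi (h ` F) A" using F gh by (auto simp: Pi_iff)
    have FD: "h ` F \<subseteq> carrier D" using F hc by auto
    have "g x \<in> carrier L" if "x \<in> h ` F" for x
      using Pi_mem[OF g that] Asub[of x] that FD by blast
    then have "g \<in> h ` F \<rightarrow> carrier L" by simp
    then have "finsum L g (h ` F) = finsum L (\<lambda>d. g (h d)) F"
      using injF by (rule add.finprod_reindex)
    also have "\<dots> = finsum L f F"
    proof (rule finsum_cong')
      show "f \<in> F \<rightarrow> carrier L"
      proof
        fix x assume "x \<in> F"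
        then have "f x \<in> A (h x)" "h x \<in> carrier D" using F hc by auto
        then show "f x \<in> carrier L" using Asub by blast
      qed
    qed (simp_all add: gh)
    finally have "finsum L g (h ` F) = \<zero>\<^bsub>L\<^esub>" using F by simp
    moreover have "finite (h ` F)" using F by simp
    ultimately have "\<forall>d\<in>h ` F. g d = \<zero>\<^bsub>L\<^esub>"
      using gr g FD unfolding grading_def by blast
    then show "f d = \<zero>\<^bsub>L\<^esub>" using gh d by auto
  qed
  then have "unitary_grading L K D' (A \<circ> h)"
    using unitary hc h1 by (simp add: unitary_grading_def)
  moreover have "primary_component D' l = {\<one>\<^bsub>D'\<^esub>}" if "primary_component D l = {\<one>\<^bsub>D\<^esub>}" for l
  proof -
    have "d = \<one>\<^bsub>D'\<^esub>" if d: "d \<in> carrier D'" "d [^]\<^bsub>D'\<^esub> (l ^ k) = \<one>\<^bsub>D'\<^esub>" for d and k :: nat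
    proof -
      have "h d [^]\<^bsub>D\<^esub> (l ^ k) = \<one>\<^bsub>D\<^esub>"
        using hom_nat_pow[OF hom d(1) D'g D, of "l ^ k"] d(2) h1 by simp
      then have "h d \<in> primary_component D l" using hc[OF d(1)] by (auto simp: primary_component_def)
      then have "h d = h \<one>\<^bsub>D'\<^esub>" using \<open>primary_component D l = {\<one>\<^bsub>D\<^esub>}\<close> h1 by auto
      then show ?thesis using inj d(1) D'g by (meson group.is_monoid inj_onD monoid.one_closed)
    qed
    moreover have "\<one>\<^bsub>D'\<^esub> \<in> primary_component D' l"
      using D'g by (simp add: primary_component_def group.is_monoid monoid.nat_pow_one)
    ultimately show ?thesis by (auto simp: primary_component_def)
  qed
  moreover have "\<exists>S'. subgroup S' D' \<and> E = graded_part L (A \<circ> h) S'"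
    if "subgroup S D" "E = graded_part L A S" for E S
  proof -
    have inv: "inv_into (carrier D') h \<in> iso D D'" using group.iso_set_sym[OF D'g h] .
    define S' where "S' = inv_into (carrier D') h ` S"
    have sub: "subgroup S' D'"
      unfolding S'_def using subgroup.iso_subgroup[OF that(1) D D'g inv] .
    have "S \<subseteq> carrier D" using that(1) by (rule subgroup.subset)
    then have "h ` S' = S" using im by (force simp: S'_def f_inv_into_f image_image)
    then show ?thesis using sub part[OF subgroup.subset[OF sub]] that(2) by auto
  qed
  ultimately show ?thesis
    using co unfolding co_galois_grading_def by metis
qed

lemma has_co_galois_gradingI:
  fixes L :: "('a, 'b) ring_scheme" and D :: "('d, 'c) monoid_scheme"
  assumes L: "field L" and co: "co_galois_grading L K D A"
  shows "has_co_galois_grading L K"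
proof -
  interpret field L by (rule L)
  have unitary: "unitary_grading L K D A" using co by (simp add: co_galois_grading_def)
  have gr: "grading L K D A" using unitary by (simp add: unitary_grading_def)
  interpret D: comm_group D using gr by (simp add: grading_def)
  have "\<forall>d\<in>carrier D. \<exists>x. x \<in> A d \<inter> Units L" using unitary unfolding unitary_grading_def by blast
  then obtain u where u: "\<And>d. d \<in> carrier D \<Longrightarrow> u d \<in> A d \<inter> Units L"
    by (auto dest!: bchoice)
  have inj: "inj_on u (carrier D)"
  proof (rule inj_onI, rule ccontr)
    fix d e assume d: "d \<in> carrier D" and e: "e \<in> carrier D" and eq: "u d = u e" and ne: "d \<noteq> e"
    have uL: "u d \<in> carrier L" "u d \<noteq> \<zero>\<^bsub>L\<^esub>" using u[OF d] field_Units by auto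
    have "subalgebra K (A e) L" using gr e by (auto simp: grading_def)
    from subgroup.m_inv_closed[OF subalgebra.axioms(1)[OF this]] have
      neg: "\<ominus>\<^bsub>L\<^esub> u d \<in> A e" using u[OF e] eq by (simp add: a_inv_def)
    define f where "f = (\<lambda>x. if x = d then u d else \<ominus>\<^bsub>L\<^esub> u d)"
    have "f \<in> Pi {d, e} A" using u[OF d] neg by (auto simp: f_def)
    moreover have "finsum L f {d, e} = f d \<oplus>\<^bsub>L\<^esub> f e"
      using ne uL by (subst finsum_insert) (auto simp: f_def)
    then have "finsum L f {d, e} = \<zero>\<^bsub>L\<^esub>" using ne uL by (simp add: f_def r_neg)
    moreover have "finite {d, e} \<and> {d, e} \<subseteq> carrier D" using d e by simp
    ultimately have "\<forall>x\<in>{d, e}. f x = \<zero>\<^bsub>L\<^esub>" using gr unfolding grading_def by blast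
    then show False using uL by (simp add: f_def)
  qed
  define v where "v = inv_into (carrier D) u"
  have vu: "v (u d) = d" if "d \<in> carrier D" for d using that inj by (simp add: v_def)
  define D' :: "'a monoid" where "D' = \<lparr>carrier = u ` carrier D,
    monoid.mult = (\<lambda>x y. u (v x \<otimes>\<^bsub>D\<^esub> v y)), one = u \<one>\<^bsub>D\<^esub>\<rparr>"
  have "comm_group D'"
  proof (rule comm_groupI)
    fix x assume "x \<in> carrier D'"
    then obtain d where d: "d \<in> carrier D" "x = u d" by (auto simp: D'_def)
    then show "\<exists>y\<in>carrier D'. y \<otimes>\<^bsub>D'\<^esub> x = \<one>\<^bsub>D'\<^esub>"
      by (intro bexI[of _ "u (inv\<^bsub>D\<^esub> d)"]) (auto simp: D'_def vu)
  qed (auto simp: D'_def vu D.m_assoc D.m_lcomm D.m_comm)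
  moreover have "v \<in> iso D' D"
  proof (rule isoI)
    show "v \<in> hom D' D" by (auto simp: hom_def D'_def vu)
    show "bij_betw v (carrier D') (carrier D)"
      unfolding D'_def v_def by (simp add: bij_betw_inv_into inj inj_on_imp_bij_betw)
  qed
  ultimately have "co_galois_grading L K D' (A \<circ> v)"
    using co_galois_grading_transport[OF L co] by blast
  then show ?thesis unfolding has_co_galois_grading_def by blast
qed

end

theory Submission
  imports Defs "HOL-Number_Theory.Cong"
begin

text \<open>By Hilbert 90, a crossed homomorphism from \<open>G\<close> to the \<open>n\<close>-th roots of unity has the form
  \<open>\<phi> \<mapsto> \<phi> x / x\<close> with \<open>x ^ n \<in> K\<close>. Since the coboundaries are counted by the roots of unity in \<open>L\<close> and
  in \<open>K\<close>, condition 2 says, once \<open>|\<mu>_n(L)| = n\<close>, that there are \<open>|G|\<close> crossed homomorphisms.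

  If moreover \<open>K\<close> contains the roots of unity of order \<open>er(n)\<close>, then a crossed homomorphism that
  vanishes on a subgroup \<open>H\<close>, and on \<open>g ^ m \<in> H\<close>, satisfies \<open>f(g) ^ m = 1\<close> (lifting the exponent). Adjoining
  one element at a time, the number of crossed homomorphisms vanishing on \<open>H\<close>, times \<open>|H|\<close>, increases
  with \<open>H\<close>. Hence there are at most \<open>|G|\<close> of them, and in case of equality the decomposition
  of \<open>L\<close> according to crossed homomorphisms has the correct size over every intermediate field.

  Conversely, let a co-Galois grading by \<open>D\<close> be given. Conjugating a homogeneous element of order
  \<open>n = exp(D)\<close> yields all \<open>n\<close>-th roots of unity. If \<open>\<zeta> \<in> L\<close> of prime order \<open>p\<close> dividing \<open>n\<close> is not in \<open>K\<close>,
  and \<open>x\<close> is homogeneous of order \<open>p\<close>, then \<open>\<zeta> x\<close> has at most \<open>p\<close> conjugates, but generates a subfield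
  whose group of degrees is larger. So the bound above applies to the crossed homomorphisms, which
  contain \<open>D\<close> by way of homogeneous elements, and \<open>|D| = |G|\<close>. All the dimension counts are done by
  solving homogeneous linear systems and taking traces.\<close>

text \<open>If \<open>K\<close> contained all \<open>n\<close>-th roots of unity, crossed
  homomorphisms would be characters of \<open>G\<close>, and Kummer duality would apply. With only
  those of order \<open>er(n)\<close> in \<open>K\<close>, a crossed homomorphism on the powers of
  \<open>g\<close> is governed by f(g ^ k) = f(g) ^ (1 + s + ... + s ^ (k - 1)), where
  \<open>g\<close> raises the \<open>n\<close>-th roots of unity to the power \<open>s\<close>. What
  survives of duality is that f(g ^ k) = 1 exactly if f(g) ^ k = 1, for which the sum and
  \<open>k\<close> must be divisible by the same divisors of \<open>n\<close>. This is the origin of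
  \<open>er(n)\<close>: s = 1 modulo the primes dividing \<open>n\<close> is enough, except that s =
  3 and k = 2 give the sum 4; hence the additional factor 2 if 4 divides \<open>n\<close>.

  The pairing of crossed homomorphisms with \<open>G\<close> is not bilinear, so duality is replaced
  by two inequalities of cardinalities, which a full count of crossed homomorphisms turns into
  equalities. In the converse direction the natural exponent is that of \<open>D\<close>; its
  equality with the exponent of \<open>G\<close> is itself a consequence of the pairing.\<close>

hide_const (open) Divisibility.prime

section \<open>Geometric sums and their divisors: lifting the exponent\<close>

lemma geometric_sum_mult:
  fixes s :: nat
  shows "(\<Sum>i<a * b. s ^ i) = (\<Sum>i<a. s ^ i) * (\<Sum>i<b. (s ^ a) ^ i)"
proof (induction b)
  case (Suc b)
  have split: "(\<Sum>i<x + y. s ^ i) = (\<Sum>i<x. s ^ i) + s ^ x * (\<Sum>i<y. s ^ i)" for x y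
    by (induction y) (simp_all add: algebra_simps power_add)
  show ?case
    using Suc split[of "a * b" a] by (simp add: algebra_simps power_mult)
qed simp

lemma cong_geometric_sum:
  fixes s :: nat
  assumes "[s = 1] (mod p)"
  shows "[(\<Sum>i<m. s ^ i) = m] (mod p)"
proof -
  have "[s ^ i = 1] (mod p)" for i
    using cong_pow[OF assms, of i] by simp
  then have "[(\<Sum>i<m. s ^ i) = (\<Sum>i<m. 1)] (mod p)"
    by (intro cong_sum)
  then show ?thesis by simp
qed

text \<open>Modulo p^2 the sum is p: with t = 1 + p k its terms are 1 + i p k, and p k times 0 + 1 +
  ... + (p - 1) vanishes modulo p^2 because (p - 1) / 2 is an integer for odd \<open>p\<close>. For
  p = 2 this fails, and the congruence modulo 4 takes its place.\<close>

lemma geometric_sum_prime: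
  fixes t :: nat
  assumes p: "prime p" and t: "[t = 1] (mod p)" and two: "p = 2 \<Longrightarrow> [t = 1] (mod 4)" and "0 < t"
  shows "\<exists>u. (\<Sum>i<p. t ^ i) = p * u \<and> \<not> p dvd u"
proof -
  have "[(\<Sum>i<p. t ^ i) = p] (mod p * p)"
  proof (cases "p = 2")
    case True
    have "{..<2::nat} = {0, 1}" by auto
    then have "(\<Sum>i<p. t ^ i) = 1 + t" using True by simp
    moreover have "[1 + t = 1 + 1] (mod 4)" using two[OF True] by (intro cong_add) auto
    then have "(1 + t) mod 4 = 2" by (simp add: cong_def)
    ultimately show ?thesis using True by (simp add: cong_def)
  next
    case False
    then have "odd p" using p primes_dvd_imp_eq two_is_prime_nat by blast
    obtain k where "t - 1 = p * k" using cong_to_1_nat[OF t] ..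
    then have k: "t = 1 + p * k" using \<open>0 < t\<close> by simp
    have pow: "[t ^ i = 1 + i * (p * k)] (mod p * p)" for i
    proof (induction i)
      case (Suc i)
      have "[t ^ Suc i = t * (1 + i * (p * k))] (mod p * p)"
        using cong_mult[OF cong_refl Suc, of t] by simp
      also have "t * (1 + i * (p * k)) = 1 + Suc i * (p * k) + (p * p) * (i * k * k)"
        by (simp add: k algebra_simps)
      also have "[\<dots> = 1 + Suc i * (p * k)] (mod p * p)"
        by (simp add: cong_def)
      finally show ?case .
    qed simp
    have "[(\<Sum>i<p. t ^ i) = (\<Sum>i<p. 1 + i * (p * k))] (mod p * p)"
      by (intro cong_sum pow)
    also have "(\<Sum>i<p. 1 + i * (p * k)) = p + (\<Sum>i<p. i) * (p * k)"
      by (subst sum.distrib) (simp add: sum_distrib_right)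
    also have "(\<Sum>i<p. i) = p * ((p - 1) div 2)"
    proof -
      have "(\<Sum>i<p. i) = p * (p - 1) div 2"
      proof -
        have "2 * (\<Sum>i<q. i) = q * (q - 1)" for q :: nat
          by (induction q) (auto simp: algebra_simps)
        then show ?thesis by (metis nonzero_mult_div_cancel_left zero_neq_numeral)
      qed
      then show ?thesis using \<open>odd p\<close> by (simp add: div_mult_swap)
    qed
    also have "p + p * ((p - 1) div 2) * (p * k) = p + (p * p) * ((p - 1) div 2 * k)"
      by simp
    also have "[\<dots> = p] (mod p * p)"
      by (simp only: cong_def mod_mult_self2)
    finally show ?thesis .
  qed
  then obtain u where u: "(\<Sum>i<p. t ^ i) = p * u" 
    by (metis cong_dvd_iff cong_modulus_mult_nat dvd_refl dvdE)
  have "\<not> p dvd u"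
  proof
    assume "p dvd u"
    then have "p * p dvd (\<Sum>i<p. t ^ i)" by (simp add: u)
    then have "p * p dvd p"
      using \<open>[_ = p] (mod p * p)\<close> cong_dvd_iff by blast
    then show False using p by (auto dest: dvd_imp_le prime_gt_1_nat simp: prime_gt_0_nat)
  qed
  with u show ?thesis by blast
qed

text \<open>For m = m' p the sum splits into the one of length m' and the one of length
  \<open>p\<close> for the base s ^ m'; the latter contributes exactly one factor \<open>p\<close>.
  If \<open>p\<close> does not divide \<open>m\<close>, it suffices that the sum is congruent to
  \<open>m\<close> modulo \<open>p\<close>. This also settles a = 1, so that the congruence modulo 4
  is only asked for from a = 2 on.\<close>

lemma prime_power_dvd_geometric_sum:
  fixes s :: nat
  assumes p: "prime p" and s: "[s = 1] (mod p)" and "0 < s"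
    and two: "p = 2 \<Longrightarrow> 2 \<le> a \<Longrightarrow> [s = 1] (mod 4)"
  shows "p ^ a dvd (\<Sum>i<m. s ^ i) \<longleftrightarrow> p ^ a dvd m"
proof -
  have p_dvd: "p dvd (\<Sum>i<m. s ^ i) \<longleftrightarrow> p dvd m" for m
    using cong_geometric_sum[OF s] cong_dvd_iff by blast
  consider "a = 0" | "a = 1" | "2 \<le> a" by linarith
  then show ?thesis
  proof cases
    case 3
    \<comment> \<open>Obtained before the induction, whose steps lower \<open>a\<close> below 2
      while the congruence modulo 4 has to survive.\<close>
    have four: "[s = 1] (mod 4)" if "p = 2" using two 3 that by simp
    show ?thesis
    proof (induction m arbitrary: a rule: less_induct)
      case (less m)
      show ?case
      proof (cases "a = 0 \<or> m = 0 \<or> \<not> p dvd m")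
        case True
        then consider "a = 0" | "m = 0" | "a \<noteq> 0" "\<not> p dvd m" by blast
        then show ?thesis
        proof cases
          case 3
          then have "p dvd p ^ a" by simp
          then show ?thesis using 3 p_dvd[of m] dvd_trans by blast
        qed simp_all
      next
        case False
        then obtain m' b where m': "m = m' * p" and b: "a = Suc b"
          by (metis dvdE mult.commute not0_implies_Suc)
        have "m' < m" using m' False prime_gt_1_nat[OF p] by simp
        have "[s ^ m' = 1] (mod p)" using cong_pow[OF s, of m'] by simp
        moreover have "[s ^ m' = 1] (mod 4)" if "p = 2" using cong_pow[OF four, of m'] that by simp
        ultimately obtain u where u: "(\<Sum>i<p. (s ^ m') ^ i) = p * u" "\<not> p dvd u"
          using geometric_sum_prime[OF p] \<open>0 < s\<close> by fastforce
        have "coprime (p ^ b) u" using u(2) p by (simp add: prime_imp_coprime)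
        have "p ^ a dvd (\<Sum>i<m. s ^ i) \<longleftrightarrow> p * p ^ b dvd p * ((\<Sum>i<m'. s ^ i) * u)"
          by (simp only: m' geometric_sum_mult u b power_Suc mult_ac)
        also have "\<dots> \<longleftrightarrow> p ^ b dvd (\<Sum>i<m'. s ^ i) * u"
          using p by (simp add: prime_gt_0_nat)
        also have "\<dots> \<longleftrightarrow> p ^ b dvd (\<Sum>i<m'. s ^ i)"
          using \<open>coprime (p ^ b) u\<close> by (simp add: coprime_dvd_mult_left_iff)
        also have "\<dots> \<longleftrightarrow> p ^ b dvd m'" using less \<open>m' < m\<close> by simp
        also have "\<dots> \<longleftrightarrow> p ^ a dvd m" using p by (simp add: m' b prime_gt_0_nat)
        finally show ?thesis .
      qed
    qed
  qed (simp_all add: p_dvd)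
qed

lemma dvd_iff_prime_power_dvd:
  fixes k x :: nat
  assumes "0 < k"
  shows "k dvd x \<longleftrightarrow> (\<forall>p a. prime p \<longrightarrow> p ^ a dvd k \<longrightarrow> p ^ a dvd x)"
proof (cases "x = 0")
  case False
  show ?thesis
  proof
    assume *: "\<forall>p a. prime p \<longrightarrow> p ^ a dvd k \<longrightarrow> p ^ a dvd x"
    show "k dvd x"
    proof (rule multiplicity_le_imp_dvd)
      show "multiplicity p k \<le> multiplicity p x" if "prime p" for p
      proof (rule multiplicity_geI)
        show "p ^ multiplicity p k dvd x" using * that multiplicity_dvd by blast
        show "x \<noteq> 0" using False .
        show "\<not> is_unit p" using that by (auto dest: not_prime_unit)
      qed
    qed (use assms in simp)
  qed (metis dvd_trans)
qed simp

text \<open>Checked for one prime power p ^ a dividing \<open>k\<close> at a time. As it divides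
  \<open>n\<close> too, p = 2 and a >= 2 force \<open>4 dvd n\<close>, which is just when the
  congruence modulo 4 is available.\<close>

lemma dvd_geometric_sum_iff:
  fixes s :: nat
  assumes n: "0 < n" "k dvd n" and "0 < s"
    and odd: "\<And>p. prime p \<Longrightarrow> p dvd n \<Longrightarrow> [s = 1] (mod p)"
    and four: "4 dvd n \<Longrightarrow> [s = 1] (mod 4)"
  shows "k dvd (\<Sum>i<m. s ^ i) \<longleftrightarrow> k dvd m"
proof -
  have "0 < k" using n by (auto intro: dvd_pos_nat)
  have "p ^ a dvd (\<Sum>i<m. s ^ i) \<longleftrightarrow> p ^ a dvd m" if p: "prime p" "p ^ a dvd k" for p a
  proof (cases "a = 0")
    case False
    have pn: "p ^ a dvd n" using p n dvd_trans by blast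
    show ?thesis
    proof (rule prime_power_dvd_geometric_sum[OF p(1) _ \<open>0 < s\<close>])
      show "[s = 1] (mod p)"
        using odd[OF p(1)] pn False by (meson dvd_power dvd_trans bot_nat_0.not_eq_extremum)
      assume "p = 2" "2 \<le> a"
      then have "2 ^ 2 dvd n" using pn by (meson le_imp_power_dvd dvd_trans)
      then show "[s = 1] (mod 4)" using four by simp
    qed
  qed simp
  then show ?thesis unfolding dvd_iff_prime_power_dvd[OF \<open>0 < k\<close>] by blast
qed

section \<open>Divisibility by the radical and by the extended reduction\<close>

lemma prod_primes_dvd:
  fixes P :: "nat set"
  assumes "finite P" "\<And>p. p \<in> P \<Longrightarrow> prime p" "\<And>p. p \<in> P \<Longrightarrow> p dvd x"
  shows "\<Prod>P dvd x"
  using assms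
proof (induction P rule: finite_induct)
  case (insert p P)
  have "coprime p (\<Prod>P)"
    using insert by (intro prod_coprime_right) (auto intro!: primes_coprime)
  then show ?case using insert by (simp add: divides_mult)
qed simp

lemma reduction_dvd_iff:
  "reduction n dvd x \<longleftrightarrow> (\<forall>p\<in>prime_factors n. p dvd x)"
proof
  assume "reduction n dvd x"
  then show "\<forall>p\<in>prime_factors n. p dvd x"
    unfolding reduction_def by (metis dvd_prodI dvd_trans finite_set_mset)
next
  assume "\<forall>p\<in>prime_factors n. p dvd x"
  then show "reduction n dvd x"
    unfolding reduction_def by (intro prod_primes_dvd) auto
qed

text \<open>If 4 divides \<open>n\<close>, then er(n) = 4 r with \<open>r\<close> the product of the
  odd prime divisors, and coprimality separates the two factors. With x = s - 1 this translates
  between roots of unity in \<open>K\<close> and congruences for the exponent \<open>s\<close> by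
  which an automorphism acts on roots of unity.\<close>

lemma extended_reduction_dvd_iff:
  assumes "0 < n"
  shows "extended_reduction n dvd x \<longleftrightarrow>
    (\<forall>p. prime p \<longrightarrow> p dvd n \<longrightarrow> p dvd x) \<and> (4 dvd n \<longrightarrow> 4 dvd x)"
proof -
  have red: "reduction n dvd x \<longleftrightarrow> (\<forall>p. prime p \<longrightarrow> p dvd n \<longrightarrow> p dvd x)" for x
    using assms by (auto simp: reduction_dvd_iff in_prime_factors_iff)
  show ?thesis
  proof (cases "4 dvd n")
    case True
    have "2 dvd n" using True by (meson dvd_trans dvd_numeral_simp even_numeral)
    define r where "r = \<Prod>(prime_factors n - {2})"
    have "2 \<in> prime_factors n" using \<open>2 dvd n\<close> assms by (simp add: in_prime_factors_iff)
    then have r: "reduction n = 2 * r"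
      unfolding reduction_def r_def using prod.remove[of "prime_factors n" 2 "\<lambda>p. p"] by simp
    have "odd r"
    proof
      assume "even r"
      then obtain p where "p \<in> prime_factors n - {2}" "2 dvd p"
        unfolding r_def using prime_dvd_prod_iff[of "prime_factors n - {2}" 2 id] by auto
      then show False
        using primes_dvd_imp_eq[OF two_is_prime_nat, of p] by (auto simp: in_prime_factors_iff)
    qed
    then have cop: "coprime 4 r"
      using coprime_power_left_iff[of 2 2 r] by simp
    have "extended_reduction n = 4 * r" using True r by (simp add: extended_reduction_def)
    then have "extended_reduction n dvd x \<longleftrightarrow> 4 dvd x \<and> r dvd x"
      using cop by (metis divides_mult dvd_mult_left dvd_mult_right)
    moreover have "reduction n dvd x \<longleftrightarrow> 2 dvd x \<and> r dvd x"
      using r \<open>odd r\<close> by (metis divides_mult dvd_mult_left dvd_mult_right coprime_left_2_iff_odd)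
    moreover have "4 dvd x \<Longrightarrow> 2 dvd x" by (meson dvd_trans dvd_numeral_simp even_numeral)
    ultimately show ?thesis using red True by blast
  qed (simp add: red extended_reduction_def)
qed

lemma extended_reduction_dvd: "0 < n \<Longrightarrow> extended_reduction n dvd n"
  by (simp add: extended_reduction_dvd_iff)

section \<open>Exponents of finite groups\<close>

lemma (in group) group_exponent_properties:
  assumes "finite (carrier G)"
  shows group_exponent_pos: "0 < group_exponent G"
    and pow_group_exponent: "g \<in> carrier G \<Longrightarrow> g [^] group_exponent G = \<one>"
proof -
  let ?P = "\<lambda>e. 0 < e \<and> (\<forall>g\<in>carrier G. g [^] (e::nat) = \<one>)"
  have "?P (order G)"
    by (simp add: order_gt_0_iff_finite assms pow_order_eq_1)
  from LeastI[of ?P, OF this] have "?P (group_exponent G)"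
    unfolding group_exponent_def .
  then show "0 < group_exponent G" "g \<in> carrier G \<Longrightarrow> g [^] group_exponent G = \<one>" by blast+
qed

lemma (in group) group_exponent_dvd:
  assumes "finite (carrier G)" "\<And>g. g \<in> carrier G \<Longrightarrow> g [^] (e::nat) = \<one>"
  shows "group_exponent G dvd e"
proof -
  let ?n = "group_exponent G"
  have n: "0 < ?n" using group_exponent_pos[OF assms(1)] .
  have "g [^] (e mod ?n) = \<one>" if g: "g \<in> carrier G" for g
  proof -
    have "ord g dvd e" "ord g dvd ?n"
      using assms(2) pow_group_exponent[OF assms(1)] g by (simp_all flip: pow_eq_id)
    then show ?thesis using g by (simp add: pow_eq_id dvd_mod)
  qed
  then have "\<not> 0 < e mod ?n"
    using not_less_Least[of "e mod ?n" "\<lambda>e. 0 < e \<and> (\<forall>g\<in>carrier G. g [^] e = \<one>)"] n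
    unfolding group_exponent_def[symmetric] by auto
  then show ?thesis by (simp add: dvd_eq_mod_eq_0)
qed

lemma (in comm_group) ord_mult_coprime:
  assumes x: "x \<in> carrier G" and y: "y \<in> carrier G" and "coprime (ord x) (ord y)"
  shows "ord (x \<otimes> y) = ord x * ord y"
proof (rule dvd_antisym)
  show "ord (x \<otimes> y) dvd ord x * ord y" by (rule abelian_ord_mul_divides[OF x y])
  have aux: "ord a dvd ord (a \<otimes> b)"
    if a: "a \<in> carrier G" and b: "b \<in> carrier G" and "coprime (ord a) (ord b)" for a b
  proof -
    let ?k = "ord (a \<otimes> b) * ord b"
    have "(a \<otimes> b) [^] ?k = \<one>" "b [^] ?k = \<one>" using a b by (simp_all add: pow_eq_id)
    then have "a [^] ?k = \<one>" using a b by (simp add: nat_pow_distrib)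
    then have "ord a dvd ?k" using a by (simp add: pow_eq_id)
    then show ?thesis using that by (simp add: coprime_dvd_mult_left_iff)
  qed
  have "ord x dvd ord (x \<otimes> y)" using aux x y assms(3) by blast
  moreover have "ord y dvd ord (x \<otimes> y)"
    using aux[OF y x] assms(3) by (simp add: m_comm[OF x y] coprime_commute)
  ultimately show "ord x * ord y dvd ord (x \<otimes> y)" using assms(3) by (rule divides_mult)
qed

text \<open>An element \<open>a\<close> of maximal order will do. Were the power p ^ j of a prime in
  the order of \<open>b\<close> larger than the power p ^ i in that of \<open>a\<close>, then
  trading the p-part of \<open>a\<close> for that of \<open>b\<close> would raise the order from p ^
  i r to p ^ j r.\<close>

lemma (in comm_group) exists_ord_dvd_ord:
  assumes fin: "finite (carrier G)"
  shows "\<exists>a\<in>carrier G. \<forall>b\<in>carrier G. ord b dvd ord a"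
proof -
  have "Max (ord ` carrier G) \<in> ord ` carrier G" using fin by (intro Max_in) auto
  then obtain a where a: "a \<in> carrier G" and "Max (ord ` carrier G) = ord a" by auto
  then have max: "ord b \<le> ord a" if "b \<in> carrier G" for b
    using that fin by (metis Max_ge finite_imageI image_eqI)
  have pos: "0 < ord b" if "b \<in> carrier G" for b using ord_ge_1[OF fin that] by simp
  have "ord b dvd ord a" if b: "b \<in> carrier G" for b
  proof (rule multiplicity_le_imp_dvd)
    fix p :: nat assume p: "prime p"
    define i j where "i = multiplicity p (ord a)" and "j = multiplicity p (ord b)"
    obtain r where r: "ord a = p ^ i * r" "\<not> p dvd r"
      unfolding i_def using multiplicity_decompose'[of "ord a" p] pos[OF a] p
      by (metis not_prime_unit bot_nat_0.not_eq_extremum)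
    obtain t where t: "ord b = p ^ j * t"
      unfolding j_def using multiplicity_dvd by blast
    have pp: "0 < p" using p prime_gt_0_nat by blast
    have "0 < t" using pos[OF b] t by (metis gr0I mult_0_right less_irrefl)
    have oa: "ord (a [^] (p ^ i)) = r" using a r(1) pp by (subst ord_pow) auto
    have ob: "ord (b [^] t) = p ^ j" using b t \<open>0 < t\<close> by (subst ord_pow) auto
    have "coprime r (p ^ j)" using r(2) p by (simp add: prime_imp_coprime coprime_commute)
    then have "ord (a [^] (p ^ i) \<otimes> b [^] t) = r * p ^ j"
      using a b by (subst ord_mult_coprime) (auto simp: oa ob)
    then have "r * p ^ j \<le> p ^ i * r" using max[of "a [^] (p ^ i) \<otimes> b [^] t"] a b r(1) by simp
    moreover have "0 < r" using r by (metis dvd_0_right gr0I)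
    ultimately have "p ^ j \<le> p ^ i" by simp
    then show "multiplicity p (ord b) \<le> multiplicity p (ord a)"
      using prime_gt_1_nat[OF p] by (simp add: i_def j_def)
  qed (use pos[OF b] pos[OF a] in auto)
  then show ?thesis using a by blast
qed

corollary (in comm_group) exists_ord_eq_group_exponent:
  assumes "finite (carrier G)"
  shows "\<exists>a\<in>carrier G. ord a = group_exponent G"
proof -
  obtain a where a: "a \<in> carrier G" "\<And>b. b \<in> carrier G \<Longrightarrow> ord b dvd ord a"
    using exists_ord_dvd_ord[OF assms] by blast
  have "group_exponent G dvd ord a"
    using a by (intro group_exponent_dvd[OF assms]) (simp add: pow_eq_id)
  moreover have "ord a dvd group_exponent G"
    using a pow_group_exponent[OF assms] by (simp flip: pow_eq_id)
  ultimately show ?thesis using a(1) dvd_antisym by blast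
qed

section \<open>Roots of unity in a field\<close>

context field
begin

lemma roots_card_le_degree:
  assumes "set p \<subseteq> carrier R" "p \<noteq> []" "hd p \<noteq> \<zero>"
  shows "finite {x \<in> carrier R. eval p x = \<zero>}"
    and "card {x \<in> carrier R. eval p x = \<zero>} \<le> length p - 1"
proof -
  have p: "p \<in> carrier (poly_ring R)"
    using assms by (simp add: univ_poly_def polynomial_def)
  have eq: "{x \<in> carrier R. eval p x = \<zero>} = set_mset (roots p)"
    using roots_mem_iff_is_root[OF p] assms(2) by (auto simp: is_root_def)
  show "finite {x \<in> carrier R. eval p x = \<zero>}" by (simp add: eq)
  have "card (set_mset (roots p)) \<le> size (roots p)"
  proof -
    have "card (set_mset (roots p)) = (\<Sum>x\<in>set_mset (roots p). 1)" by simp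
    also have "\<dots> \<le> (\<Sum>x\<in>set_mset (roots p). count (roots p) x)"
      by (intro sum_mono) (simp add: Suc_le_eq)
    finally show ?thesis by (simp add: size_multiset_overloaded_eq)
  qed
  then show "card {x \<in> carrier R. eval p x = \<zero>} \<le> length p - 1"
    using size_roots_le_degree[OF p] by (simp add: eq)
qed

lemma roots_of_one_eq: "0 < m \<Longrightarrow> roots_of_one m R = {x \<in> carrier R. x [^] m = \<one>}"
  by (auto simp: roots_of_one_def nat_pow_zero)

lemma roots_of_one_card_le:
  assumes "0 < m"
  shows finite_roots_of_one: "finite (roots_of_one m R)"
    and card_roots_of_one_le: "card (roots_of_one m R) \<le> m"
proof -
  \<comment> \<open>T ^ m - 1, with its coefficients listed from the leading one down.\<close>
  define p where "p = \<one> # replicate (m - 1) \<zero> @ [\<ominus> \<one>]"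
  have "eval p x = x [^] m \<ominus> \<one>" if "x \<in> carrier R" for x
    using that assms by (simp add: p_def eval_replicate minus_eq)
  then have eq: "roots_of_one m R = {x \<in> carrier R. eval p x = \<zero>}"
    using assms by (auto simp: roots_of_one_eq)
  have p: "set p \<subseteq> carrier R" "p \<noteq> []" "hd p \<noteq> \<zero>" by (auto simp: p_def)
  have len: "length p = Suc m" using assms by (simp add: p_def)
  show "finite (roots_of_one m R)" unfolding eq by (rule roots_card_le_degree(1)[OF p])
  show "card (roots_of_one m R) \<le> m"
    using roots_card_le_degree(2)[OF p] len unfolding eq by simp
qed

text \<open>If \<open>m\<close> vanished in the field, the polynomial \<open>1 + T + \<dots> + T^(m-1)\<close> would have \<open>m\<close> roots,
  namely \<open>1\<close> and the nontrivial powers of \<open>x\<close>.\<close>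
lemma ord_not_zero_in_field:
  fixes m :: nat
  assumes x: "x \<in> carrier R" "x [^] m = \<one>" and "1 < m"
    and ord: "\<And>i. 0 < i \<Longrightarrow> i < m \<Longrightarrow> x [^] i \<noteq> \<one>"
  shows "[m] \<cdot> \<one> \<noteq> \<zero>"
proof
  assume zero: "[m] \<cdot> \<one> = \<zero>"
  let ?p = "\<lambda>k. replicate k \<one>"
  have step: "(y \<ominus> \<one>) \<otimes> eval (?p k) y = y [^] k \<ominus> \<one>" if y: "y \<in> carrier R" for y k
  proof (induction k)
    case (Suc k)
    have c: "eval (?p k) y \<in> carrier R" by (rule eval_in_carrier) (use y in auto)
    have "(y \<ominus> \<one>) \<otimes> eval (?p (Suc k)) y = (y \<ominus> \<one>) \<otimes> y [^] k \<oplus> (y \<ominus> \<one>) \<otimes> eval (?p k) y"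
      using y c by (simp add: r_distr)
    also have "\<dots> = y [^] Suc k \<ominus> \<one>"
      unfolding Suc nat_pow_Suc using y nat_pow_closed[OF y, of k] by algebra
    finally show ?case .
  qed (use y in \<open>simp add: minus_eq r_neg\<close>)
  have one: "eval (?p k) \<one> = [k] \<cdot> \<one>" for k
    by (induction k) (auto simp: add.nat_pow_Suc a_comm)
  have root: "eval (?p m) (x [^] i) = \<zero>" if "i < m" for i
  proof (cases "i = 0")
    case False
    let ?y = "x [^] i"
    have y: "?y \<in> carrier R" using x by simp
    have "?y [^] m = \<one>" using x by (metis nat_pow_pow mult.commute nat_pow_one)
    then have "(?y \<ominus> \<one>) \<otimes> eval (?p m) ?y = \<zero>" using step[OF y] by (simp add: minus_eq r_neg)
    moreover have "?y \<ominus> \<one> \<noteq> \<zero>" using ord[of i] False that y by simp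
    moreover have "eval (?p m) ?y \<in> carrier R" by (rule eval_in_carrier) (use y in auto)
    ultimately show ?thesis using integral y by (metis minus_closed one_closed)
  qed (use one zero in simp)
  have "inj_on (\<lambda>i. x [^] i) {..<m}"
  proof -
    have False if "x [^] i = x [^] j" "i < j" "j < m" for i j
    proof -
      have "x \<noteq> \<zero>" using x(2) \<open>1 < m\<close> by (auto simp: nat_pow_zero)
      then have nz: "x [^] i \<noteq> \<zero>" using x(1) by (induction i) (auto simp: integral_iff)
      have "x [^] i \<otimes> x [^] (j - i) = x [^] (i + (j - i))" by (rule nat_pow_mult[OF x(1)])
      also have "\<dots> = x [^] i \<otimes> \<one>" using that x by simp
      finally have "x [^] i \<otimes> x [^] (j - i) = x [^] i \<otimes> \<one>" .
      then have "x [^] (j - i) = \<one>" using nz x by (subst (asm) m_lcancel) auto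
      then show False using ord[of "j - i"] that by simp
    qed
    then show ?thesis by (metis inj_onI lessThan_iff linorder_neqE_nat)
  qed
  then have "m = card ((\<lambda>i. x [^] i) ` {..<m})" by (simp add: card_image)
  also have "\<dots> \<le> card {y \<in> carrier R. eval (?p m) y = \<zero>}"
    using root x \<open>1 < m\<close> by (intro card_mono roots_card_le_degree(1)) auto
  also have "\<dots> \<le> m - 1"
    using roots_card_le_degree(2)[of "?p m"] \<open>1 < m\<close> by auto
  finally show False using \<open>1 < m\<close> by simp
qed

text \<open>Two constants of the library share the name \<open>mult_of\<close>.\<close>
lemma mult_of_eq: "mult_of R = Multiplicative_Group.mult_of R"
  by (simp add: Ring_Divisibility.mult_of_def Multiplicative_Group.mult_of_def)

lemma group_mult_of: "group (mult_of R)"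
  unfolding mult_of_eq by (rule field_mult_group)

lemma subgroup_roots_of_one: "subgroup (roots_of_one m R) (mult_of R)"
proof -
  interpret M: group "mult_of R" by (rule group_mult_of)
  have inv: "inv\<^bsub>mult_of R\<^esub> x \<in> roots_of_one m R" if "x \<in> roots_of_one m R" for x
  proof -
    have x: "x \<in> carrier (mult_of R)" "x [^]\<^bsub>mult_of R\<^esub> m = \<one>\<^bsub>mult_of R\<^esub>"
      using that by (auto simp: roots_of_one_def nat_pow_mult_of)
    then have "inv\<^bsub>mult_of R\<^esub> x [^]\<^bsub>mult_of R\<^esub> m = \<one>\<^bsub>mult_of R\<^esub>"
      using M.nat_pow_inv[OF x(1), of m] by simp
    then show ?thesis
      using M.inv_closed[OF x(1)] by (auto simp: roots_of_one_def nat_pow_mult_of)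
  qed
  have mem: "x \<in> roots_of_one m R \<longleftrightarrow> x \<in> carrier R \<and> x \<noteq> \<zero> \<and> x [^] m = \<one>" for x
    by (auto simp: roots_of_one_def)
  show ?thesis
  proof (rule M.subgroupI)
    have "\<one> \<in> roots_of_one m R" by (simp add: mem)
    then show "roots_of_one m R \<noteq> {}" by blast
    show "x \<otimes>\<^bsub>mult_of R\<^esub> y \<in> roots_of_one m R"
      if "x \<in> roots_of_one m R" "y \<in> roots_of_one m R" for x y
      using that by (simp add: mem nat_pow_distrib integral_iff)
      show "roots_of_one m R \<subseteq> carrier (mult_of R)" by (auto simp: mem)
  qed (rule inv)
qed

lemma comm_group_roots_of_one: "comm_group (roots_of_one_group m R)"
proof (rule group.group_comm_groupI)
  show "group (roots_of_one_group m R)"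
    unfolding roots_of_one_group_def
    by (rule group.subgroup_imp_group[OF group_mult_of subgroup_roots_of_one])
qed (auto simp: roots_of_one_group_def roots_of_one_def m_comm)

lemma roots_of_one_group_simps [simp]:
  "carrier (roots_of_one_group m R) = roots_of_one m R"
  "x \<otimes>\<^bsub>roots_of_one_group m R\<^esub> y = x \<otimes> y"
  "\<one>\<^bsub>roots_of_one_group m R\<^esub> = \<one>"
  by (auto simp: roots_of_one_group_def)

lemma pow_roots_of_one_group [simp]: "x [^]\<^bsub>roots_of_one_group m R\<^esub> (k::nat) = x [^] k"
  by (simp add: roots_of_one_group_def nat_pow_def)

text \<open>Take \<zeta> whose order \<open>m\<close> is divisible by all orders. Then the
  \<open>n\<close> roots of unity all satisfy T ^ m = 1, an equation with at most \<open>m\<close>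
  solutions; so m = n, and the powers of \<zeta> exhaust them.\<close>

lemma roots_of_one_cyclic:
  assumes n: "0 < n" and card: "card (roots_of_one n R) = n"
  obtains \<zeta> where "\<zeta> \<in> roots_of_one n R"
    "\<And>z. z \<in> roots_of_one n R \<Longrightarrow> \<exists>i::nat. z = \<zeta> [^] i"
    "\<And>k::nat. \<zeta> [^] k = \<one> \<longleftrightarrow> n dvd k"
proof -
  let ?M = "roots_of_one_group n R"
  interpret M: comm_group ?M by (rule comm_group_roots_of_one)
  have fin: "finite (carrier ?M)" using finite_roots_of_one[OF n] by simp
  obtain \<zeta> where \<zeta>: "\<zeta> \<in> roots_of_one n R"
    "\<And>b. b \<in> roots_of_one n R \<Longrightarrow> M.ord b dvd M.ord \<zeta>"
    using M.exists_ord_dvd_ord[OF fin] by auto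
  let ?m = "M.ord \<zeta>"
  have m: "0 < ?m" using M.ord_ge_1[OF fin, of \<zeta>] \<zeta> by simp
  have "roots_of_one n R \<subseteq> roots_of_one ?m R"
  proof
    fix b assume b: "b \<in> roots_of_one n R"
    then have "b [^] ?m = \<one>" using M.pow_eq_id[of b ?m] \<zeta>(2)[OF b] by simp
    then show "b \<in> roots_of_one ?m R" using b by (simp add: roots_of_one_def)
  qed
  then have "card (roots_of_one n R) \<le> card (roots_of_one ?m R)"
    by (rule card_mono[OF finite_roots_of_one[OF m]])
  then have "n \<le> ?m" using card_roots_of_one_le[OF m] card by linarith
  moreover have "?m dvd n" using \<zeta>(1) M.pow_eq_id[of \<zeta> n] by (simp add: roots_of_one_def)
  ultimately have mn: "?m = n" using n by (simp add: dvd_imp_le le_antisym)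
  have pow: "\<zeta> [^] k = \<one> \<longleftrightarrow> n dvd k" for k :: nat
    using M.pow_eq_id[of \<zeta> k] \<zeta>(1) mn by simp
  have "(\<lambda>i::nat. \<zeta> [^] i) ` {0..?m - 1} = roots_of_one n R"
  proof (rule card_subset_eq)
    show "(\<lambda>i::nat. \<zeta> [^] i) ` {0..?m - 1} \<subseteq> roots_of_one n R"
      using M.nat_pow_closed[of \<zeta>] \<zeta>(1) by auto
    have "inj_on (\<lambda>i::nat. \<zeta> [^] i) {0..?m - 1}"
      using M.ord_inj[of \<zeta>] \<zeta>(1) by simp
    then show "card ((\<lambda>i::nat. \<zeta> [^] i) ` {0..?m - 1}) = card (roots_of_one n R)"
      using card mn n by (simp add: card_image)
  qed (use fin in simp)
  then have "\<exists>i::nat. z = \<zeta> [^] i" if "z \<in> roots_of_one n R" for z using that by blast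
  then show ?thesis by (rule that[OF \<zeta>(1) _ pow])
qed

end

section \<open>The Galois group and its action\<close>

locale finite_galois = field L for L :: "('a, 'b) ring_scheme" (structure) +
  fixes K :: "'a set" and G :: "('a \<Rightarrow> 'a) monoid"
  assumes galois: "finite_galois_extension L K"
    and G_eq: "G = galois_group L K"
begin

lemma K_subfield: "subfield K L"
  using galois by (simp add: finite_galois_extension_def)

lemma K_subset: "x \<in> K \<Longrightarrow> x \<in> carrier L"
  using subfieldE(3)[OF K_subfield] by blast

lemma K_closed:
  "\<one> \<in> K" "\<zero> \<in> K"
  "x \<in> K \<Longrightarrow> y \<in> K \<Longrightarrow> x \<oplus> y \<in> K"
  "x \<in> K \<Longrightarrow> y \<in> K \<Longrightarrow> x \<otimes> y \<in> K"
  "x \<in> K \<Longrightarrow> \<ominus> x \<in> K"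
  using subringE[OF subfieldE(1)[OF K_subfield]] by auto

lemma K_inv: "x \<in> K \<Longrightarrow> x \<noteq> \<zero> \<Longrightarrow> inv x \<in> K"
  using subfield_m_inv(1)[OF K_subfield] by blast

lemma G_carrier:
  "\<phi> \<in> carrier G \<longleftrightarrow> \<phi> \<in> ring_hom L L \<and> \<phi> \<in> Bij (carrier L) \<and> (\<forall>x\<in>K. \<phi> x = x)"
  by (auto simp: G_eq galois_group_def)

lemma G_hom:
  assumes "\<phi> \<in> carrier G"
  shows G_closed [simp]: "x \<in> carrier L \<Longrightarrow> \<phi> x \<in> carrier L"
    and G_add [simp]: "x \<in> carrier L \<Longrightarrow> y \<in> carrier L \<Longrightarrow> \<phi> (x \<oplus> y) = \<phi> x \<oplus> \<phi> y"
    and G_mult [simp]: "x \<in> carrier L \<Longrightarrow> y \<in> carrier L \<Longrightarrow> \<phi> (x \<otimes> y) = \<phi> x \<otimes> \<phi> y"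
    and G_one [simp]: "\<phi> \<one> = \<one>"
  using assms by (auto simp: G_carrier ring_hom_def)

lemma G_fixes_K: "\<phi> \<in> carrier G \<Longrightarrow> x \<in> K \<Longrightarrow> \<phi> x = x"
  by (simp add: G_carrier)

lemma fixed_iff_K:
  "x \<in> carrier L \<Longrightarrow> (\<forall>\<phi>\<in>carrier G. \<phi> x = x) \<longleftrightarrow> x \<in> K"
  using galois unfolding finite_galois_extension_def G_eq by blast

lemma G_ring_hom: "\<phi> \<in> carrier G \<Longrightarrow> ring_hom_cring L L \<phi>"
  by (intro ring_hom_cringI is_cring) (auto simp: G_carrier)

lemma G_zero [simp]: "\<phi> \<in> carrier G \<Longrightarrow> \<phi> \<zero> = \<zero>"
  by (simp add: G_fixes_K K_closed)

lemma G_minus [simp]: "\<phi> \<in> carrier G \<Longrightarrow> x \<in> carrier L \<Longrightarrow> \<phi> (\<ominus> x) = \<ominus> \<phi> x"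
  using ring_hom_cring.hom_a_inv[OF G_ring_hom] by blast

lemma G_pow [simp]: "\<phi> \<in> carrier G \<Longrightarrow> x \<in> carrier L \<Longrightarrow> \<phi> (x [^] (k::nat)) = \<phi> x [^] k"
  by (induction k) auto

lemma G_finsum:
  "\<phi> \<in> carrier G \<Longrightarrow> f \<in> A \<rightarrow> carrier L \<Longrightarrow> \<phi> (\<Oplus>i\<in>A. f i) = (\<Oplus>i\<in>A. \<phi> (f i))"
  by (subst ring_hom_cring.hom_finsum[OF G_ring_hom]) (simp_all add: comp_def)

lemma G_inj:
  "\<phi> \<in> carrier G \<Longrightarrow> x \<in> carrier L \<Longrightarrow> y \<in> carrier L \<Longrightarrow> \<phi> x = \<phi> y \<longleftrightarrow> x = y"
  unfolding G_carrier Bij_def bij_betw_def by (blast dest: inj_onD)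

lemma G_eq_zero_iff [simp]: "\<phi> \<in> carrier G \<Longrightarrow> x \<in> carrier L \<Longrightarrow> \<phi> x = \<zero> \<longleftrightarrow> x = \<zero>"
  using G_inj[of \<phi> x \<zero>] by simp

lemma inv_nonzero [simp]:
  "x \<in> carrier L \<Longrightarrow> x \<noteq> \<zero> \<Longrightarrow> inv x \<in> carrier L"
  "x \<in> carrier L \<Longrightarrow> x \<noteq> \<zero> \<Longrightarrow> x \<otimes> inv x = \<one>"
  "x \<in> carrier L \<Longrightarrow> x \<noteq> \<zero> \<Longrightarrow> inv x \<otimes> x = \<one>"
  "x \<in> carrier L \<Longrightarrow> x \<noteq> \<zero> \<Longrightarrow> inv x \<noteq> \<zero>"
  using field_Units Units_inv_Units[of x] by auto

lemma G_inv [simp]: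
  assumes "\<phi> \<in> carrier G" "x \<in> carrier L" "x \<noteq> \<zero>"
  shows "\<phi> (inv x) = inv (\<phi> x)"
proof (rule comm_inv_char[symmetric])
  show "\<phi> x \<otimes> \<phi> (inv x) = \<one>" using assms by (simp flip: G_mult)
qed (use assms in auto)

lemma G_ext:
  "\<phi> \<in> carrier G \<Longrightarrow> \<tau> \<in> carrier G \<Longrightarrow> (\<And>x. x \<in> carrier L \<Longrightarrow> \<phi> x = \<tau> x) \<Longrightarrow> \<phi> = \<tau>"
  by (auto simp: G_carrier intro: extensionalityI dest: Bij_imp_extensional)

lemma group_G: "group G"
proof -
  interpret B: group "BijGroup (carrier L)" by (rule group_BijGroup)
  let ?H = "{\<phi> \<in> ring_hom L L \<inter> Bij (carrier L). \<forall>x\<in>K. \<phi> x = x}"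
  have "subgroup ?H (BijGroup (carrier L))"
  proof (rule B.subgroupI)
    show "?H \<subseteq> carrier (BijGroup (carrier L))" by (auto simp: BijGroup_def)
    have "(\<lambda>x\<in>carrier L. x) \<in> ?H"
      using K_subset by (auto simp: id_Bij ring_hom_def)
    then show "?H \<noteq> {}" by blast
  next
    fix \<phi> assume s: "\<phi> \<in> ?H"
    then have hom: "\<phi> \<in> ring_hom L L" and bij: "\<phi> \<in> Bij (carrier L)" by auto
    have K: "inv_into (carrier L) \<phi> x = x" if "x \<in> K" for x
    proof -
      have "inj_on \<phi> (carrier L)" using bij by (simp add: Bij_def bij_betw_def)
      from inv_into_f_f[OF this K_subset[OF that]] show ?thesis using s that by simp
    qed
    have "(\<lambda>x\<in>carrier L. inv_into (carrier L) \<phi> x) \<in> ring_hom L L"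
    proof (rule ring_hom_memI)
      fix x y assume xy: "x \<in> carrier L" "y \<in> carrier L"
      have "inv_into (carrier L) \<phi> (x \<otimes> y)
          = inv_into (carrier L) \<phi> x \<otimes> inv_into (carrier L) \<phi> y"
        by (rule Bij_inv_into_lemma[OF _ bij]) (use hom xy in \<open>auto simp: ring_hom_def\<close>)
      then show "(\<lambda>x\<in>carrier L. inv_into (carrier L) \<phi> x) (x \<otimes> y)
          = (\<lambda>x\<in>carrier L. inv_into (carrier L) \<phi> x) x \<otimes> (\<lambda>x\<in>carrier L. inv_into (carrier L) \<phi> x) y"
        using xy by simp
      have "inv_into (carrier L) \<phi> (x \<oplus> y)
          = inv_into (carrier L) \<phi> x \<oplus> inv_into (carrier L) \<phi> y"
        by (rule Bij_inv_into_lemma[OF _ bij]) (use hom xy in \<open>auto simp: ring_hom_def\<close>)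
      then show "(\<lambda>x\<in>carrier L. inv_into (carrier L) \<phi> x) (x \<oplus> y)
          = (\<lambda>x\<in>carrier L. inv_into (carrier L) \<phi> x) x \<oplus> (\<lambda>x\<in>carrier L. inv_into (carrier L) \<phi> x) y"
        using xy by simp
    qed (use K K_closed Bij_inv_into_mem[OF bij] in auto)
    moreover have "\<forall>x\<in>K. (\<lambda>x\<in>carrier L. inv_into (carrier L) \<phi> x) x = x"
      using K K_subset by simp
    ultimately have "(\<lambda>x\<in>carrier L. inv_into (carrier L) \<phi> x) \<in> ?H"
      using restrict_inv_into_Bij[OF bij] by blast
    then show "inv\<^bsub>BijGroup (carrier L)\<^esub> \<phi> \<in> ?H"
      unfolding inv_BijGroup[OF bij] .
  next
    fix \<phi> \<tau> assume st: "\<phi> \<in> ?H" "\<tau> \<in> ?H"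
    then have bij: "\<phi> \<in> Bij (carrier L)" "\<tau> \<in> Bij (carrier L)" by auto
    have hom: "\<phi> \<in> ring_hom L L" "\<tau> \<in> ring_hom L L" using st by auto
    have "compose (carrier L) \<phi> \<tau> \<in> ring_hom L L"
      using hom[THEN ring_hom_closed] hom[THEN ring_hom_mult] hom[THEN ring_hom_add]
        hom[THEN ring_hom_one]
      by (intro ring_hom_memI) (simp_all add: compose_def)
    moreover have "\<forall>x\<in>K. compose (carrier L) \<phi> \<tau> x = x"
      using st K_subset by (auto simp: compose_def)
    ultimately show "\<phi> \<otimes>\<^bsub>BijGroup (carrier L)\<^esub> \<tau> \<in> ?H"
      using compose_Bij[OF bij] bij by (simp add: BijGroup_def)
  qed
  then show ?thesis
    unfolding G_eq galois_group_def by (rule B.subgroup_imp_group)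
qed

sublocale G: group G by (rule group_G)

lemma G_apply_mult [simp]:
  "\<phi> \<in> carrier G \<Longrightarrow> \<tau> \<in> carrier G \<Longrightarrow> x \<in> carrier L \<Longrightarrow> (\<phi> \<otimes>\<^bsub>G\<^esub> \<tau>) x = \<phi> (\<tau> x)"
  unfolding G_eq by (simp add: galois_group_def BijGroup_def compose_def)

lemma G_apply_one [simp]: "x \<in> carrier L \<Longrightarrow> \<one>\<^bsub>G\<^esub> x = x"
  by (simp add: G_eq galois_group_def BijGroup_def)

lemma G_apply_inv [simp]:
  assumes "\<phi> \<in> carrier G" "x \<in> carrier L"
  shows "\<phi> ((inv\<^bsub>G\<^esub> \<phi>) x) = x" "(inv\<^bsub>G\<^esub> \<phi>) (\<phi> x) = x"
  using assms G_apply_mult[of \<phi> "inv\<^bsub>G\<^esub> \<phi>" x] G_apply_mult[of "inv\<^bsub>G\<^esub> \<phi>" \<phi> x] by simp_all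

lemma G_eval:
  assumes "\<phi> \<in> carrier G" "x \<in> carrier L"
  shows "set p \<subseteq> K \<Longrightarrow> \<phi> (eval p x) = eval p (\<phi> x)"
proof (induction p)
  case (Cons a p)
  have "eval p x \<in> carrier L"
    using Cons.prems K_subset assms by (intro eval_in_carrier) auto
  then show ?case using Cons assms K_subset by (simp add: G_fixes_K)
qed (use assms in simp)

text \<open>An automorphism is determined by its values on a finite spanning list, and each value is
  a root of a polynomial over \<open>K\<close> that its argument satisfies.\<close>

lemma finite_G: "finite (carrier G)"
proof -
  obtain m where "dimension m K (carrier L)"
    using galois finite_dimension_def by (auto simp: finite_galois_extension_def)
  then obtain Us where Us: "set Us \<subseteq> carrier L" "Span K Us = carrier L"
    using exists_base[OF K_subfield] by blast
  have "\<exists>A. finite A \<and> (\<forall>\<phi>\<in>carrier G. \<phi> u \<in> A)" if u: "u \<in> carrier L" for u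
  proof -
    have "(algebraic over K) u"
      using finite_dimension_imp_algebraic[OF K_subfield carrier_is_subring _ u] galois
      by (simp add: finite_galois_extension_def)
    then obtain p where p: "p \<in> carrier (K[X])" "p \<noteq> []" "eval p u = \<zero>"
      using algebraicE[OF subfieldE(1)[OF K_subfield] u] by blast
    have pK: "set p \<subseteq> K" "hd p \<noteq> \<zero>" using p by (auto simp: univ_poly_def polynomial_def)
    let ?A = "{x \<in> carrier L. eval p x = \<zero>}"
    have "finite ?A" using p(2) pK K_subset by (intro roots_card_le_degree(1)) auto
    moreover have "\<phi> u \<in> ?A" if "\<phi> \<in> carrier G" for \<phi>
      using G_eval[OF that u pK(1)] p(3) that u by simp
    ultimately show ?thesis by blast
  qed
  then obtain A where A: "\<And>u. u \<in> carrier L \<Longrightarrow> finite (A u)"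
    "\<And>u \<phi>. u \<in> carrier L \<Longrightarrow> \<phi> \<in> carrier G \<Longrightarrow> \<phi> u \<in> A u" by metis
  have "inj_on (\<lambda>\<phi>. restrict \<phi> (set Us)) (carrier G)"
  proof (rule inj_onI)
    fix \<phi> \<tau> assume st: "\<phi> \<in> carrier G" "\<tau> \<in> carrier G"
      and eq: "restrict \<phi> (set Us) = restrict \<tau> (set Us)"
    \<comment> \<open>The equalizer of the two automorphisms is a \<open>K\<close>-subspace, so it
      is everything as soon as it contains the spanning list.\<close>
    let ?V = "{x \<in> carrier L. \<phi> x = \<tau> x}"
    have "subgroup ?V (add_monoid L)"
    proof (rule add.subgroupI)
      have "\<zero> \<in> ?V" using st by simp
      then show "?V \<noteq> {}" by blast
    qed (use st in \<open>auto simp flip: a_inv_def\<close>)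
    then have "subalgebra K ?V L"
      using st K_subset by (auto simp: subalgebra_def subalgebra_axioms_def G_fixes_K)
    moreover have "set Us \<subseteq> ?V"
      using Us(1) eq by (auto simp: restrict_def fun_eq_iff) metis
    ultimately have "carrier L \<subseteq> ?V"
      using subalgebra_Span_incl[OF K_subfield] Us(2) by blast
    then show "\<phi> = \<tau>" using G_ext[OF st] by blast
  qed
  moreover have "(\<lambda>\<phi>. restrict \<phi> (set Us)) ` carrier G \<subseteq> PiE (set Us) A"
    using A(2) Us(1) by auto
  moreover have "finite (PiE (set Us) A)"
    using A(1) Us(1) by (intro finite_PiE) auto
  ultimately show ?thesis by (metis finite_imageD finite_subset)
qed

lemma order_G_pos: "0 < order G"
  using finite_G G.order_gt_0_iff_finite by blast

lemma fixed_field: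
  assumes "H \<subseteq> carrier G"
  shows "subfield {x \<in> carrier L. \<forall>\<phi>\<in>H. \<phi> x = x} L" (is "subfield ?E L")
proof (rule subfieldI')
  have G: "\<phi> \<in> carrier G" if "\<phi> \<in> H" for \<phi> using assms that by blast
  show "subring ?E L"
  proof (rule subringI)
    show "x \<otimes> y \<in> ?E" "x \<oplus> y \<in> ?E" if "x \<in> ?E" "y \<in> ?E" for x y
      using that G by force+
  qed (use G in force)+
  show "inv x \<in> ?E" if "x \<in> ?E - {\<zero>}" for x
    using that G by force
qed

section \<open>Linear combinations of automorphisms\<close>

text \<open>The combinations, with coefficients in \<open>L\<close>, of the evaluations at points of
  \<open>S\<close>. They are closed under products if \<open>S\<close> is, which makes interpolation
  possible; and a linear relation that holds at the points of \<open>S\<close> extends to all of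
  them.\<close>

inductive_set automorphism_span :: "'a set \<Rightarrow> (('a \<Rightarrow> 'a) \<Rightarrow> 'a) set"
  for S :: "'a set"
where
  single: "c \<in> carrier L \<Longrightarrow> s \<in> S \<Longrightarrow> (\<lambda>\<phi>. c \<otimes> \<phi> s) \<in> automorphism_span S"
| add: "u \<in> automorphism_span S \<Longrightarrow> v \<in> automorphism_span S \<Longrightarrow>
    (\<lambda>\<phi>. u \<phi> \<oplus> v \<phi>) \<in> automorphism_span S"

lemma automorphism_span_closed:
  "w \<in> automorphism_span S \<Longrightarrow> S \<subseteq> carrier L \<Longrightarrow> \<phi> \<in> carrier G \<Longrightarrow> w \<phi> \<in> carrier L"
  by (induction rule: automorphism_span.induct) (auto simp: subset_iff)

text \<open>Evaluations multiply by
  \<open>\<phi> s \<otimes> \<phi> t = \<phi> (s \<otimes> t)\<close>. This is true of homomorphisms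
  \<phi> only, hence the product is matched on \<open>carrier G\<close> and not as a
  function.\<close>

lemma automorphism_span_mult:
  assumes u: "u \<in> automorphism_span S" and v: "v \<in> automorphism_span S"
    and S: "S \<subseteq> carrier L" "\<And>s t. s \<in> S \<Longrightarrow> t \<in> S \<Longrightarrow> s \<otimes> t \<in> S"
  shows "\<exists>w\<in>automorphism_span S. \<forall>\<phi>\<in>carrier G. w \<phi> = u \<phi> \<otimes> v \<phi>"
  using u
proof (induction rule: automorphism_span.induct)
  case (single c s)
  show ?case
    using v
  proof (induction rule: automorphism_span.induct)
    case (single d t)
    have "\<forall>\<phi>\<in>carrier G. c \<otimes> d \<otimes> \<phi> (s \<otimes> t) = c \<otimes> \<phi> s \<otimes> (d \<otimes> \<phi> t)"
      using \<open>c \<in> carrier L\<close> \<open>s \<in> S\<close> single S(1) by (auto simp: subset_iff m_ac)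
    moreover have "(\<lambda>\<phi>. c \<otimes> d \<otimes> \<phi> (s \<otimes> t)) \<in> automorphism_span S"
      using \<open>c \<in> carrier L\<close> \<open>s \<in> S\<close> single S(2) by (intro automorphism_span.single) auto
    ultimately show ?case by (intro bexI)
  next
    case (add v1 v2)
    then obtain w1 w2 where w: "w1 \<in> automorphism_span S" "w2 \<in> automorphism_span S"
      "\<forall>\<phi>\<in>carrier G. w1 \<phi> = c \<otimes> \<phi> s \<otimes> v1 \<phi>" "\<forall>\<phi>\<in>carrier G. w2 \<phi> = c \<otimes> \<phi> s \<otimes> v2 \<phi>"
      by blast
    have "\<forall>\<phi>\<in>carrier G. w1 \<phi> \<oplus> w2 \<phi> = c \<otimes> \<phi> s \<otimes> (v1 \<phi> \<oplus> v2 \<phi>)"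
      using w(3,4) \<open>c \<in> carrier L\<close> \<open>s \<in> S\<close> add.hyps S(1)
      by (auto simp: subset_iff r_distr automorphism_span_closed)
    then show ?case
      using automorphism_span.add[OF w(1,2)] by (intro bexI)
  qed
next
  case (add u1 u2)
  then obtain w1 w2 where w: "w1 \<in> automorphism_span S" "w2 \<in> automorphism_span S"
    "\<forall>\<phi>\<in>carrier G. w1 \<phi> = u1 \<phi> \<otimes> v \<phi>" "\<forall>\<phi>\<in>carrier G. w2 \<phi> = u2 \<phi> \<otimes> v \<phi>"
    by blast
  have "\<forall>\<phi>\<in>carrier G. w1 \<phi> \<oplus> w2 \<phi> = (u1 \<phi> \<oplus> u2 \<phi>) \<otimes> v \<phi>"
    using w(3,4) add.hyps v S(1) by (auto simp: l_distr automorphism_span_closed)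
  then show ?case
    using automorphism_span.add[OF w(1,2)] by (intro bexI)
qed

text \<open>Lagrange interpolation: for automorphisms \<open>\<tau>0\<close> and \<open>\<tau>\<close> that differ at \<open>s\<close>, the function
  \<open>(\<phi> s - \<tau> s) / (\<tau>0 s - \<tau> s)\<close> of \<open>\<phi>\<close> is 1 at \<open>\<tau>0\<close> and 0 at \<open>\<tau>\<close>.\<close>
lemma automorphism_span_indicator:
  assumes S: "S \<subseteq> carrier L" "\<one> \<in> S" "\<And>s t. s \<in> S \<Longrightarrow> t \<in> S \<Longrightarrow> s \<otimes> t \<in> S"
    and \<tau>0: "\<tau>0 \<in> carrier G"
  shows "\<exists>w\<in>automorphism_span S. \<forall>\<phi>\<in>carrier G.
    w \<phi> = (if \<forall>s\<in>S. \<phi> s = \<tau>0 s then \<one> else \<zero>)"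
proof -
  let ?P = "\<lambda>\<phi>. \<forall>s\<in>S. \<phi> s = \<tau>0 s"
  have ex: "\<exists>w\<in>automorphism_span S. (\<forall>\<tau>\<in>T. w \<tau> = \<zero>) \<and> (\<forall>\<phi>\<in>carrier G. ?P \<phi> \<longrightarrow> w \<phi> = \<one>)"
    if "finite T" "T \<subseteq> {\<phi> \<in> carrier G. \<not> ?P \<phi>}" for T
    using that
  proof (induction T rule: finite_induct)
    case empty
    show ?case
      by (intro bexI[of _ "\<lambda>\<phi>. \<one> \<otimes> \<phi> \<one>"] automorphism_span.single) (auto simp: S(2))
  next
    case (insert \<tau> T)
    have "T \<subseteq> {\<phi> \<in> carrier G. \<not> ?P \<phi>}" using insert.prems by blast
    from insert.IH[OF this] obtain v where v: "v \<in> automorphism_span S" "\<forall>\<tau>\<in>T. v \<tau> = \<zero>"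
      "\<forall>\<phi>\<in>carrier G. ?P \<phi> \<longrightarrow> v \<phi> = \<one>" by blast
    obtain s where s: "s \<in> S" "\<tau> s \<noteq> \<tau>0 s" and \<tau>: "\<tau> \<in> carrier G" using insert.prems by blast
    have sL: "s \<in> carrier L" using s S by blast
    define d where "d = \<tau>0 s \<ominus> \<tau> s"
    have d: "d \<in> carrier L" "d \<noteq> \<zero>" using s sL \<tau> \<tau>0 by (auto simp: d_def)
    \<comment> \<open>The constant term is written as a multiple of \<open>\<phi> \<one>\<close> so
      as to be an evaluation as well.\<close>
    define u where "u = (\<lambda>\<phi>. inv d \<otimes> \<phi> s \<oplus> (\<ominus> (inv d \<otimes> \<tau> s)) \<otimes> \<phi> \<one>)"
    have "inv d \<in> carrier L" "\<ominus> (inv d \<otimes> \<tau> s) \<in> carrier L" using d sL \<tau> by simp_all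
    then have u: "u \<in> automorphism_span S"
      unfolding u_def
      by (intro automorphism_span.add automorphism_span.single s(1) S(2))
    have u_eq: "u \<phi> = inv d \<otimes> (\<phi> s \<ominus> \<tau> s)" if "\<phi> \<in> carrier G" for \<phi>
      using that d sL \<tau> by (simp add: u_def minus_eq r_distr r_minus)
    have u_zero: "u \<tau> = \<zero>" using u_eq[OF \<tau>] d sL \<tau> by (simp add: minus_eq r_neg)
    have u_one: "u \<phi> = \<one>" if "\<phi> \<in> carrier G" "?P \<phi>" for \<phi>
    proof -
      have "\<phi> s = \<tau>0 s" by (rule bspec[OF that(2) s(1)])
      then show ?thesis using u_eq[OF that(1)] d by (simp flip: d_def)
    qed
    obtain w where w: "w \<in> automorphism_span S" "\<forall>\<phi>\<in>carrier G. w \<phi> = u \<phi> \<otimes> v \<phi>"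
      using automorphism_span_mult[OF u v(1) S(1,3)] by blast
    have uv: "u \<phi> \<in> carrier L" "v \<phi> \<in> carrier L" if "\<phi> \<in> carrier G" for \<phi>
      using automorphism_span_closed[OF u S(1) that] automorphism_span_closed[OF v(1) S(1) that] by blast+
    have "w \<tau>' = \<zero>" if "\<tau>' \<in> insert \<tau> T" for \<tau>'
    proof (cases "\<tau>' = \<tau>")
      case False
      then have "\<tau>' \<in> T" "\<tau>' \<in> carrier G" using that insert.prems by blast+
      then show ?thesis using w(2) v(2) uv(1)[of \<tau>'] by simp
    qed (use w(2) u_zero uv(2)[OF \<tau>] \<tau> in simp)
    moreover have "w \<phi> = \<one>" if "\<phi> \<in> carrier G" "?P \<phi>" for \<phi>
      using w(2) v(3) u_one that by simp
    ultimately show ?case using w(1) by blast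
  qed
  have "finite {\<phi> \<in> carrier G. \<not> ?P \<phi>}" using finite_G by simp
  from ex[OF this subset_refl] obtain w where w: "w \<in> automorphism_span S"
    "\<forall>\<tau>\<in>{\<phi> \<in> carrier G. \<not> ?P \<phi>}. w \<tau> = \<zero>" "\<forall>\<phi>\<in>carrier G. ?P \<phi> \<longrightarrow> w \<phi> = \<one>"
    by blast
  have "w \<phi> = (if ?P \<phi> then \<one> else \<zero>)" if "\<phi> \<in> carrier G" for \<phi>
    using w(2,3) that by simp
  then show ?thesis using w(1) by blast
qed

lemma automorphism_span_annihilated:
  assumes w: "w \<in> automorphism_span S" and S: "S \<subseteq> carrier L" and x: "x \<in> carrier G \<rightarrow> carrier L"
    and zero: "\<And>s. s \<in> S \<Longrightarrow> (\<Oplus>\<phi>\<in>carrier G. x \<phi> \<otimes> \<phi> s) = \<zero>"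
  shows "(\<Oplus>\<phi>\<in>carrier G. x \<phi> \<otimes> w \<phi>) = \<zero>"
  using w
proof (induction rule: automorphism_span.induct)
  case (single c s)
  have s: "s \<in> carrier L" using single S by blast
  have "(\<Oplus>\<phi>\<in>carrier G. x \<phi> \<otimes> (c \<otimes> \<phi> s)) = (\<Oplus>\<phi>\<in>carrier G. c \<otimes> (x \<phi> \<otimes> \<phi> s))"
    using x s single by (intro finsum_cong') (auto simp: Pi_iff m_lcomm)
  also have "\<dots> = c \<otimes> (\<Oplus>\<phi>\<in>carrier G. x \<phi> \<otimes> \<phi> s)"
    using x s single finite_G by (intro finsum_rdistr[symmetric]) (auto simp: Pi_iff)
  finally show ?case using zero single by simp
next
  case (add u v)
  have "(\<Oplus>\<phi>\<in>carrier G. x \<phi> \<otimes> (u \<phi> \<oplus> v \<phi>)) = (\<Oplus>\<phi>\<in>carrier G. x \<phi> \<otimes> u \<phi> \<oplus> x \<phi> \<otimes> v \<phi>)"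
    using x add.hyps S by (intro finsum_cong') (auto simp: Pi_iff r_distr automorphism_span_closed)
  also have "\<dots> = (\<Oplus>\<phi>\<in>carrier G. x \<phi> \<otimes> u \<phi>) \<oplus> (\<Oplus>\<phi>\<in>carrier G. x \<phi> \<otimes> v \<phi>)"
    using x add.hyps S by (intro finsum_addf) (auto simp: Pi_iff automorphism_span_closed)
  finally show ?case using add.IH by simp
qed

text \<open>Dedekind's independence, by interpolation: the indicator of \<tau> is a combination of
  evaluations, and the relation summed against it isolates the coefficient of \<tau>.\<close>

lemma automorphisms_independent:
  assumes x: "x \<in> carrier G \<rightarrow> carrier L"
    and zero: "\<And>a. a \<in> carrier L \<Longrightarrow> (\<Oplus>\<phi>\<in>carrier G. x \<phi> \<otimes> \<phi> a) = \<zero>"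
    and \<tau>: "\<tau> \<in> carrier G"
  shows "x \<tau> = \<zero>"
proof -
  obtain w where w: "w \<in> automorphism_span (carrier L)"
    "\<forall>\<phi>\<in>carrier G. w \<phi> = (if \<forall>s\<in>carrier L. \<phi> s = \<tau> s then \<one> else \<zero>)"
    using automorphism_span_indicator[OF subset_refl one_closed m_closed \<tau>] by blast
  have "w \<phi> = (if \<tau> = \<phi> then \<one> else \<zero>)" if "\<phi> \<in> carrier G" for \<phi>
    using w(2) that G_ext[OF that \<tau>] by auto
  then have "(\<Oplus>\<phi>\<in>carrier G. x \<phi> \<otimes> w \<phi>) = (\<Oplus>\<phi>\<in>carrier G. if \<tau> = \<phi> then x \<phi> else \<zero>)"
    using x by (intro finsum_cong') (auto simp: Pi_iff)
  also have "\<dots> = x \<tau>" using finite_G \<tau> x by (intro finsum_singleton)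
  finally show ?thesis
    using automorphism_span_annihilated[OF w(1) subset_refl x zero] by simp
qed

section \<open>Traces and the fixed field of a stabilizer\<close>

definition trace :: "('a \<Rightarrow> 'a) set \<Rightarrow> 'a \<Rightarrow> 'a"
  where "trace H a = (\<Oplus>\<tau>\<in>H. \<tau> a)"

lemma trace_closed [simp]:
  "H \<subseteq> carrier G \<Longrightarrow> a \<in> carrier L \<Longrightarrow> trace H a \<in> carrier L"
  unfolding trace_def by (intro finsum_closed) auto

lemma finsum_left_translate:
  assumes H: "subgroup H G" and \<phi>: "\<phi> \<in> H" and f: "f \<in> H \<rightarrow> carrier L"
  shows "(\<Oplus>\<tau>\<in>H. f (\<phi> \<otimes>\<^bsub>G\<^esub> \<tau>)) = (\<Oplus>\<tau>\<in>H. f \<tau>)"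
proof -
  interpret H: subgroup H G by (rule H)
  have im: "(\<lambda>\<tau>. \<phi> \<otimes>\<^bsub>G\<^esub> \<tau>) ` H = H"
  proof
    show "H \<subseteq> (\<lambda>\<tau>. \<phi> \<otimes>\<^bsub>G\<^esub> \<tau>) ` H"
    proof
      fix \<tau> assume "\<tau> \<in> H"
      then show "\<tau> \<in> (\<lambda>\<tau>. \<phi> \<otimes>\<^bsub>G\<^esub> \<tau>) ` H"
        using \<phi> by (intro image_eqI[of _ _ "inv\<^bsub>G\<^esub> \<phi> \<otimes>\<^bsub>G\<^esub> \<tau>"]) (auto simp flip: G.m_assoc)
    qed
  qed (use \<phi> in auto)
  have "inj_on (\<lambda>\<tau>. \<phi> \<otimes>\<^bsub>G\<^esub> \<tau>) H" using \<phi> by (auto intro!: inj_onI)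
  then have "(\<Oplus>\<tau>\<in>(\<lambda>\<tau>. \<phi> \<otimes>\<^bsub>G\<^esub> \<tau>) ` H. f \<tau>) = (\<Oplus>\<tau>\<in>H. f (\<phi> \<otimes>\<^bsub>G\<^esub> \<tau>))"
    using f im by (intro add.finprod_reindex) auto
  then show ?thesis by (simp add: im)
qed

lemma trace_fixed:
  assumes H: "subgroup H G" and \<phi>: "\<phi> \<in> H" and a: "a \<in> carrier L"
  shows "\<phi> (trace H a) = trace H a"
proof -
  have HG: "H \<subseteq> carrier G" using H by (rule subgroup.subset)
  have "\<phi> (trace H a) = (\<Oplus>\<tau>\<in>H. \<phi> (\<tau> a))"
    unfolding trace_def using HG \<phi> a by (intro G_finsum) auto
  also have "\<dots> = (\<Oplus>\<tau>\<in>H. (\<phi> \<otimes>\<^bsub>G\<^esub> \<tau>) a)"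
    using HG \<phi> a by (intro finsum_cong') (auto simp: subset_iff)
  also have "\<dots> = trace H a"
    unfolding trace_def using HG a by (intro finsum_left_translate[OF H \<phi>]) auto
  finally show ?thesis .
qed

lemma trace_in_K: "a \<in> carrier L \<Longrightarrow> trace (carrier G) a \<in> K"
  by (subst fixed_iff_K[symmetric]) (auto intro: trace_fixed G.subgroup_self)

text \<open>Independence, applied to the coefficients 1 on \<open>H\<close> and 0 elsewhere. The
  trace of 1 would not do, as the order of \<open>H\<close> may vanish in \<open>L\<close>.\<close>

lemma trace_nonzero:
  assumes H: "subgroup H G"
  shows "\<exists>a\<in>carrier L. trace H a \<noteq> \<zero>"
proof (rule ccontr)
  assume *: "\<not> ?thesis"
  have HG: "H \<subseteq> carrier G" using H by (rule subgroup.subset)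
  let ?x = "\<lambda>\<phi>. if \<phi> \<in> H then \<one> else \<zero>"
  have "(\<Oplus>\<phi>\<in>carrier G. ?x \<phi> \<otimes> \<phi> a) = \<zero>" if a: "a \<in> carrier L" for a
  proof -
    have "(\<Oplus>\<phi>\<in>carrier G. ?x \<phi> \<otimes> \<phi> a) = (\<Oplus>\<phi>\<in>H. \<phi> a)"
      using HG a finite_G
      by (intro add.finprod_mono_neutral_cong_right) (auto simp: subset_iff)
    also have "\<dots> = \<zero>" using * a unfolding trace_def by blast
    finally show ?thesis .
  qed
  then have "?x \<one>\<^bsub>G\<^esub> = \<zero>"
    by (rule automorphisms_independent[rotated]) auto
  then show False using subgroup.one_closed[OF H] by simp
qed

text \<open>The indicator of the stabilizer of \<open>S\<close> is a combination of the evaluations at points of \<open>S\<close>;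
  conjugating and summing turns its coefficients into traces, which lie in \<open>K\<close>.\<close>
lemma fixed_by_stabilizer_in_span:
  assumes S: "S \<subseteq> carrier L" "\<one> \<in> S" "\<And>s t. s \<in> S \<Longrightarrow> t \<in> S \<Longrightarrow> s \<otimes> t \<in> S"
    and V: "\<And>u v. u \<in> V \<Longrightarrow> v \<in> V \<Longrightarrow> u \<oplus> v \<in> V" "\<And>k s. k \<in> K \<Longrightarrow> s \<in> S \<Longrightarrow> k \<otimes> s \<in> V"
    and x: "x \<in> carrier L"
      "\<And>\<phi>. \<phi> \<in> carrier G \<Longrightarrow> (\<And>s. s \<in> S \<Longrightarrow> \<phi> s = s) \<Longrightarrow> \<phi> x = x"
  shows "x \<in> V"
proof -
  define H where "H = {\<phi> \<in> carrier G. \<forall>s\<in>S. \<phi> s = s}"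
  have inv: "(inv\<^bsub>G\<^esub> \<phi>) s = s" if "\<phi> \<in> carrier G" "s \<in> S" "\<phi> s = s" for \<phi> s
    using G_apply_inv(2)[of \<phi> s] that S(1) by auto
  have HG: "H \<subseteq> carrier G" by (auto simp: H_def)
  have H: "subgroup H G"
  proof (rule G.subgroupI)
    have "\<one>\<^bsub>G\<^esub> \<in> H" using S(1) by (auto simp: H_def)
    then show "H \<noteq> {}" by blast
  next
    show "inv\<^bsub>G\<^esub> \<phi> \<in> H" if "\<phi> \<in> H" for \<phi>
      using that inv by (simp add: H_def)
  next
    show "\<phi> \<otimes>\<^bsub>G\<^esub> \<tau> \<in> H" if "\<phi> \<in> H" "\<tau> \<in> H" for \<phi> \<tau>
      using that S(1) by (simp add: H_def subset_iff)
  qed (rule HG)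
  \<comment> \<open>For the evaluation at \<open>s\<close> with coefficient \<open>c\<close>, the
    outer \<tau> cancels the inner inverse at \<open>s\<close>. So \<open>s\<close> leaves the sum,
    and its factor becomes the trace of a c.\<close>
  have in_V: "(\<Oplus>\<tau>\<in>carrier G. \<tau> (a \<otimes> w (inv\<^bsub>G\<^esub> \<tau>))) \<in> V"
    if "w \<in> automorphism_span S" "a \<in> carrier L" for w a
    using that(1)
  proof (induction rule: automorphism_span.induct)
    case (single c s)
    have s: "s \<in> carrier L" using single S by blast
    have "(\<Oplus>\<tau>\<in>carrier G. \<tau> (a \<otimes> (c \<otimes> (inv\<^bsub>G\<^esub> \<tau>) s))) = (\<Oplus>\<tau>\<in>carrier G. \<tau> (a \<otimes> c) \<otimes> s)"
      using s single that(2) by (intro finsum_cong') (auto simp: m_assoc)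
    also have "\<dots> = trace (carrier G) (a \<otimes> c) \<otimes> s"
      unfolding trace_def using s single that(2) finite_G by (intro finsum_ldistr[symmetric]) auto
    finally show ?case using V(2) single that(2) trace_in_K by simp
  next
    case (add u v)
    have uv: "u (inv\<^bsub>G\<^esub> \<tau>) \<in> carrier L" "v (inv\<^bsub>G\<^esub> \<tau>) \<in> carrier L" if "\<tau> \<in> carrier G" for \<tau>
      using add.hyps S(1) that by (auto simp: automorphism_span_closed)
    have "(\<Oplus>\<tau>\<in>carrier G. \<tau> (a \<otimes> (u (inv\<^bsub>G\<^esub> \<tau>) \<oplus> v (inv\<^bsub>G\<^esub> \<tau>))))
      = (\<Oplus>\<tau>\<in>carrier G. \<tau> (a \<otimes> u (inv\<^bsub>G\<^esub> \<tau>)) \<oplus> \<tau> (a \<otimes> v (inv\<^bsub>G\<^esub> \<tau>)))"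
      using uv that(2) by (intro finsum_cong') (auto simp: r_distr)
    also have "\<dots> = (\<Oplus>\<tau>\<in>carrier G. \<tau> (a \<otimes> u (inv\<^bsub>G\<^esub> \<tau>))) \<oplus> (\<Oplus>\<tau>\<in>carrier G. \<tau> (a \<otimes> v (inv\<^bsub>G\<^esub> \<tau>)))"
      using uv that(2) by (intro finsum_addf) auto
    finally show ?case using V(1) add.IH by simp
  qed
  obtain w where w: "w \<in> automorphism_span S"
    "\<forall>\<phi>\<in>carrier G. w \<phi> = (if \<forall>s\<in>S. \<phi> s = \<one>\<^bsub>G\<^esub> s then \<one> else \<zero>)"
    using automorphism_span_indicator[OF S G.one_closed] by blast
  have w_inv: "w (inv\<^bsub>G\<^esub> \<tau>) = (if \<tau> \<in> H then \<one> else \<zero>)" if "\<tau> \<in> carrier G" for \<tau>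
  proof -
    have "inv\<^bsub>G\<^esub> \<tau> \<in> H \<longleftrightarrow> \<tau> \<in> H"
      using H that by (metis G.inv_inv subgroup.m_inv_closed)
    moreover have "w (inv\<^bsub>G\<^esub> \<tau>) = (if inv\<^bsub>G\<^esub> \<tau> \<in> H then \<one> else \<zero>)"
    proof -
      have "inv\<^bsub>G\<^esub> \<tau> \<in> H \<longleftrightarrow> (\<forall>s\<in>S. (inv\<^bsub>G\<^esub> \<tau>) s = \<one>\<^bsub>G\<^esub> s)"
        using that S(1) by (simp add: H_def subset_iff)
      then show ?thesis using w(2) G.inv_closed[OF that] by simp
    qed
    ultimately show ?thesis by simp
  qed
  have trace_V: "trace H a \<in> V" if a: "a \<in> carrier L" for a
  proof -
    have "(\<Oplus>\<tau>\<in>carrier G. \<tau> (a \<otimes> w (inv\<^bsub>G\<^esub> \<tau>))) = (\<Oplus>\<tau>\<in>H. \<tau> a)"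
      using HG a finite_G w_inv
      by (intro add.finprod_mono_neutral_cong_right) (auto simp: subset_iff)
    then show ?thesis using in_V[OF w(1) a] by (simp add: trace_def)
  qed
  obtain b where b: "b \<in> carrier L" "trace H b \<noteq> \<zero>" using trace_nonzero[OF H] by blast
  define t where "t = trace H b"
  have t: "t \<in> carrier L" "t \<noteq> \<zero>" using b HG by (simp_all add: t_def)
  \<comment> \<open>So far only traces over \<open>H\<close> are known to lie in \<open>V\<close>.
    As \<open>y\<close> is fixed by \<open>H\<close>, it can be pulled out of the trace of b y,
    which is therefore t y = x.\<close>
  define y where "y = x \<otimes> inv t"
  have y: "y \<in> carrier L" using x(1) t by (simp add: y_def)
  have fix_y: "\<tau> y = y" if "\<tau> \<in> H" for \<tau>
  proof -
    have "\<tau> \<in> carrier G" "\<tau> x = x" using that x(2)[of \<tau>] by (simp_all add: H_def)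
    moreover have "\<tau> t = t" unfolding t_def by (rule trace_fixed[OF H that b(1)])
    ultimately show ?thesis using x(1) t by (simp add: y_def)
  qed
  have "trace H (b \<otimes> y) = (\<Oplus>\<tau>\<in>H. \<tau> b \<otimes> y)"
    unfolding trace_def
  proof (rule finsum_cong')
    show "\<tau> (b \<otimes> y) = \<tau> b \<otimes> y" if "\<tau> \<in> H" for \<tau>
      using that HG b(1) y fix_y[OF that] by (simp add: subset_iff)
  qed (use HG b(1) y in auto)
  also have "\<dots> = t \<otimes> y"
    unfolding trace_def t_def using HG b(1) y finite_subset[OF HG finite_G]
    by (intro finsum_ldistr[symmetric]) auto
  also have "\<dots> = x \<otimes> (t \<otimes> inv t)"
    unfolding y_def using t x(1) by (intro m_lcomm) auto
  also have "\<dots> = x" using t x(1) by simp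
  finally show ?thesis using trace_V[of "b \<otimes> y"] b(1) y by simp
qed

end

section \<open>Homogeneous linear systems\<close>

text \<open>Induction on the equations. With any chosen unknown set to zero there are still enough
  unknowns to solve all equations but one. Take such a solution \<open>x\<close>, a coordinate
  \<open>i1\<close> where it is nonzero, and a solution \<open>y\<close> that vanishes at
  \<open>i1\<close>. If neither solves the last equation, a combination does, and it stays nonzero
  at \<open>i1\<close>.\<close>

lemma (in field) homogeneous_system_nontrivial_solution:
  assumes "finite J" "finite I" "card J < card I"
    and "\<And>j i. j \<in> J \<Longrightarrow> i \<in> I \<Longrightarrow> a j i \<in> carrier R"
  shows "\<exists>x. x \<in> I \<rightarrow> carrier R \<and> (\<exists>i\<in>I. x i \<noteq> \<zero>) \<and> (\<forall>j\<in>J. (\<Oplus>i\<in>I. a j i \<otimes> x i) = \<zero>)"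
  using assms
proof (induction J arbitrary: I rule: finite_induct)
  case empty
  then have "I \<noteq> {}" by auto
  then show ?case by (intro exI[of _ "\<lambda>_. \<one>"]) auto
next
  case (insert j J)
  let ?S = "\<lambda>j x. \<Oplus>i\<in>I. a j i \<otimes> x i"
  have a: "a j' i \<in> carrier R" if "j' \<in> insert j J" "i \<in> I" for j' i using insert.prems(3) that .
  have solve: "\<exists>x. x \<in> I \<rightarrow> carrier R \<and> x i0 = \<zero> \<and> (\<exists>i\<in>I. x i \<noteq> \<zero>) \<and> (\<forall>j\<in>J. ?S j x = \<zero>)"
    if i0: "i0 \<in> I" for i0
  proof -
    have "card J < card (I - {i0})" using insert i0 by simp
    have "\<exists>x. x \<in> I - {i0} \<rightarrow> carrier R \<and> (\<exists>i\<in>I - {i0}. x i \<noteq> \<zero>) \<and>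
        (\<forall>j\<in>J. (\<Oplus>i\<in>I - {i0}. a j i \<otimes> x i) = \<zero>)"
    proof (rule insert.IH)
      show "finite (I - {i0})" using insert.prems(1) by simp
      show "a j i \<in> carrier R" if "j \<in> J" "i \<in> I - {i0}" for j i using that a by simp
    qed fact
    then obtain x where x: "x \<in> I - {i0} \<rightarrow> carrier R"
      "\<exists>i\<in>I - {i0}. x i \<noteq> \<zero>" "\<forall>j\<in>J. (\<Oplus>i\<in>I - {i0}. a j i \<otimes> x i) = \<zero>"
      by (elim exE conjE)
    define y where "y = x(i0 := \<zero>)"
    have y: "y \<in> I \<rightarrow> carrier R" using x(1) by (auto simp: y_def)
    have "?S j y = \<zero>" if j: "j \<in> J" for j
    proof -
      have "?S j y = (\<Oplus>i\<in>I - {i0}. a j i \<otimes> x i)"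
        using insert.prems(1) i0 a j x(1) y by (intro add.finprod_mono_neutral_cong_right) (auto simp: y_def Pi_iff)
      then show ?thesis using x(3) j by simp
    qed
    moreover have "\<exists>i\<in>I. y i \<noteq> \<zero>" using x(2) by (auto simp: y_def)
    moreover have "y i0 = \<zero>" by (simp add: y_def)
    ultimately show ?thesis using y by (intro exI[of _ y] conjI ballI)
  qed
  have "I \<noteq> {}" using insert.prems(2) by auto
  then obtain i0 where "i0 \<in> I" by blast
  from solve[OF this] obtain x i1 where x: "x \<in> I \<rightarrow> carrier R" "i1 \<in> I" "x i1 \<noteq> \<zero>"
    "\<forall>j\<in>J. ?S j x = \<zero>" by (elim exE conjE bexE)
  from solve[OF x(2)] obtain y where y: "y \<in> I \<rightarrow> carrier R" "y i1 = \<zero>" "\<exists>i\<in>I. y i \<noteq> \<zero>"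
    "\<forall>j\<in>J. ?S j y = \<zero>" by (elim exE conjE)
  have closed: "?S j' u \<in> carrier R" if "j' \<in> insert j J" "u \<in> I \<rightarrow> carrier R" for j' u
    using that a by (intro finsum_closed) (auto simp: Pi_iff)
  consider "?S j x = \<zero>" | "?S j y = \<zero>" | "?S j x \<noteq> \<zero>" "?S j y \<noteq> \<zero>" by blast
  then show ?case
  proof cases
    case 1
    show ?thesis using x 1 by (intro exI[of _ x] conjI bexI[of _ i1]) simp_all
  next
    case 2
    show ?thesis using y 2 by (intro exI[of _ y] conjI) simp_all
  next
    case 3
    define \<alpha> \<beta> where "\<alpha> = \<ominus> ?S j x" and "\<beta> = ?S j y"
    have ab: "\<alpha> \<in> carrier R" "\<beta> \<in> carrier R" using closed x(1) y(1) by (auto simp: \<alpha>_def \<beta>_def)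
    define z where "z = (\<lambda>i. \<beta> \<otimes> x i \<oplus> \<alpha> \<otimes> y i)"
    have lin: "?S j' z = \<beta> \<otimes> ?S j' x \<oplus> \<alpha> \<otimes> ?S j' y" if j': "j' \<in> insert j J" for j'
    proof -
      have "?S j' z = (\<Oplus>i\<in>I. \<beta> \<otimes> (a j' i \<otimes> x i) \<oplus> \<alpha> \<otimes> (a j' i \<otimes> y i))"
        using a[OF j'] x(1) y(1) ab
        by (intro finsum_cong') (auto simp: z_def Pi_iff r_distr m_lcomm)
      also have "\<dots> = (\<Oplus>i\<in>I. \<beta> \<otimes> (a j' i \<otimes> x i)) \<oplus> (\<Oplus>i\<in>I. \<alpha> \<otimes> (a j' i \<otimes> y i))"
        using a[OF j'] x(1) y(1) ab by (intro finsum_addf) (auto simp: Pi_iff)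
      also have "(\<Oplus>i\<in>I. \<beta> \<otimes> (a j' i \<otimes> x i)) = \<beta> \<otimes> ?S j' x"
        using a[OF j'] x(1) ab insert.prems(1) by (intro finsum_rdistr[symmetric]) (auto simp: Pi_iff)
      also have "(\<Oplus>i\<in>I. \<alpha> \<otimes> (a j' i \<otimes> y i)) = \<alpha> \<otimes> ?S j' y"
        using a[OF j'] y(1) ab insert.prems(1) by (intro finsum_rdistr[symmetric]) (auto simp: Pi_iff)
      finally show ?thesis .
    qed
    have "?S j z = \<beta> \<otimes> ?S j x \<oplus> \<alpha> \<otimes> \<beta>" using lin[of j] by (simp add: \<beta>_def)
    also have "\<dots> = \<zero>"
      using closed[of j x] x(1) ab by (simp add: \<alpha>_def r_minus m_comm r_neg)
    finally have "?S j' z = \<zero>" if "j' \<in> insert j J" for j'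
      using that lin[OF that] x(4) y(4) ab by auto
    moreover have "z i1 \<noteq> \<zero>"
    proof -
      have x1: "x i1 \<in> carrier R" using x(1,2) by blast
      then have "z i1 = \<beta> \<otimes> x i1" using y(2) ab by (simp add: z_def)
      moreover have "\<beta> \<noteq> \<zero>" using 3 by (simp add: \<beta>_def)
      ultimately show ?thesis using x(3) x1 ab integral_iff[of \<beta> "x i1"] by simp
    qed
    moreover have "z \<in> I \<rightarrow> carrier R" using x(1) y(1) ab by (auto simp: z_def)
    ultimately show ?thesis using x(2) by (intro exI[of _ z] conjI bexI[of _ i1] ballI)
  qed
qed

section \<open>Crossed homomorphisms\<close>

locale abelian_group_action = G: group G + M: comm_group M
  for G :: "('g, 'b) monoid_scheme" and M :: "('m, 'c) monoid_scheme" +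
  fixes act :: "'g \<Rightarrow> 'm \<Rightarrow> 'm"
  assumes act_closed [simp]: "g \<in> carrier G \<Longrightarrow> m \<in> carrier M \<Longrightarrow> act g m \<in> carrier M"
    and act_mult: "g \<in> carrier G \<Longrightarrow> m \<in> carrier M \<Longrightarrow> m' \<in> carrier M \<Longrightarrow>
      act g (m \<otimes>\<^bsub>M\<^esub> m') = act g m \<otimes>\<^bsub>M\<^esub> act g m'"
    and act_act: "g \<in> carrier G \<Longrightarrow> h \<in> carrier G \<Longrightarrow> m \<in> carrier M \<Longrightarrow>
      act (g \<otimes>\<^bsub>G\<^esub> h) m = act g (act h m)"
    and act_group_one [simp]: "m \<in> carrier M \<Longrightarrow> act \<one>\<^bsub>G\<^esub> m = m"
begin

abbreviation Z1 :: "('g \<Rightarrow> 'm) monoid" where "Z1 \<equiv> crossed_hom_group G M act"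

lemma act_hom: "g \<in> carrier G \<Longrightarrow> group_hom M M (act g)"
  by (intro group_hom.intro group_hom_axioms.intro M.group_axioms) (simp add: hom_def act_mult)

lemma act_one [simp]: "g \<in> carrier G \<Longrightarrow> act g \<one>\<^bsub>M\<^esub> = \<one>\<^bsub>M\<^esub>"
  using group_hom.hom_one[OF act_hom] .

lemma act_inv: "g \<in> carrier G \<Longrightarrow> m \<in> carrier M \<Longrightarrow> act g (inv\<^bsub>M\<^esub> m) = inv\<^bsub>M\<^esub> act g m"
  using group_hom.hom_inv[OF act_hom] .

lemma crossed_hom_closed [simp]: "f \<in> crossed_homs G M act \<Longrightarrow> g \<in> carrier G \<Longrightarrow> f g \<in> carrier M"
  by (auto simp: crossed_homs_def)

lemma crossed_hom_mult:
  "f \<in> crossed_homs G M act \<Longrightarrow> g \<in> carrier G \<Longrightarrow> h \<in> carrier G \<Longrightarrow>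
    f (g \<otimes>\<^bsub>G\<^esub> h) = f g \<otimes>\<^bsub>M\<^esub> act g (f h)"
  by (simp add: crossed_homs_def)

lemma crossed_hom_ext:
  assumes "f \<in> crossed_homs G M act" "f' \<in> crossed_homs G M act"
    "\<And>g. g \<in> carrier G \<Longrightarrow> f g = f' g"
  shows "f = f'"
  using assms by (auto simp: crossed_homs_def intro: PiE_ext)

lemma crossed_homI:
  assumes "\<And>g. g \<in> carrier G \<Longrightarrow> f g \<in> carrier M"
    "\<And>g h. g \<in> carrier G \<Longrightarrow> h \<in> carrier G \<Longrightarrow> f (g \<otimes>\<^bsub>G\<^esub> h) = f g \<otimes>\<^bsub>M\<^esub> act g (f h)"
  shows "restrict f (carrier G) \<in> crossed_homs G M act"
  using assms by (simp add: crossed_homs_def)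

lemma crossed_hom_one [simp]:
  assumes "f \<in> crossed_homs G M act"
  shows "f \<one>\<^bsub>G\<^esub> = \<one>\<^bsub>M\<^esub>"
proof -
  have "f \<one>\<^bsub>G\<^esub> \<otimes>\<^bsub>M\<^esub> f \<one>\<^bsub>G\<^esub> = f \<one>\<^bsub>G\<^esub>"
    using crossed_hom_mult[OF assms, of "\<one>\<^bsub>G\<^esub>" "\<one>\<^bsub>G\<^esub>"] assms by simp
  then show ?thesis using assms by simp
qed

lemma Z1_simps [simp]:
  "carrier Z1 = crossed_homs G M act"
  "f \<otimes>\<^bsub>Z1\<^esub> f' = (\<lambda>g\<in>carrier G. f g \<otimes>\<^bsub>M\<^esub> f' g)"
  "\<one>\<^bsub>Z1\<^esub> = (\<lambda>g\<in>carrier G. \<one>\<^bsub>M\<^esub>)"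
  by (simp_all add: crossed_hom_group_def)

lemma comm_group_Z1: "comm_group Z1"
proof (rule comm_groupI)
  show "x \<otimes>\<^bsub>Z1\<^esub> y \<in> carrier Z1" if "x \<in> carrier Z1" "y \<in> carrier Z1" for x y
    using that by (auto intro!: crossed_homI simp: crossed_hom_mult act_mult M.m_ac)
  show "\<one>\<^bsub>Z1\<^esub> \<in> carrier Z1" by (auto intro!: crossed_homI)
  show "x \<otimes>\<^bsub>Z1\<^esub> y \<otimes>\<^bsub>Z1\<^esub> z = x \<otimes>\<^bsub>Z1\<^esub> (y \<otimes>\<^bsub>Z1\<^esub> z)"
    if "x \<in> carrier Z1" "y \<in> carrier Z1" "z \<in> carrier Z1" for x y z
    using that by (auto simp: fun_eq_iff restrict_def M.m_assoc)
  show "x \<otimes>\<^bsub>Z1\<^esub> y = y \<otimes>\<^bsub>Z1\<^esub> x" if "x \<in> carrier Z1" "y \<in> carrier Z1" for x y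
    using that by (auto simp: fun_eq_iff restrict_def M.m_comm)
  show "\<one>\<^bsub>Z1\<^esub> \<otimes>\<^bsub>Z1\<^esub> x = x" if "x \<in> carrier Z1" for x
  proof (rule crossed_hom_ext)
    have "(\<lambda>g\<in>carrier G. x g) \<in> crossed_homs G M act"
      using that by (intro crossed_homI) (auto simp: crossed_hom_mult)
    then show "\<one>\<^bsub>Z1\<^esub> \<otimes>\<^bsub>Z1\<^esub> x \<in> crossed_homs G M act"
      using that by (simp add: restrict_def cong: if_cong)
  qed (use that in auto)
  show "\<exists>y\<in>carrier Z1. y \<otimes>\<^bsub>Z1\<^esub> x = \<one>\<^bsub>Z1\<^esub>" if "x \<in> carrier Z1" for x
  proof (rule bexI)
    show "(\<lambda>g\<in>carrier G. inv\<^bsub>M\<^esub> x g) \<in> carrier Z1"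
      using that by (auto intro!: crossed_homI simp: crossed_hom_mult act_inv M.inv_mult)
    show "(\<lambda>g\<in>carrier G. inv\<^bsub>M\<^esub> x g) \<otimes>\<^bsub>Z1\<^esub> x = \<one>\<^bsub>Z1\<^esub>"
      using that by (auto simp: fun_eq_iff restrict_def)
  qed
qed

sublocale Z1: comm_group Z1 by (rule comm_group_Z1)

lemma Z1_inv [simp]: "f \<in> crossed_homs G M act \<Longrightarrow> g \<in> carrier G \<Longrightarrow> (inv\<^bsub>Z1\<^esub> f) g = inv\<^bsub>M\<^esub> f g"
proof -
  assume f: "f \<in> crossed_homs G M act" and g: "g \<in> carrier G"
  have "inv\<^bsub>Z1\<^esub> f \<in> crossed_homs G M act" using Z1.inv_closed[of f] f by simp
  moreover have "(inv\<^bsub>Z1\<^esub> f \<otimes>\<^bsub>Z1\<^esub> f) g = \<one>\<^bsub>Z1\<^esub> g" using Z1.l_inv[of f] f by simp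
  ultimately show ?thesis using f g by (intro M.inv_equality[symmetric]) auto
qed

lemma Z1_pow [simp]:
  "f \<in> crossed_homs G M act \<Longrightarrow> g \<in> carrier G \<Longrightarrow> (f [^]\<^bsub>Z1\<^esub> (k::nat)) g = f g [^]\<^bsub>M\<^esub> k"
  by (induction k) (simp_all add: Z1.nat_pow_Suc)

definition invariants :: "'m set"
  where "invariants = {m \<in> carrier M. \<forall>g\<in>carrier G. act g m = m}"

lemma principal_hom:
  "group_hom M Z1 (\<lambda>m. \<lambda>g\<in>carrier G. act g m \<otimes>\<^bsub>M\<^esub> inv\<^bsub>M\<^esub> m)" (is "group_hom M Z1 ?p")
proof (intro group_hom.intro group_hom_axioms.intro M.group_axioms Z1.group_axioms homI)
  show "?p m \<in> carrier Z1" if m: "m \<in> carrier M" for m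
  proof -
    have "act (g \<otimes>\<^bsub>G\<^esub> h) m \<otimes>\<^bsub>M\<^esub> inv\<^bsub>M\<^esub> m
      = act g m \<otimes>\<^bsub>M\<^esub> inv\<^bsub>M\<^esub> m \<otimes>\<^bsub>M\<^esub> act g (act h m \<otimes>\<^bsub>M\<^esub> inv\<^bsub>M\<^esub> m)"
      if g: "g \<in> carrier G" "h \<in> carrier G" for g h
    proof -
      have "act g m \<otimes>\<^bsub>M\<^esub> inv\<^bsub>M\<^esub> m \<otimes>\<^bsub>M\<^esub> (act g (act h m) \<otimes>\<^bsub>M\<^esub> inv\<^bsub>M\<^esub> act g m)
        = (act g m \<otimes>\<^bsub>M\<^esub> inv\<^bsub>M\<^esub> act g m) \<otimes>\<^bsub>M\<^esub> (act g (act h m) \<otimes>\<^bsub>M\<^esub> inv\<^bsub>M\<^esub> m)"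
        using g m by (simp only: M.m_ac M.inv_closed act_closed M.m_closed)
      then show ?thesis using g m by (simp add: act_mult act_inv act_act)
    qed
    then show ?thesis using m by (auto intro!: crossed_homI)
  qed
  show "?p (m \<otimes>\<^bsub>M\<^esub> m') = ?p m \<otimes>\<^bsub>Z1\<^esub> ?p m'" if "m \<in> carrier M" "m' \<in> carrier M" for m m'
    using that by (simp add: fun_eq_iff restrict_def act_mult M.inv_mult M.m_ac)
qed

lemma subgroup_principal: "subgroup (principal_crossed_homs G M act) Z1"
  unfolding principal_crossed_homs_def by (rule group_hom.img_is_subgroup[OF principal_hom])

lemma order_H1: "order (H1 G M act) * card (principal_crossed_homs G M act) = card (crossed_homs G M act)"
  using Z1.lagrange[OF subgroup_principal]
  by (simp add: H1_def FactGroup_def order_def)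

lemma card_principal:
  "card (principal_crossed_homs G M act) * card invariants = card (carrier M)"
proof -
  let ?p = "\<lambda>m. \<lambda>g\<in>carrier G. act g m \<otimes>\<^bsub>M\<^esub> inv\<^bsub>M\<^esub> m"
  interpret p: group_hom M Z1 ?p by (rule principal_hom)
  have "act g m \<otimes>\<^bsub>M\<^esub> inv\<^bsub>M\<^esub> m = \<one>\<^bsub>M\<^esub> \<longleftrightarrow> act g m = m" if "g \<in> carrier G" "m \<in> carrier M" for g m
    using M.inv_solve_right'[of "\<one>\<^bsub>M\<^esub>" "act g m" m] that by simp
  then have ker: "kernel M Z1 ?p = invariants"
    by (auto simp: kernel_def invariants_def fun_eq_iff restrict_def)
  \<comment> \<open>The codomain is cut down to the image, so that the map from \<open>M\<close> is
    onto and the isomorphism theorem applies.\<close>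
  let ?I = "Z1\<lparr>carrier := ?p ` carrier M\<rparr>"
  interpret q: group_hom M ?I ?p
  proof (intro group_hom.intro group_hom_axioms.intro M.group_axioms)
    show "group ?I" by (rule Z1.subgroup_imp_group[OF p.img_is_subgroup])
    show "?p \<in> hom M ?I" using p.hom_mult by (auto simp: hom_def)
  qed
  have "M Mod kernel M ?I ?p \<cong> ?I" by (rule q.FactGroup_iso) simp
  moreover have "kernel M ?I ?p = invariants" using ker by (simp add: kernel_def)
  ultimately have "card (carrier (M Mod invariants)) = card (principal_crossed_homs G M act)"
    using iso_same_card by (fastforce simp: principal_crossed_homs_def)
  then show ?thesis
    using M.lagrange[OF p.subgroup_kernel] by (simp add: ker FactGroup_def order_def)
qed

end

section \<open>Crossed homomorphisms with values in roots of unity\<close>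

text \<open>The exponent \<open>n\<close> is left open: it is that of \<open>G\<close> in one
  direction and that of \<open>D\<close> in the other, before the two are known to agree.\<close>

locale finite_galois_roots = finite_galois L K G
  for L :: "('a, 'b) ring_scheme" (structure) and K G +
  fixes n :: nat
  assumes n_pos: "0 < n"
begin

abbreviation Z where "Z \<equiv> crossed_homs G (roots_of_one_group n L) (\<lambda>\<phi> x. \<phi> x)"

lemma roots_of_one_carrier: "x \<in> roots_of_one m L \<Longrightarrow> x \<in> carrier L" "x \<in> roots_of_one m L \<Longrightarrow> x \<noteq> \<zero>"
  by (auto simp: roots_of_one_def)

lemma G_roots_of_one: "\<phi> \<in> carrier G \<Longrightarrow> x \<in> roots_of_one m L \<Longrightarrow> \<phi> x \<in> roots_of_one m L"
  by (auto simp: roots_of_one_def simp flip: G_pow)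

sublocale C: abelian_group_action G "roots_of_one_group n L" "\<lambda>\<phi> x. \<phi> x"
proof (intro abelian_group_action.intro abelian_group_action_axioms.intro
    G.group_axioms comm_group_roots_of_one)
qed (simp_all add: G_roots_of_one roots_of_one_carrier)

lemma Z_closed: "f \<in> Z \<Longrightarrow> \<phi> \<in> carrier G \<Longrightarrow> f \<phi> \<in> roots_of_one n L"
  using C.crossed_hom_closed by simp

lemma Z_mult: "f \<in> Z \<Longrightarrow> \<phi> \<in> carrier G \<Longrightarrow> \<tau> \<in> carrier G \<Longrightarrow> f (\<phi> \<otimes>\<^bsub>G\<^esub> \<tau>) = f \<phi> \<otimes> \<phi> (f \<tau>)"
  using C.crossed_hom_mult by simp

lemma Z_one: "f \<in> Z \<Longrightarrow> f \<one>\<^bsub>G\<^esub> = \<one>"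
  using C.crossed_hom_one by simp

lemma finite_Z: "finite Z"
proof (rule finite_subset)
  show "Z \<subseteq> carrier G \<rightarrow>\<^sub>E roots_of_one n L" by (auto simp: crossed_homs_def)
  show "finite (carrier G \<rightarrow>\<^sub>E roots_of_one n L)"
    by (intro finite_PiE finite_G finite_roots_of_one n_pos)
qed

lemma roots_of_one_K: "roots_of_one m (L\<lparr>carrier := K\<rparr>) = roots_of_one m L \<inter> K"
proof -
  have "x [^]\<^bsub>L\<lparr>carrier := K\<rparr>\<^esub> m = x [^] m" for x by (simp add: nat_pow_def)
  then show ?thesis using K_subset by (auto simp: roots_of_one_def)
qed

lemma order_H1_iff:
  assumes "card (roots_of_one n L) = n"
  shows "(of_nat (order (H1 G (roots_of_one_group n L) (\<lambda>\<phi> x. \<phi> x))) :: rat) =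
      of_nat (card (roots_of_one n (L\<lparr>carrier := K\<rparr>))) * of_nat (order G) / of_nat n
    \<longleftrightarrow> card Z = order G"
proof -
  let ?h = "order (H1 G (roots_of_one_group n L) (\<lambda>\<phi> x. \<phi> x))"
  let ?b = "card (principal_crossed_homs G (roots_of_one_group n L) (\<lambda>\<phi> x. \<phi> x))"
  let ?k = "card (roots_of_one n (L\<lparr>carrier := K\<rparr>))"
  have "C.invariants = roots_of_one n L \<inter> K"
  proof (intro equalityI subsetI)
    fix x assume "x \<in> C.invariants"
    then show "x \<in> roots_of_one n L \<inter> K"
      using fixed_iff_K[OF roots_of_one_carrier(1), of x n] by (simp add: C.invariants_def)
  next
    fix x assume "x \<in> roots_of_one n L \<inter> K"
    then show "x \<in> C.invariants" by (simp add: C.invariants_def G_fixes_K)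
  qed
  then have bk: "?b * ?k = n" using C.card_principal assms roots_of_one_K by simp
  have arith: "(of_nat h :: rat) = of_nat k * of_nat q / of_nat m \<longleftrightarrow> z = q"
    if "b * k = m" "h * b = z" "0 < m" for h k q m z b :: nat
  proof -
    have "(of_nat h :: rat) = of_nat k * of_nat q / of_nat m \<longleftrightarrow> k * (h * b) = k * q"
      using that by (simp add: field_simps flip: of_nat_mult) (simp add: mult_ac flip: that(1))
    moreover have "0 < k" using that by (metis gr0I mult_0_right less_irrefl)
    ultimately show ?thesis using that(2) by simp
  qed
  show ?thesis by (rule arith[OF bk C.order_H1 n_pos])
qed

definition vanishing :: "('a \<Rightarrow> 'a) set \<Rightarrow> (('a \<Rightarrow> 'a) \<Rightarrow> 'a) set"
  where "vanishing H = {f \<in> Z. \<forall>\<phi>\<in>H. f \<phi> = \<one>}"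

text \<open>Although \<open>f\<close> is not a homomorphism, the twist by \<phi> cannot be seen
  where the value is 1.\<close>

lemma subgroup_zeros:
  assumes f: "f \<in> Z"
  shows "subgroup {\<phi> \<in> carrier G. f \<phi> = \<one>} G"
proof (rule G.subgroupI)
  have "\<one>\<^bsub>G\<^esub> \<in> {\<phi> \<in> carrier G. f \<phi> = \<one>}" using Z_one[OF f] by simp
  then show "{\<phi> \<in> carrier G. f \<phi> = \<one>} \<noteq> {}" by blast
next
  fix \<phi> assume p: "\<phi> \<in> {\<phi> \<in> carrier G. f \<phi> = \<one>}"
  then have c: "f (inv\<^bsub>G\<^esub> \<phi>) \<in> carrier L"
    using roots_of_one_carrier(1)[OF Z_closed[OF f G.inv_closed]] by simp
  have "f (inv\<^bsub>G\<^esub> \<phi> \<otimes>\<^bsub>G\<^esub> \<phi>) = f (inv\<^bsub>G\<^esub> \<phi>) \<otimes> (inv\<^bsub>G\<^esub> \<phi>) (f \<phi>)"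
    using p by (intro Z_mult[OF f]) auto
  then show "inv\<^bsub>G\<^esub> \<phi> \<in> {\<phi> \<in> carrier G. f \<phi> = \<one>}" using p c Z_one[OF f] by simp
next
  fix \<phi> \<tau> assume "\<phi> \<in> {\<phi> \<in> carrier G. f \<phi> = \<one>}" "\<tau> \<in> {\<phi> \<in> carrier G. f \<phi> = \<one>}"
  then show "\<phi> \<otimes>\<^bsub>G\<^esub> \<tau> \<in> {\<phi> \<in> carrier G. f \<phi> = \<one>}" using Z_mult[OF f] by simp
qed auto

end

section \<open>The cyclotomic character and the bound on crossed homomorphisms\<close>

lemma (in finite_galois) roots_of_one_exponent:
  assumes n: "0 < n" "card (roots_of_one n L) = n" and p: "\<phi> \<in> carrier G"
  shows "\<exists>s::nat. 0 < s \<and> (\<forall>z\<in>roots_of_one n L. \<phi> z = z [^] s) \<and>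
    (\<forall>q. q dvd n \<longrightarrow> roots_of_one q L \<subseteq> K \<longrightarrow> q dvd s - 1)"
proof -
  obtain \<zeta> where \<zeta>: "\<zeta> \<in> roots_of_one n L"
    "\<And>z. z \<in> roots_of_one n L \<Longrightarrow> \<exists>i::nat. z = \<zeta> [^] i"
    "\<And>k::nat. \<zeta> [^] k = \<one> \<longleftrightarrow> n dvd k"
    by (rule roots_of_one_cyclic[OF n]) blast
  have zL: "\<zeta> \<in> carrier L" "\<zeta> \<noteq> \<zero>" "\<zeta> [^] n = \<one>" using \<zeta>(1) by (auto simp: roots_of_one_def)
  have "\<phi> \<zeta> \<in> roots_of_one n L" using p zL n(1) by (simp add: roots_of_one_eq flip: G_pow)
  then obtain i :: nat where i: "\<phi> \<zeta> = \<zeta> [^] i" using \<zeta>(2) by blast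
  \<comment> \<open>Adding \<open>n\<close> changes no power of \<zeta> and makes the exponent
    positive, so that \<open>s - 1\<close> is a genuine difference.\<close>
  define s where "s = i + n"
  have s: "0 < s" using n(1) by (simp add: s_def)
  have ps: "\<phi> \<zeta> = \<zeta> [^] s" using i zL by (simp add: s_def flip: nat_pow_mult)
  have pow: "\<phi> z = z [^] s" if z: "z \<in> roots_of_one n L" for z
  proof -
    obtain k :: nat where k: "z = \<zeta> [^] k" using \<zeta>(2)[OF z] ..
    have "\<phi> z = (\<zeta> [^] s) [^] k" using k ps zL p by simp
    then show ?thesis using k zL by (simp add: nat_pow_pow mult.commute)
  qed
  have "q dvd s - 1" if q: "q dvd n" "roots_of_one q L \<subseteq> K" for q
  proof -
    \<comment> \<open>\<zeta> ^ d is a \<open>q\<close>-th root of unity, hence fixed. So \<zeta> ^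
      ((s - 1) d) = 1, and n = q d divides (s - 1) d.\<close>
    obtain d where d: "n = q * d" using q(1) ..
    have dpos: "0 < d" using d n(1) by (metis gr0I mult_0_right less_irrefl)
    have zd: "\<zeta> [^] d \<in> carrier L" "\<zeta> [^] d \<noteq> \<zero>"
    proof -
      show "\<zeta> [^] d \<in> carrier L" using zL by simp
      show "\<zeta> [^] d \<noteq> \<zero>" using zL(1,2) by (induction d) (simp_all add: integral_iff)
    qed
    have "(\<zeta> [^] d) [^] q = \<one>" using zL d by (simp add: nat_pow_pow mult.commute)
    then have "\<zeta> [^] d \<in> K" using q(2) zd by (auto simp: roots_of_one_def)
    then have "\<phi> (\<zeta> [^] d) = \<zeta> [^] d" using p by (rule G_fixes_K[rotated])
    then have "\<zeta> [^] d = \<zeta> [^] (s * d)" using p zL ps by (simp add: nat_pow_pow)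
    also have "s * d = d + (s - 1) * d" using s by (cases s) simp_all
    also have "\<zeta> [^] (d + (s - 1) * d) = \<zeta> [^] d \<otimes> \<zeta> [^] ((s - 1) * d)"
      using zL by (simp add: nat_pow_mult)
    finally have "\<zeta> [^] d \<otimes> \<zeta> [^] ((s - 1) * d) = \<zeta> [^] d \<otimes> \<one>" using zL by simp
    then have "\<zeta> [^] ((s - 1) * d) = \<one>" using zd zL by (subst (asm) m_lcancel) auto
    then have "n dvd (s - 1) * d" using \<zeta>(3) by simp
    then have "q * d dvd (s - 1) * d" by (simp only: d)
    then show ?thesis using dpos by simp
  qed
  then show ?thesis using s pow by (intro exI[of _ s] conjI ballI allI impI)
qed

text \<open>Condition 1 in working form: given the \<open>n\<close> roots of unity in
  \<open>L\<close>, there are er(n) of order er(n) in \<open>L\<close>, and their number in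
  \<open>K\<close> is er(n) exactly if all of them lie in \<open>K\<close>.\<close>

locale finite_galois_cyclotomic = finite_galois_roots L K G n
  for L :: "('a, 'b) ring_scheme" (structure) and K G n +
  assumes card_roots: "card (roots_of_one n L) = n"
    and reduced_roots: "roots_of_one (extended_reduction n) L \<subseteq> K"
begin

lemma cyclotomic_character:
  assumes p: "\<phi> \<in> carrier G"
  shows "\<exists>s::nat. 0 < s \<and> (\<forall>z\<in>roots_of_one n L. \<phi> z = z [^] s) \<and>
    (\<forall>p. prime p \<longrightarrow> p dvd n \<longrightarrow> [s = 1] (mod p)) \<and> (4 dvd n \<longrightarrow> [s = 1] (mod 4))"
proof -
  obtain s :: nat where s: "0 < s" "\<forall>z\<in>roots_of_one n L. \<phi> z = z [^] s"
    "\<forall>q. q dvd n \<longrightarrow> roots_of_one q L \<subseteq> K \<longrightarrow> q dvd s - 1"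
    using roots_of_one_exponent[OF n_pos card_roots p] by blast
  have "extended_reduction n dvd s - 1"
    using s(3) extended_reduction_dvd[OF n_pos] reduced_roots by blast
  then have dvd: "\<And>p. prime p \<Longrightarrow> p dvd n \<Longrightarrow> p dvd s - 1" "4 dvd n \<Longrightarrow> 4 dvd s - 1"
    using extended_reduction_dvd_iff[OF n_pos, of "s - 1"] by blast+
  have "1 \<le> s" using s(1) by simp
  show ?thesis
    using s(1,2) dvd by (intro exI[of _ s] conjI allI impI) (simp_all only: cong_altdef_nat[OF \<open>1 \<le> s\<close>])
qed

text \<open>For a cyclotomic character that is trivial modulo \<open>extended_reduction n\<close>, the norm element
  \<open>1 + s + \<dots> + s^(k-1)\<close> and \<open>k\<close> have the same annihilator in the roots of unity.\<close>
lemma crossed_hom_pow_eq_one_iff: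
  assumes f: "f \<in> Z" and p: "\<phi> \<in> carrier G"
  shows "f (\<phi> [^]\<^bsub>G\<^esub> (k::nat)) = \<one> \<longleftrightarrow> f \<phi> [^] k = \<one>"
proof -
  obtain s :: nat where s: "0 < s" "\<And>z. z \<in> roots_of_one n L \<Longrightarrow> \<phi> z = z [^] s"
    "\<And>p. prime p \<Longrightarrow> p dvd n \<Longrightarrow> [s = 1] (mod p)" "4 dvd n \<Longrightarrow> [s = 1] (mod 4)"
    using cyclotomic_character[OF p] by auto
  let ?z = "f \<phi>"
  have z: "?z \<in> roots_of_one n L" using Z_closed[OF f p] .
  have zL: "?z \<in> carrier L" using roots_of_one_carrier(1)[OF z] .
  have norm: "f (\<phi> [^]\<^bsub>G\<^esub> k) = ?z [^] (\<Sum>i<k. s ^ i)" for k :: nat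
  proof (induction k)
    case (Suc k)
    have "f (\<phi> [^]\<^bsub>G\<^esub> Suc k) = f (\<phi> \<otimes>\<^bsub>G\<^esub> \<phi> [^]\<^bsub>G\<^esub> k)" using p G.nat_pow_Suc2 by simp
    also have "\<dots> = ?z \<otimes> \<phi> (f (\<phi> [^]\<^bsub>G\<^esub> k))" using p by (intro Z_mult[OF f]) auto
    also have "\<phi> (f (\<phi> [^]\<^bsub>G\<^esub> k)) = ?z [^] ((\<Sum>i<k. s ^ i) * s)"
    proof -
      have "f (\<phi> [^]\<^bsub>G\<^esub> k) \<in> roots_of_one n L" using Z_closed[OF f] p by simp
      from s(2)[OF this] show ?thesis by (simp only: Suc nat_pow_pow[OF zL])
    qed
    also have "?z \<otimes> ?z [^] ((\<Sum>i<k. s ^ i) * s) = ?z [^] (1 + (\<Sum>i<k. s ^ i) * s)"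
      using zL by (simp add: m_comm)
    also have "1 + (\<Sum>i<k. s ^ i) * s = (\<Sum>i<Suc k. s ^ i)"
      by (simp add: sum.lessThan_Suc_shift sum_distrib_left mult.commute del: sum.lessThan_Suc)
    finally show ?case .
  qed (simp add: Z_one[OF f])
  let ?o = "C.M.ord ?z"
  have ord: "?z [^] j = \<one> \<longleftrightarrow> ?o dvd j" for j :: nat
    using C.M.pow_eq_id[of ?z j] z by simp
  have "?o dvd n" using z ord[of n] by (simp add: roots_of_one_def)
  from dvd_geometric_sum_iff[OF n_pos this s(1,3,4)]
  show ?thesis unfolding norm ord by simp
qed

text \<open>Let \<open>m\<close> be the least positive exponent with g ^ m in \<open>H\<close>. The
  cosets of \<open>H\<close> by g ^ i for i < m are disjoint, so the group grows at least by the
  factor \<open>m\<close>. For \<open>f\<close> vanishing on \<open>H\<close>, f(g ^ m) = 1 makes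
  f(g) an \<open>m\<close>-th root of unity, so evaluation at \<open>g\<close> has at most
  \<open>m\<close> values; each fiber embeds into the crossed homomorphisms vanishing on the larger
  group, so their number drops at most by the factor \<open>m\<close>.\<close>

lemma card_vanishing_step:
  assumes H: "subgroup H G" and g: "g \<in> carrier G" "g \<notin> H"
  shows "card (vanishing H) * card H \<le>
    card (vanishing (generate G (insert g H))) * card (generate G (insert g H))"
proof -
  interpret H: subgroup H G by (rule H)
  let ?H' = "generate G (insert g H)"
  have HG: "insert g H \<subseteq> carrier G" using H.subset g by blast
  have H': "subgroup ?H' G" using G.generate_is_subgroup[OF HG] .
  then interpret H': subgroup ?H' G .
  define m :: nat where "m = (LEAST m. 0 < m \<and> g [^]\<^bsub>G\<^esub> m \<in> H)"
  have "0 < order G \<and> g [^]\<^bsub>G\<^esub> order G \<in> H"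
    using order_G_pos G.pow_order_eq_1[OF g(1)] H.one_closed by simp
  then have mm: "0 < m \<and> g [^]\<^bsub>G\<^esub> m \<in> H"
    unfolding m_def by (rule LeastI[of "\<lambda>m::nat. 0 < m \<and> g [^]\<^bsub>G\<^esub> m \<in> H"])
  note m = conjunct1[OF mm] conjunct2[OF mm]
  have least: "g [^]\<^bsub>G\<^esub> k \<notin> H" if "0 < k" "k < m" for k
    using not_less_Least[of k "\<lambda>m. 0 < m \<and> g [^]\<^bsub>G\<^esub> m \<in> H"] that by (simp add: m_def)
  have fin: "finite ?H'" using H'.subset finite_G finite_subset by blast
  have "m * card H \<le> card ?H'"
  proof -
    let ?q = "\<lambda>(i, h). g [^]\<^bsub>G\<^esub> (i::nat) \<otimes>\<^bsub>G\<^esub> h"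
    have False if i: "i < j" "j < m" and h: "h \<in> H" "h' \<in> H"
      and eq: "g [^]\<^bsub>G\<^esub> i \<otimes>\<^bsub>G\<^esub> h = g [^]\<^bsub>G\<^esub> j \<otimes>\<^bsub>G\<^esub> h'" for i j h h'
    proof -
      have "g [^]\<^bsub>G\<^esub> j = g [^]\<^bsub>G\<^esub> i \<otimes>\<^bsub>G\<^esub> g [^]\<^bsub>G\<^esub> (j - i)"
        using g(1) i by (simp add: G.nat_pow_mult)
      then have "g [^]\<^bsub>G\<^esub> i \<otimes>\<^bsub>G\<^esub> h = g [^]\<^bsub>G\<^esub> i \<otimes>\<^bsub>G\<^esub> (g [^]\<^bsub>G\<^esub> (j - i) \<otimes>\<^bsub>G\<^esub> h')"
        using eq g(1) h H.mem_carrier by (simp add: G.m_assoc)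
      then have "h = g [^]\<^bsub>G\<^esub> (j - i) \<otimes>\<^bsub>G\<^esub> h'"
        using g(1) h H.mem_carrier by (subst (asm) G.l_cancel) auto
      then have "g [^]\<^bsub>G\<^esub> (j - i) = h \<otimes>\<^bsub>G\<^esub> inv\<^bsub>G\<^esub> h'"
        using g(1) h H.mem_carrier by (simp add: G.inv_solve_right)
      then have "g [^]\<^bsub>G\<^esub> (j - i) \<in> H" using h by simp
      then show False using least[of "j - i"] i by simp
    qed
    note less = this
    have "inj_on ?q ({..<m} \<times> H)"
    proof (rule inj_onI, clarsimp)
      fix i h j h'
      assume *: "i < m" "h \<in> H" "j < m" "h' \<in> H"
        "g [^]\<^bsub>G\<^esub> i \<otimes>\<^bsub>G\<^esub> h = g [^]\<^bsub>G\<^esub> j \<otimes>\<^bsub>G\<^esub> h'"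
      have "i = j"
        using less[of i j h h'] less[of j i h' h] * by (metis linorder_neqE_nat)
      then show "i = j \<and> h = h'" using * g(1) H.mem_carrier by simp
    qed
    moreover have "?q ` ({..<m} \<times> H) \<subseteq> ?H'"
    proof -
      have "g \<in> ?H'" by (rule generate.incl) simp
      then have "g [^]\<^bsub>G\<^esub> i \<in> ?H'" for i :: nat by (induction i) auto
      moreover have "h \<in> ?H'" if "h \<in> H" for h using that by (intro generate.incl) simp
      ultimately show ?thesis by auto
    qed
    ultimately have "card ({..<m} \<times> H) \<le> card ?H'" using fin by (metis card_inj_on_le)
    then show ?thesis by (simp add: card_cartesian_product)
  qed
  moreover have "card (vanishing H) \<le> m * card (vanishing ?H')"
  proof -
    let ?F = "\<lambda>z. {f \<in> vanishing H. f g = z}"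
    have finV: "finite (vanishing A)" for A
      using finite_Z by (rule finite_subset[rotated]) (auto simp: vanishing_def)
    have fiber: "card (?F z) \<le> card (vanishing ?H')" for z
    proof (cases "?F z = {}")
      case False
      then obtain f0 where f0: "f0 \<in> Z" "\<forall>\<phi>\<in>H. f0 \<phi> = \<one>" "f0 g = z" by (auto simp: vanishing_def)
      \<comment> \<open>Division by one member \<open>f0\<close> of the fiber gives the value 1 on
        \<open>H\<close> and at \<open>g\<close>, hence on the subgroup that they generate.\<close>
      let ?t = "\<lambda>f. f \<otimes>\<^bsub>C.Z1\<^esub> inv\<^bsub>C.Z1\<^esub> f0"
      have inv_f0: "inv\<^bsub>C.Z1\<^esub> f0 \<in> Z" using C.Z1.inv_closed[of f0] f0(1) by simp
      have t_apply: "?t f \<phi> = f \<phi> \<otimes> inv\<^bsub>roots_of_one_group n L\<^esub> f0 \<phi>" if "\<phi> \<in> carrier G" for f \<phi>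
        using that f0(1) by simp
      have t_one: "?t f \<phi> = \<one>" if "f \<in> Z" "\<phi> \<in> carrier G" "f \<phi> = f0 \<phi>" for f \<phi>
        using t_apply[OF that(2), of f] that C.M.r_inv[of "f0 \<phi>"] Z_closed[OF f0(1) that(2)] by simp
      have "?t f \<in> vanishing ?H'" if f: "f \<in> ?F z" for f
      proof -
        have fZ: "f \<in> Z" and fH: "\<forall>\<phi>\<in>H. f \<phi> = \<one>" and fg: "f g = z"
          using f by (simp_all add: vanishing_def)
        have tZ: "?t f \<in> Z" using C.Z1.m_closed[of f "inv\<^bsub>C.Z1\<^esub> f0"] fZ inv_f0 by simp
        have "?t f \<phi> = \<one>" if "\<phi> \<in> insert g H" for \<phi>
        proof (rule t_one[OF fZ])
          show "\<phi> \<in> carrier G" using that HG by blast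
          show "f \<phi> = f0 \<phi>" using that fH fg f0(2,3) by (cases "\<phi> = g") simp_all
        qed
        then have "insert g H \<subseteq> {\<phi> \<in> carrier G. ?t f \<phi> = \<one>}" using HG by blast
        from G.generate_subgroup_incl[OF this subgroup_zeros[OF tZ]]
        show ?thesis using tZ unfolding vanishing_def by blast
      qed
      moreover have "inj_on ?t (?F z)"
      proof (rule inj_onI)
        fix f f' assume "f \<in> ?F z" "f' \<in> ?F z" and eq: "?t f = ?t f'"
        then have "f \<in> carrier C.Z1" "f' \<in> carrier C.Z1" by (simp_all add: vanishing_def)
        then show "f = f'" using eq inv_f0 C.Z1.r_cancel[of f "inv\<^bsub>C.Z1\<^esub> f0" f'] by (simp only: C.Z1_simps(1))
      qed
      ultimately show ?thesis using finV by (intro card_inj_on_le[of ?t]) auto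
    next
      case True
      show ?thesis unfolding True by simp
    qed
    have "vanishing H \<subseteq> (\<Union>z\<in>roots_of_one m L. ?F z)"
    proof
      fix f assume f: "f \<in> vanishing H"
      then have fZ: "f \<in> Z" and "f (g [^]\<^bsub>G\<^esub> m) = \<one>" using m(2) by (auto simp: vanishing_def)
      then have "f g [^] m = \<one>" using crossed_hom_pow_eq_one_iff[OF fZ g(1)] by simp
      moreover have "f g \<in> carrier L" "f g \<noteq> \<zero>"
        using Z_closed[OF fZ g(1)] roots_of_one_carrier by blast+
      ultimately have "f g \<in> roots_of_one m L" by (simp add: roots_of_one_def)
      then show "f \<in> (\<Union>z\<in>roots_of_one m L. ?F z)" using f by blast
    qed
    then have "card (vanishing H) \<le> card (\<Union>z\<in>roots_of_one m L. ?F z)"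
      using finV finite_roots_of_one[OF m(1)] by (intro card_mono finite_UN_I) auto
    also have "\<dots> \<le> (\<Sum>z\<in>roots_of_one m L. card (?F z))"
      by (rule card_UN_le[OF finite_roots_of_one[OF m(1)]])
    also have "\<dots> \<le> (\<Sum>z\<in>roots_of_one m L. card (vanishing ?H'))"
      by (intro sum_mono fiber)
    also have "\<dots> \<le> m * card (vanishing ?H')"
      using card_roots_of_one_le[OF m(1)] by simp
    finally show ?thesis .
  qed
  ultimately have "(m * card H) * card (vanishing H) \<le> card ?H' * (m * card (vanishing ?H'))"
    by (rule mult_le_mono)
  then show ?thesis using m(1) by (simp add: mult_ac)
qed

lemma card_vanishing_mono:
  assumes "subgroup H G" "subgroup H' G" "H \<subseteq> H'"
  shows "card (vanishing H) * card H \<le> card (vanishing H') * card H'"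
  using assms(1,3)
proof (induction "card H' - card H" arbitrary: H rule: less_induct)
  case less
  have H'G: "H' \<subseteq> carrier G" using subgroup.subset[OF assms(2)] .
  have fin: "finite H'" using H'G finite_G finite_subset by blast
  show ?case
  proof (cases "H = H'")
    case False
    then obtain g where g: "g \<in> H'" "g \<notin> H" using less.prems(2) by blast
    let ?J = "generate G (insert g H)"
    have sub: "insert g H \<subseteq> carrier G" using g less.prems(2) H'G by blast
    have J: "subgroup ?J G" using G.generate_is_subgroup[OF sub] .
    have JH': "?J \<subseteq> H'"
      using g less.prems(2) by (intro G.generate_subgroup_incl[OF _ assms(2)]) blast
    have "insert g H \<subseteq> ?J" by (auto intro: generate.incl)
    then have "H \<subset> ?J" using g(2) by blast
    then have "card H < card ?J" using JH' fin finite_subset psubset_card_mono by metis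
    moreover have "card ?J \<le> card H'" using JH' fin card_mono by blast
    ultimately have "card H' - card ?J < card H' - card H" by linarith
    from less.hyps[OF this J JH']
    have "card (vanishing ?J) * card ?J \<le> card (vanishing H') * card H'" .
    moreover have "g \<in> carrier G" using g H'G by blast
    ultimately show ?thesis using card_vanishing_step[OF less.prems(1) _ g(2)] by (meson order_trans)
  qed simp
qed

lemma vanishing_G: "vanishing (carrier G) = {\<one>\<^bsub>C.Z1\<^esub>}"
proof -
  have one: "\<one>\<^bsub>C.Z1\<^esub> \<in> Z" using C.Z1.one_closed by simp
  have "f = \<one>\<^bsub>C.Z1\<^esub>" if "f \<in> Z" "\<forall>\<phi>\<in>carrier G. f \<phi> = \<one>" for f
  proof (rule C.crossed_hom_ext[OF that(1) one])
    show "f \<phi> = \<one>\<^bsub>C.Z1\<^esub> \<phi>" if "\<phi> \<in> carrier G" for \<phi>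
      using bspec[OF \<open>\<forall>\<phi>\<in>carrier G. f \<phi> = \<one>\<close> that] that by simp
  qed
  moreover have "\<one>\<^bsub>C.Z1\<^esub> \<phi> = \<one>" if "\<phi> \<in> carrier G" for \<phi> using that by simp
  ultimately show ?thesis using one unfolding vanishing_def by blast
qed

lemma card_vanishing_le:
  assumes "subgroup H G"
  shows "card (vanishing H) * card H \<le> order G"
  using card_vanishing_mono[OF assms G.subgroup_self subgroup.subset[OF assms]] vanishing_G
  by (simp add: order_def)

text \<open>Monotonicity from the trivial subgroup, on which all of \<open>Z\<close> vanishes.
  Together with \<open>card_vanishing_le\<close> it shows that, if card Z = order G, the product
  card (vanishing H) * card H is order G for every subgroup \<open>H\<close>.\<close>

lemma card_Z_le:
  assumes "subgroup H G"
  shows "card Z \<le> card (vanishing H) * card H"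
proof -
  have "vanishing {\<one>\<^bsub>G\<^esub>} = Z" using Z_one by (auto simp: vanishing_def)
  then show ?thesis
    using card_vanishing_mono[OF G.triv_subgroup assms] subgroup.one_closed[OF assms] by simp
qed

end

section \<open>Graded parts\<close>

lemma (in ring) finsum_mem_closed:
  assumes "V \<subseteq> carrier R" "\<zero> \<in> V" "\<And>u v. u \<in> V \<Longrightarrow> v \<in> V \<Longrightarrow> u \<oplus> v \<in> V" "g \<in> F \<rightarrow> V"
  shows "finsum R g F \<in> V"
proof (cases "finite F")
  case True
  then show ?thesis using assms(4)
  proof (induction F rule: finite_induct)
    case (insert x F)
    have gF: "g \<in> F \<rightarrow> V" and gx: "g x \<in> V" using insert.prems by auto
    have "g \<in> F \<rightarrow> carrier R" "g x \<in> carrier R" using gF gx assms(1) by auto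
    then have "finsum R g (insert x F) = g x \<oplus> finsum R g F"
      using insert.hyps by (intro finsum_insert)
    then show ?case using assms(3)[OF gx insert.IH[OF gF]] by simp
  qed (simp add: assms(2))
qed (simp add: assms(2) finsum_infinite)

text \<open>Both families are extended by zero to the union of their supports.\<close>

lemma (in ring) graded_part_add:
  fixes A :: "'d \<Rightarrow> 'a set"
  assumes A: "\<And>d. d \<in> S \<Longrightarrow> A d \<subseteq> carrier R" "\<And>d. d \<in> S \<Longrightarrow> \<zero> \<in> A d"
    "\<And>d x y. d \<in> S \<Longrightarrow> x \<in> A d \<Longrightarrow> y \<in> A d \<Longrightarrow> x \<oplus> y \<in> A d"
    and x: "x \<in> graded_part R A S" and y: "y \<in> graded_part R A S"
  shows "x \<oplus> y \<in> graded_part R A S"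
proof -
  obtain f F where f: "finite F" "F \<subseteq> S" "f \<in> Pi F A" "x = finsum R f F"
    using x by (auto simp: graded_part_def)
  obtain g F' where g: "finite F'" "F' \<subseteq> S" "g \<in> Pi F' A" "y = finsum R g F'"
    using y by (auto simp: graded_part_def)
  define ext where "ext = (\<lambda>(f :: 'd \<Rightarrow> 'a) F d. if d \<in> F then f d else \<zero>)"
  have ext: "ext f F d \<in> A d" "ext f F d \<in> carrier R" if "f \<in> Pi F A" "d \<in> S" for f F d
    using that A(1,2)[of d] by (auto simp: ext_def Pi_iff)
  have sum: "finsum R f F = finsum R (ext f F) (F \<union> F')"
    if "finite F" "finite F'" "F \<subseteq> S" "F' \<subseteq> S" "f \<in> Pi F A" for f F F'
  proof (rule add.finprod_mono_neutral_cong_left)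
    show "ext f F \<in> F \<union> F' \<rightarrow> carrier R" using ext(2)[OF that(5)] that by blast
  qed (use that in \<open>auto simp: ext_def\<close>)
  have "x \<oplus> y = finsum R (ext f F) (F \<union> F') \<oplus> finsum R (ext g F') (F' \<union> F)"
    using sum[of F F' f] sum[of F' F g] f g by simp
  also have "\<dots> = (\<Oplus>d\<in>F \<union> F'. ext f F d \<oplus> ext g F' d)"
    using ext(2)[OF f(3)] ext(2)[OF g(3)] f(2) g(2)
    by (subst finsum_addf) (auto simp: Un_commute)
  finally have "x \<oplus> y = (\<Oplus>d\<in>F \<union> F'. ext f F d \<oplus> ext g F' d)" .
  moreover have "(\<lambda>d. ext f F d \<oplus> ext g F' d) \<in> Pi (F \<union> F') A"
    using ext(1)[OF f(3)] ext(1)[OF g(3)] f(2) g(2) A(3) by blast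
  moreover have "finite (F \<union> F')" "F \<union> F' \<subseteq> S" using f g by auto
  ultimately show ?thesis unfolding graded_part_def by blast
qed

lemma (in ring) graded_part_single:
  assumes "d \<in> S" "x \<in> A d" "x \<in> carrier R"
  shows "x \<in> graded_part R A S"
proof -
  have "finsum R (\<lambda>_. x) {d} = x" using assms(3) by simp
  moreover have "finite {d}" "{d} \<subseteq> S" "(\<lambda>_. x) \<in> Pi {d} A" using assms by auto
  ultimately show ?thesis unfolding graded_part_def by force
qed

text \<open>A prime divisor \<open>q\<close> of the order of \<open>x\<close> divides
  \<open>l\<close>, and some power of \<open>x\<close> has order exactly \<open>q\<close>, so
  \<open>q\<close> does not vanish in the field. From l = q r it follows that \<open>r\<close>
  vanishes there, although 0 < r < l.\<close>

lemma (in field) char_power_torsion_trivial: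
  assumes K: "subring K R" and l: "ring_characteristic (R\<lparr>carrier := K\<rparr>) = l" "0 < l"
    and x: "x \<in> carrier R" "x [^] (l ^ k) = \<one>"
  shows "x = \<one>"
proof (rule ccontr)
  assume "x \<noteq> \<one>"
  interpret K: ring "R\<lparr>carrier := K\<rparr>" using subring_is_ring[OF K] .
  have "[j] \<cdot>\<^bsub>R\<lparr>carrier := K\<rparr>\<^esub> \<one> = [j] \<cdot> \<one>" for j :: nat
    by (simp add: add_pow_def nat_pow_def)
  then have char: "[j] \<cdot> \<one> = \<zero> \<longleftrightarrow> l dvd j" for j :: nat
    using K.add.pow_eq_id[of \<one> j] l(1) subringE(3)[OF K]
    by (simp add: ring_characteristic_def)
  let ?N = "l ^ k"
  interpret M: comm_group "roots_of_one_group ?N R" by (rule comm_group_roots_of_one)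
  have N: "0 < ?N" using l(2) by simp
  have xN: "x \<in> roots_of_one ?N R" using x N by (simp add: roots_of_one_eq)
  let ?m = "M.ord x"
  have ord: "x [^] j = \<one> \<longleftrightarrow> ?m dvd j" for j :: nat
    using M.pow_eq_id[of x j] xN by simp
  have "?m \<noteq> 1" using ord[of 1] x(1) \<open>x \<noteq> \<one>\<close> by auto
  then obtain q where q: "prime q" "q dvd ?m" using prime_factor_nat by blast
  have m: "?m dvd ?N" using ord x(2) by simp
  then have "q dvd l" using q prime_dvd_power dvd_trans by blast
  obtain t where t: "?m = q * t" using q(2) ..
  have "?m \<noteq> 0" using m N by (metis dvd_0_left_iff less_irrefl)
  then have t0: "0 < t" using t by auto
  have q1: "1 < q" using q(1) prime_gt_1_nat by blast
  have pow: "(x [^] t) [^] i = \<one> \<longleftrightarrow> q dvd i" for i :: nat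
    using x(1) ord[of "t * i"] t t0 by (simp add: nat_pow_pow mult.commute)
  have "[q] \<cdot> \<one> \<noteq> \<zero>"
  proof (rule ord_not_zero_in_field)
    show "(x [^] t) [^] i \<noteq> \<one>" if "0 < i" "i < q" for i
      using that pow by (auto dest: dvd_imp_le)
  qed (use x(1) pow q1 in auto)
  moreover obtain r where r: "l = q * r" using \<open>q dvd l\<close> ..
  have "[l] \<cdot> \<one> = ([q] \<cdot> \<one>) \<otimes> ([r] \<cdot> \<one>)"
    by (simp add: add_pow_ldistr add.nat_pow_pow r mult.commute)
  moreover have "[l] \<cdot> \<one> = \<zero>" using char by simp
  ultimately have "[r] \<cdot> \<one> = \<zero>" using integral by (metis add.nat_pow_closed one_closed)
  then have "l dvd r" using char by simp
  moreover have "0 < r" "r < l" using r l(2) q1 by auto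
  ultimately show False by (auto dest: dvd_imp_le)
qed

section \<open>The isotypic grading\<close>

text \<open>The kernel of a \<open>K\<close>-linear map. By independence it is all of
  \<open>L\<close> only if \<open>x\<close> vanishes on \<open>G\<close>. Dimension counts produce a
  nonzero \<open>x\<close> and reach a contradiction by showing that this kernel contains a spanning
  set.\<close>

definition (in finite_galois) annihilated :: "(('a \<Rightarrow> 'a) \<Rightarrow> 'a) \<Rightarrow> 'a set"
  where "annihilated x = {s \<in> carrier L. (\<Oplus>\<phi>\<in>carrier G. x \<phi> \<otimes> \<phi> s) = \<zero>}"

lemma (in finite_galois) annihilated_closed:
  assumes x: "x \<in> carrier G \<rightarrow> carrier L"
  shows "\<zero> \<in> annihilated x"
    and "s \<in> annihilated x \<Longrightarrow> t \<in> annihilated x \<Longrightarrow> s \<oplus> t \<in> annihilated x"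
    and "k \<in> K \<Longrightarrow> s \<in> annihilated x \<Longrightarrow> k \<otimes> s \<in> annihilated x"
proof -
  have "(\<Oplus>\<phi>\<in>carrier G. x \<phi> \<otimes> \<phi> \<zero>) = (\<Oplus>\<phi>\<in>carrier G. \<zero>)"
    using x by (intro finsum_cong') (auto simp: Pi_iff)
  then show "\<zero> \<in> annihilated x" by (simp add: annihilated_def)
next
  assume s: "s \<in> annihilated x" and t: "t \<in> annihilated x"
  have "(\<Oplus>\<phi>\<in>carrier G. x \<phi> \<otimes> \<phi> (s \<oplus> t)) = (\<Oplus>\<phi>\<in>carrier G. x \<phi> \<otimes> \<phi> s \<oplus> x \<phi> \<otimes> \<phi> t)"
    using s t x by (intro finsum_cong') (auto simp: annihilated_def Pi_iff r_distr)
  also have "\<dots> = (\<Oplus>\<phi>\<in>carrier G. x \<phi> \<otimes> \<phi> s) \<oplus> (\<Oplus>\<phi>\<in>carrier G. x \<phi> \<otimes> \<phi> t)"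
    using s t x by (intro finsum_addf) (auto simp: annihilated_def Pi_iff)
  finally show "s \<oplus> t \<in> annihilated x" using s t by (simp add: annihilated_def)
next
  assume "k \<in> K" and s: "s \<in> annihilated x"
  then have k: "k \<in> carrier L" by (simp add: K_subset)
  have "(\<Oplus>\<phi>\<in>carrier G. x \<phi> \<otimes> \<phi> (k \<otimes> s)) = (\<Oplus>\<phi>\<in>carrier G. k \<otimes> (x \<phi> \<otimes> \<phi> s))"
    using s x k \<open>k \<in> K\<close>
    by (intro finsum_cong') (auto simp: annihilated_def Pi_iff G_fixes_K m_lcomm)
  also have "\<dots> = k \<otimes> (\<Oplus>\<phi>\<in>carrier G. x \<phi> \<otimes> \<phi> s)"
    using s x k finite_G by (intro finsum_rdistr[symmetric]) (auto simp: annihilated_def Pi_iff)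
  finally show "k \<otimes> s \<in> annihilated x" using s k by (simp add: annihilated_def)
qed

context finite_galois_roots
begin

text \<open>An eigenspace for a twisted character, as \<open>G\<close> may move the values of
  \<open>f\<close>. By \<open>isotypic_nonzero\<close> and \<open>isotypic_quotient\<close> it is a
  line over \<open>K\<close> for each \<open>f\<close> in \<open>Z\<close>.\<close>

definition isotypic :: "(('a \<Rightarrow> 'a) \<Rightarrow> 'a) \<Rightarrow> 'a set"
  where "isotypic f = {x \<in> carrier L. \<forall>\<phi>\<in>carrier G. \<phi> x = f \<phi> \<otimes> x}"

lemma isotypic_carrier: "x \<in> isotypic f \<Longrightarrow> x \<in> carrier L"
  by (simp add: isotypic_def)

lemma isotypic_apply: "x \<in> isotypic f \<Longrightarrow> \<phi> \<in> carrier G \<Longrightarrow> \<phi> x = f \<phi> \<otimes> x"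
  by (simp add: isotypic_def)

lemma isotypicI:
  "x \<in> carrier L \<Longrightarrow> (\<And>\<phi>. \<phi> \<in> carrier G \<Longrightarrow> \<phi> x = f \<phi> \<otimes> x) \<Longrightarrow> x \<in> isotypic f"
  by (simp add: isotypic_def)

lemma Z_value: "f \<in> Z \<Longrightarrow> \<phi> \<in> carrier G \<Longrightarrow> f \<phi> \<in> carrier L" "f \<in> Z \<Longrightarrow> \<phi> \<in> carrier G \<Longrightarrow> f \<phi> \<noteq> \<zero>"
  using roots_of_one_carrier[OF Z_closed] by blast+

lemma isotypic_smult:
  assumes "f \<in> Z" "k \<in> K" "x \<in> isotypic f"
  shows "k \<otimes> x \<in> isotypic f"
  using assms K_subset isotypic_carrier Z_value
  by (intro isotypicI) (simp_all add: isotypic_apply G_fixes_K m_lcomm)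

lemma isotypic_add:
  assumes "f \<in> Z" "x \<in> isotypic f" "y \<in> isotypic f"
  shows "x \<oplus> y \<in> isotypic f"
  using assms isotypic_carrier Z_value
  by (intro isotypicI) (simp_all add: isotypic_apply r_distr)

lemma isotypic_zero: "f \<in> Z \<Longrightarrow> \<zero> \<in> isotypic f"
  using Z_value by (intro isotypicI) simp_all

lemma subalgebra_isotypic:
  assumes f: "f \<in> Z"
  shows "subalgebra K (isotypic f) L"
proof -
  have "subgroup (isotypic f) (add_monoid L)"
  proof (rule add.subgroupI)
    show "isotypic f \<noteq> {}" using isotypic_zero[OF f] by blast
    show "\<ominus> x \<in> isotypic f" if "x \<in> isotypic f" for x
      using that f isotypic_carrier Z_value
      by (intro isotypicI) (simp_all add: isotypic_apply r_minus)
    show "x \<oplus> y \<in> isotypic f" if "x \<in> isotypic f" "y \<in> isotypic f" for x y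
      by (rule isotypic_add[OF f that])
  qed (auto dest: isotypic_carrier)
  then show ?thesis
    using isotypic_smult[OF f] by (simp add: subalgebra_def subalgebra_axioms_def)
qed

lemma isotypic_mult:
  assumes "f \<in> Z" "f' \<in> Z" "x \<in> isotypic f" "y \<in> isotypic f'"
  shows "x \<otimes> y \<in> isotypic (f \<otimes>\<^bsub>C.Z1\<^esub> f')"
  using assms isotypic_carrier Z_value
  by (intro isotypicI) (simp_all add: isotypic_apply m_ac)

lemma isotypic_one: "isotypic \<one>\<^bsub>C.Z1\<^esub> = K"
proof -
  have "x \<in> isotypic \<one>\<^bsub>C.Z1\<^esub> \<longleftrightarrow> x \<in> carrier L \<and> (\<forall>\<phi>\<in>carrier G. \<phi> x = x)" for x
    by (auto simp: isotypic_def)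
  then show ?thesis using fixed_iff_K K_subset by blast
qed

text \<open>Hilbert's Theorem 90.\<close>
lemma isotypic_nonzero:
  assumes f: "f \<in> Z"
  shows "\<exists>x\<in>isotypic f. x \<noteq> \<zero>"
proof -
  have fc: "f \<in> carrier G \<rightarrow> carrier L" using Z_value[OF f] by blast
  have "\<exists>c\<in>carrier L. (\<Oplus>\<tau>\<in>carrier G. f \<tau> \<otimes> \<tau> c) \<noteq> \<zero>"
  proof (rule ccontr)
    assume "\<not> ?thesis"
    then have "(\<Oplus>\<tau>\<in>carrier G. f \<tau> \<otimes> \<tau> c) = \<zero>" if "c \<in> carrier L" for c using that by blast
    from automorphisms_independent[OF fc this G.one_closed] show False
      using Z_one[OF f] by simp
  qed
  then obtain c where c: "c \<in> carrier L" "(\<Oplus>\<tau>\<in>carrier G. f \<tau> \<otimes> \<tau> c) \<noteq> \<zero>" by blast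
  \<comment> \<open>The Poincare series of \<open>c\<close>. It satisfies f(\<phi>) \<phi>(b) = b,
    which puts its inverse into \<open>isotypic f\<close>.\<close>
  define b where "b = (\<Oplus>\<tau>\<in>carrier G. f \<tau> \<otimes> \<tau> c)"
  have summand: "(\<lambda>\<tau>. f \<tau> \<otimes> \<tau> c) \<in> carrier G \<rightarrow> carrier L" using fc c(1) by auto
  have b: "b \<in> carrier L" "b \<noteq> \<zero>" using c summand by (simp_all add: b_def)
  have fb: "f \<phi> \<otimes> \<phi> b = b" if p: "\<phi> \<in> carrier G" for \<phi>
  proof -
    have "f \<phi> \<otimes> \<phi> b = f \<phi> \<otimes> (\<Oplus>\<tau>\<in>carrier G. \<phi> (f \<tau> \<otimes> \<tau> c))"
      unfolding b_def using G_finsum[OF p summand] by simp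
    also have "\<dots> = (\<Oplus>\<tau>\<in>carrier G. f \<phi> \<otimes> \<phi> (f \<tau> \<otimes> \<tau> c))"
      using p Z_value[OF f] c(1) finite_G by (intro finsum_rdistr) auto
    also have "\<dots> = (\<Oplus>\<tau>\<in>carrier G. f (\<phi> \<otimes>\<^bsub>G\<^esub> \<tau>) \<otimes> (\<phi> \<otimes>\<^bsub>G\<^esub> \<tau>) c)"
      using p Z_value[OF f] c(1) by (intro finsum_cong') (simp_all add: Z_mult[OF f] m_assoc)
    also have "\<dots> = b"
      unfolding b_def by (rule finsum_left_translate[OF G.subgroup_self p summand])
    finally show ?thesis .
  qed
  have "\<phi> (inv b) = f \<phi> \<otimes> inv b" if p: "\<phi> \<in> carrier G" for \<phi>
  proof -
    have v: "f \<phi> \<in> carrier L" using Z_value[OF f p] by blast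
    have "inv (\<phi> b) = f \<phi> \<otimes> inv b"
    proof (rule comm_inv_char)
      have "\<phi> b \<otimes> (f \<phi> \<otimes> inv b) = (f \<phi> \<otimes> \<phi> b) \<otimes> inv b"
        using v b p by (simp add: m_ac)
      then show "\<phi> b \<otimes> (f \<phi> \<otimes> inv b) = \<one>" using fb[OF p] b by simp
    qed (use v b p in auto)
    then show ?thesis using p b by simp
  qed
  then have "inv b \<in> isotypic f" using b by (intro isotypicI) auto
  then show ?thesis using b by (intro bexI[of _ "inv b"]) auto
qed

text \<open>The factor f(\<phi>) cancels in x / y, which is therefore fixed by
  \<open>G\<close>.\<close>

lemma isotypic_quotient:
  assumes f: "f \<in> Z" and x: "x \<in> isotypic f" and y: "y \<in> isotypic f" "y \<noteq> \<zero>"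
  shows "\<exists>k\<in>K. x = k \<otimes> y"
proof
  have c: "x \<in> carrier L" "y \<in> carrier L" using x y isotypic_carrier by auto
  have "\<phi> (x \<otimes> inv y) = x \<otimes> inv y" if p: "\<phi> \<in> carrier G" for \<phi>
  proof -
    have v: "f \<phi> \<in> carrier L" "f \<phi> \<noteq> \<zero>" using Z_value[OF f p] by blast+
    have "\<phi> (x \<otimes> inv y) \<otimes> \<phi> y = \<phi> x" using p c y(2) by (simp flip: G_mult add: m_assoc)
    also have "\<phi> x = (x \<otimes> inv y) \<otimes> \<phi> y"
    proof -
      have i: "inv y \<in> carrier L" using c y(2) by simp
      have "(x \<otimes> inv y) \<otimes> (f \<phi> \<otimes> y) = (f \<phi> \<otimes> x) \<otimes> (inv y \<otimes> y)"
        using c i v(1) by (simp add: m_ac del: inv_nonzero)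
      then show ?thesis
        using c y(2) v by (simp add: isotypic_apply[OF x p] isotypic_apply[OF y(1) p])
    qed
    finally show ?thesis
      using p c y(2) m_rcancel[of "\<phi> y" "\<phi> (x \<otimes> inv y)" "x \<otimes> inv y"] by simp
  qed
  then show "x \<otimes> inv y \<in> K" using fixed_iff_K[of "x \<otimes> inv y"] c y(2) by simp
  show "x = x \<otimes> inv y \<otimes> y" using c y(2) by (simp add: m_assoc)
qed

text \<open>Dual to \<open>vanishing\<close>: the two form the Galois connection of the pairing
  between \<open>Z\<close> and \<open>G\<close>.\<close>

definition common_zeros :: "(('a \<Rightarrow> 'a) \<Rightarrow> 'a) set \<Rightarrow> ('a \<Rightarrow> 'a) set"
  where "common_zeros T = {\<phi> \<in> carrier G. \<forall>f\<in>T. f \<phi> = \<one>}"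

lemma subgroup_common_zeros:
  assumes "T \<subseteq> Z"
  shows "subgroup (common_zeros T) G"
proof -
  have z: "subgroup {\<phi> \<in> carrier G. f \<phi> = \<one>} G" if "f \<in> T" for f
    using subgroup_zeros assms that by blast
  show ?thesis
  proof (rule G.subgroupI)
    have "\<one>\<^bsub>G\<^esub> \<in> common_zeros T" using Z_one assms by (auto simp: common_zeros_def)
    then show "common_zeros T \<noteq> {}" by blast
    show "inv\<^bsub>G\<^esub> \<phi> \<in> common_zeros T" if "\<phi> \<in> common_zeros T" for \<phi>
      using that subgroup.m_inv_closed[OF z] by (simp add: common_zeros_def)
    show "\<phi> \<otimes>\<^bsub>G\<^esub> \<tau> \<in> common_zeros T" if "\<phi> \<in> common_zeros T" "\<tau> \<in> common_zeros T" for \<phi> \<tau>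
      using that subgroup.m_closed[OF z] by (simp add: common_zeros_def)
  qed (auto simp: common_zeros_def)
qed

text \<open>Components with degree in \<open>T\<close> are fixed by \<open>common_zeros T\<close>,
  as f(\<phi>) = 1 there. Conversely, their union is closed under products, and since each of them
  has a nonzero element, its stabilizer is exactly \<open>common_zeros T\<close>; so
  \<open>fixed_by_stabilizer_in_span\<close> applies.\<close>

lemma graded_part_isotypic:
  assumes T: "subgroup T C.Z1"
  shows "graded_part L isotypic T = {x \<in> carrier L. \<forall>\<phi>\<in>common_zeros T. \<phi> x = x}"
proof (intro equalityI subsetI)
  have TZ: "T \<subseteq> Z" using subgroup.subset[OF T] by simp
  fix x assume "x \<in> graded_part L isotypic T"
  then obtain a F where a: "finite F" "F \<subseteq> T" "a \<in> Pi F isotypic" "x = finsum L a F"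
    by (auto simp: graded_part_def)
  let ?V = "{x \<in> carrier L. \<forall>\<phi>\<in>common_zeros T. \<phi> x = x}"
  have zG: "\<phi> \<in> carrier G" if "\<phi> \<in> common_zeros T" for \<phi> using that by (simp add: common_zeros_def)
  have "finsum L a F \<in> ?V"
  proof (rule finsum_mem_closed)
    show "u \<oplus> v \<in> ?V" if "u \<in> ?V" "v \<in> ?V" for u v
    proof -
      have "\<phi> (u \<oplus> v) = u \<oplus> v" if p: "\<phi> \<in> common_zeros T" for \<phi>
      proof -
        have "\<phi> u = u" "\<phi> v = v" using \<open>u \<in> ?V\<close> \<open>v \<in> ?V\<close> p by blast+
        then show ?thesis using zG[OF p] \<open>u \<in> ?V\<close> \<open>v \<in> ?V\<close> by simp
      qed
      then show ?thesis using that by simp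
    qed
    show "a \<in> F \<rightarrow> ?V"
    proof
      fix f assume f: "f \<in> F"
      then have af: "a f \<in> isotypic f" using a(3) by blast
      have "\<phi> (a f) = a f" if "\<phi> \<in> common_zeros T" for \<phi>
      proof -
        have "f \<phi> = \<one>" using that f a(2) by (auto simp: common_zeros_def)
        then show ?thesis using isotypic_apply[OF af zG[OF that]] isotypic_carrier[OF af] by simp
      qed
      then show "a f \<in> ?V" using isotypic_carrier[OF af] by simp
    qed
  qed (use zG in auto)
  then show "x \<in> ?V" using a(4) by simp
next
  have TZ: "T \<subseteq> Z" using subgroup.subset[OF T] by simp
  fix x assume x: "x \<in> {x \<in> carrier L. \<forall>\<phi>\<in>common_zeros T. \<phi> x = x}"
  let ?V = "graded_part L isotypic T"
  show "x \<in> ?V"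
  proof (rule fixed_by_stabilizer_in_span)
    show "(\<Union>f\<in>T. isotypic f) \<subseteq> carrier L" using isotypic_carrier by blast
    have "\<one> \<in> isotypic \<one>\<^bsub>C.Z1\<^esub>" using isotypic_one K_closed(1) by blast
    then show "\<one> \<in> (\<Union>f\<in>T. isotypic f)" using subgroup.one_closed[OF T] by blast
    show "s \<otimes> t \<in> (\<Union>f\<in>T. isotypic f)"
      if "s \<in> (\<Union>f\<in>T. isotypic f)" "t \<in> (\<Union>f\<in>T. isotypic f)" for s t
    proof -
      obtain f f' where f: "f \<in> T" "f' \<in> T" "s \<in> isotypic f" "t \<in> isotypic f'"
        using \<open>s \<in> _\<close> \<open>t \<in> _\<close> by blast
      have "s \<otimes> t \<in> isotypic (f \<otimes>\<^bsub>C.Z1\<^esub> f')"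
        using f TZ by (intro isotypic_mult) auto
      moreover have "f \<otimes>\<^bsub>C.Z1\<^esub> f' \<in> T" using f subgroup.m_closed[OF T] by blast
      ultimately show ?thesis by blast
    qed
    show "u \<oplus> v \<in> ?V" if "u \<in> ?V" "v \<in> ?V" for u v
    proof (rule graded_part_add[OF _ _ _ that])
      show "isotypic d \<subseteq> carrier L" for d using isotypic_carrier by blast
      show "\<zero> \<in> isotypic d" if "d \<in> T" for d using isotypic_zero TZ that by blast
      show "u \<oplus> v \<in> isotypic d" if "d \<in> T" "u \<in> isotypic d" "v \<in> isotypic d" for d u v
        using isotypic_add TZ that by blast
    qed
    show "k \<otimes> s \<in> ?V" if "k \<in> K" "s \<in> (\<Union>f\<in>T. isotypic f)" for k s
    proof -
      obtain f where f: "f \<in> T" "s \<in> isotypic f" using \<open>s \<in> _\<close> by blast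
      have "k \<otimes> s \<in> isotypic f" using isotypic_smult f TZ \<open>k \<in> K\<close> by blast
      then show ?thesis using f(1) isotypic_carrier by (intro graded_part_single)
    qed
    show "x \<in> carrier L" using x by simp
    fix \<phi> assume p: "\<phi> \<in> carrier G" and fix_s: "\<And>s. s \<in> (\<Union>f\<in>T. isotypic f) \<Longrightarrow> \<phi> s = s"
    have "f \<phi> = \<one>" if f: "f \<in> T" for f
    proof -
      have fZ: "f \<in> Z" using f TZ by blast
      obtain u where u: "u \<in> isotypic f" "u \<noteq> \<zero>" using isotypic_nonzero[OF fZ] by blast
      have uL: "u \<in> carrier L" using isotypic_carrier[OF u(1)] .
      have "u \<in> (\<Union>f\<in>T. isotypic f)" using f u(1) by blast
      then have "f \<phi> \<otimes> u = \<one> \<otimes> u" using fix_s[of u] isotypic_apply[OF u(1) p] uL by simp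
      then show ?thesis using uL u(2) Z_value[OF fZ p] by (subst (asm) m_rcancel) auto
    qed
    then have "\<phi> \<in> common_zeros T" using p by (simp add: common_zeros_def)
    then show "\<phi> x = x" using x by blast
  qed
qed

lemma subset_common_zeros_vanishing:
  assumes H: "H \<subseteq> carrier G"
  shows "H \<subseteq> common_zeros (vanishing H)"
proof
  fix \<phi> assume p: "\<phi> \<in> H"
  have "f \<phi> = \<one>" if "f \<in> vanishing H" for f
  proof -
    have "\<forall>\<phi>\<in>H. f \<phi> = \<one>" using that by (simp add: vanishing_def)
    from bspec[OF this p] show ?thesis .
  qed
  then show "\<phi> \<in> common_zeros (vanishing H)" using p H by (auto simp: common_zeros_def)
qed

lemma vanishing_common_zeros_vanishing:
  assumes H: "H \<subseteq> carrier G"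
  shows "vanishing (common_zeros (vanishing H)) = vanishing H"
proof (intro equalityI subsetI)
  fix f assume "f \<in> vanishing (common_zeros (vanishing H))"
  then have f: "f \<in> Z" "\<forall>\<phi>\<in>common_zeros (vanishing H). f \<phi> = \<one>"
    unfolding vanishing_def[of "common_zeros (vanishing H)"] by simp_all
  have "f \<phi> = \<one>" if "\<phi> \<in> H" for \<phi>
    by (rule bspec[OF f(2) subsetD[OF subset_common_zeros_vanishing[OF H] that]])
  then show "f \<in> vanishing H" using f(1) by (simp add: vanishing_def)
next
  fix f assume f: "f \<in> vanishing H"
  have "f \<phi> = \<one>" if "\<phi> \<in> common_zeros (vanishing H)" for \<phi>
    using that f by (simp add: common_zeros_def)
  moreover have "f \<in> Z" using f by (simp add: vanishing_def)
  ultimately show "f \<in> vanishing (common_zeros (vanishing H))"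
    unfolding vanishing_def[of "common_zeros (vanishing H)"] by simp
qed

lemma vanishing_subgroup: "H \<subseteq> carrier G \<Longrightarrow> subgroup (vanishing H) C.Z1"
proof (rule C.Z1.subgroupI)
  assume H: "H \<subseteq> carrier G"
  have "\<one>\<^bsub>C.Z1\<^esub> \<in> vanishing H"
  proof -
    have "\<one>\<^bsub>C.Z1\<^esub> \<phi> = \<one>" if "\<phi> \<in> H" for \<phi> using that H by (simp add: subset_iff)
    then show ?thesis using C.Z1.one_closed unfolding vanishing_def by simp
  qed
  then show "vanishing H \<noteq> {}" by blast
  show "vanishing H \<subseteq> carrier C.Z1" by (auto simp: vanishing_def)
  show "inv\<^bsub>C.Z1\<^esub> f \<in> vanishing H" if "f \<in> vanishing H" for f
  proof -
    have f: "f \<in> Z" "\<forall>\<phi>\<in>H. f \<phi> = \<one>" using that by (simp_all add: vanishing_def)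
    have "inv\<^bsub>C.Z1\<^esub> f \<in> Z" using C.Z1.inv_closed[of f] f(1) by simp
    moreover have "(inv\<^bsub>C.Z1\<^esub> f) \<phi> = \<one>" if "\<phi> \<in> H" for \<phi>
      using bspec[OF f(2) that] that H f(1) C.M.inv_one by (simp add: subset_iff)
    ultimately show ?thesis by (simp add: vanishing_def)
  qed
  show "f \<otimes>\<^bsub>C.Z1\<^esub> f' \<in> vanishing H" if "f \<in> vanishing H" "f' \<in> vanishing H" for f f'
  proof -
    have f: "f \<in> Z" "\<forall>\<phi>\<in>H. f \<phi> = \<one>" "f' \<in> Z" "\<forall>\<phi>\<in>H. f' \<phi> = \<one>"
      using that by (simp_all add: vanishing_def)
    have "f \<otimes>\<^bsub>C.Z1\<^esub> f' \<in> Z" using C.Z1.m_closed[of f f'] f by simp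
    moreover have "(f \<otimes>\<^bsub>C.Z1\<^esub> f') \<phi> = \<one>" if "\<phi> \<in> H" for \<phi>
      using bspec[OF f(2) that] bspec[OF f(4) that] that H by (simp add: subset_iff)
    ultimately show ?thesis unfolding vanishing_def by blast
  qed
qed

end

section \<open>From a full count of crossed homomorphisms to the grading\<close>

lemma (in finite_galois) galois_correspondence:
  assumes E: "subfield E L" "K \<subseteq> E"
  shows "E = {x \<in> carrier L. \<forall>\<phi>\<in>{\<phi> \<in> carrier G. \<forall>y\<in>E. \<phi> y = y}. \<phi> x = x}"
proof (intro equalityI subsetI)
  fix x assume "x \<in> E"
  then show "x \<in> {x \<in> carrier L. \<forall>\<phi>\<in>{\<phi> \<in> carrier G. \<forall>y\<in>E. \<phi> y = y}. \<phi> x = x}"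
    using subfieldE(3)[OF E(1)] by blast
next
  fix x assume x: "x \<in> {x \<in> carrier L. \<forall>\<phi>\<in>{\<phi> \<in> carrier G. \<forall>y\<in>E. \<phi> y = y}. \<phi> x = x}"
  \<comment> \<open>\<open>E\<close> serves both as the multiplicative set \<open>S\<close> and as
    the subspace \<open>V\<close>.\<close>
  show "x \<in> E"
  proof (rule fixed_by_stabilizer_in_span[of E])
    show "E \<subseteq> carrier L" using subfieldE(3)[OF E(1)] .
    show "\<phi> x = x" if "\<phi> \<in> carrier G" "\<And>s. s \<in> E \<Longrightarrow> \<phi> s = s" for \<phi>
    proof -
      have "\<phi> \<in> {\<phi> \<in> carrier G. \<forall>y\<in>E. \<phi> y = y}" using that by (intro CollectI conjI ballI)
      then show ?thesis using x by blast
    qed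
    show "x \<in> carrier L" using x by blast
    note ringE = subringE[OF subfieldE(1)[OF E(1)]]
    show "\<one> \<in> E" by (rule ringE)
    show "s \<otimes> t \<in> E" "s \<oplus> t \<in> E" if "s \<in> E" "t \<in> E" for s t using ringE(6,7) that by blast+
    show "k \<otimes> s \<in> E" if "k \<in> K" "s \<in> E" for k s using ringE(6) that E(2) by blast
  qed
qed

theorem (in finite_galois_cyclotomic) co_galois_grading_isotypic:
  assumes full: "card Z = order G"
  shows "co_galois_grading L K C.Z1 isotypic"
proof -
  \<comment> \<open>The upper bound, applied to the common zeros, on which all of \<open>Z\<close>
    vanishes: card Z * card N is at most order G = card Z.\<close>
  have "common_zeros Z = {\<one>\<^bsub>G\<^esub>}"
  proof -
    let ?N = "common_zeros Z"
    have N: "subgroup ?N G" by (rule subgroup_common_zeros[OF subset_refl])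
    have "vanishing ?N = Z" by (auto simp: vanishing_def common_zeros_def)
    then have "card ?N \<le> 1" using card_vanishing_le[OF N] full order_G_pos by simp
    moreover have "\<one>\<^bsub>G\<^esub> \<in> ?N" using subgroup.one_closed[OF N] .
    moreover have "finite ?N" using subgroup.subset[OF N] finite_G finite_subset by blast
    ultimately have "{\<one>\<^bsub>G\<^esub>} = ?N" by (intro card_seteq) auto
    then show ?thesis by (rule sym)
  qed
  moreover have "subgroup Z C.Z1" using C.Z1.subgroup_self by simp
  ultimately have graded: "graded_part L isotypic Z = {x \<in> carrier L. \<forall>\<phi>\<in>{\<one>\<^bsub>G\<^esub>}. \<phi> x = x}"
    using graded_part_isotypic[of Z] by (simp only:)
  have span: "graded_part L isotypic Z = carrier L"
  proof (rule subset_antisym)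
    show "graded_part L isotypic Z \<subseteq> carrier L" unfolding graded by (rule Collect_restrict)
    show "carrier L \<subseteq> graded_part L isotypic Z"
    proof
      fix x assume "x \<in> carrier L"
      then show "x \<in> graded_part L isotypic Z" unfolding graded by simp
    qed
  qed
  have direct: "\<forall>f\<in>F. a f = \<zero>"
    if F: "finite F" "F \<subseteq> Z" "a \<in> Pi F isotypic" "finsum L a F = \<zero>" for F a
  proof (rule ccontr)
    assume "\<not> (\<forall>f\<in>F. a f = \<zero>)"
    then obtain f0 where f0: "f0 \<in> F" "a f0 \<noteq> \<zero>" by blast
    have aL: "a f \<in> carrier L" "a f \<in> isotypic f" if "f \<in> F" for f
    proof -
      show "a f \<in> isotypic f" by (rule Pi_mem[OF F(3) that])
      then show "a f \<in> carrier L" by (rule isotypic_carrier)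
    qed
    define u where "u f = (SOME x. x \<in> isotypic f \<and> x \<noteq> \<zero>)" for f
    have u: "u f \<in> isotypic f \<and> u f \<noteq> \<zero>" if "f \<in> Z" for f
      unfolding u_def by (rule someI_ex) (use isotypic_nonzero[OF that] in blast)
    have "f0 \<in> Z" using F(2) f0(1) by blast
    from card_Diff1_less[OF finite_Z this]
    have card: "card (Z - {f0}) < card (carrier G)" by (simp only: full order_def)
    have finite: "finite (Z - {f0})" using finite_Z by simp
    have "\<exists>x. x \<in> carrier G \<rightarrow> carrier L \<and> (\<exists>\<phi>\<in>carrier G. x \<phi> \<noteq> \<zero>) \<and>
      (\<forall>f\<in>Z - {f0}. (\<Oplus>\<phi>\<in>carrier G. \<phi> (u f) \<otimes> x \<phi>) = \<zero>)"
    proof (rule homogeneous_system_nontrivial_solution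
        [of "Z - {f0}" "carrier G" "\<lambda>f \<phi>. \<phi> (u f)", OF finite finite_G card])
      show "\<phi> (u f) \<in> carrier L" if "f \<in> Z - {f0}" "\<phi> \<in> carrier G" for f \<phi>
        using that u[of f] isotypic_carrier[of "u f" f] by simp
    qed
    then obtain x where x: "x \<in> carrier G \<rightarrow> carrier L" "\<exists>\<phi>\<in>carrier G. x \<phi> \<noteq> \<zero>"
      "\<forall>f\<in>Z - {f0}. (\<Oplus>\<phi>\<in>carrier G. \<phi> (u f) \<otimes> x \<phi>) = \<zero>"
      by (elim exE conjE) (rule that)
    let ?V = "annihilated x"
    note V = annihilated_closed[OF x(1)]
    have VL: "?V \<subseteq> carrier L" by (auto simp: annihilated_def)
    have V_other: "s \<in> ?V" if f: "f \<in> Z - {f0}" and s: "s \<in> isotypic f" for f s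
    proof -
      have uf: "u f \<in> isotypic f" "u f \<noteq> \<zero>" using u f by auto
      have "(\<Oplus>\<phi>\<in>carrier G. x \<phi> \<otimes> \<phi> (u f)) = (\<Oplus>\<phi>\<in>carrier G. \<phi> (u f) \<otimes> x \<phi>)"
        using x(1) isotypic_carrier[OF uf(1)] by (intro finsum_cong') (auto simp: Pi_iff m_comm)
      then have "u f \<in> ?V" using bspec[OF x(3) f] isotypic_carrier[OF uf(1)] by (simp add: annihilated_def)
      moreover obtain k where "k \<in> K" "s = k \<otimes> u f"
        using isotypic_quotient[OF _ s uf] f by blast
      ultimately show ?thesis using V(3) by blast
    qed
    have "finsum L a (F - {f0}) \<in> ?V"
    proof (rule finsum_mem_closed)
      show "a \<in> F - {f0} \<rightarrow> ?V"
      proof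
        fix f assume f: "f \<in> F - {f0}"
        then have "f \<in> Z - {f0}" using F(2) by blast
        then show "a f \<in> ?V" by (rule V_other) (use aL(2) f in blast)
      qed
    qed (use V(1,2) VL in auto)
    moreover have "a f0 \<oplus> finsum L a (F - {f0}) = \<zero>"
    proof -
      have "finsum L a (insert f0 (F - {f0})) = a f0 \<oplus> finsum L a (F - {f0})"
        using F(1) f0(1) aL by (intro finsum_insert) auto
      then show ?thesis using F(4) f0(1) by (simp add: insert_absorb)
    qed
    moreover have sL: "finsum L a (F - {f0}) \<in> carrier L"
      by (rule subsetD[OF VL]) fact
    ultimately have "\<ominus> finsum L a (F - {f0}) = a f0"
      using aL(1)[OF f0(1)] by (intro minus_equality)
    then have af0: "a f0 = (\<ominus> \<one>) \<otimes> finsum L a (F - {f0})"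
      using sL by (simp add: l_minus)
    have "\<ominus> \<one> \<in> K" using K_closed by blast
    then have "a f0 \<in> ?V" unfolding af0 using \<open>finsum L a (F - {f0}) \<in> ?V\<close> by (rule V(3))
    have V_all: "s \<in> ?V" if f: "f \<in> Z" and s: "s \<in> isotypic f" for f s
    proof (cases "f = f0")
      case True
      then obtain k where "k \<in> K" "s = k \<otimes> a f0"
        using isotypic_quotient[OF f s _ f0(2)] aL(2)[OF f0(1)] by blast
      then show ?thesis using V(3) \<open>a f0 \<in> ?V\<close> by blast
    next
      case False
      then show ?thesis using f s by (intro V_other) auto
    qed
    have "s \<in> ?V" if "s \<in> carrier L" for s
    proof -
      obtain b F' where b: "finite F'" "F' \<subseteq> Z" "b \<in> Pi F' isotypic" "s = finsum L b F'"
        using \<open>s \<in> carrier L\<close> unfolding span[symmetric] by (auto simp: graded_part_def)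
      show ?thesis unfolding b(4)
      proof (rule finsum_mem_closed)
        show "b \<in> F' \<rightarrow> ?V"
        proof
          fix f assume "f \<in> F'"
          then show "b f \<in> ?V" using b(2,3) by (intro V_all[of f]) auto
        qed
      qed (use V(1,2) VL in auto)
    qed
    then have zero: "(\<Oplus>\<phi>\<in>carrier G. x \<phi> \<otimes> \<phi> s) = \<zero>" if "s \<in> carrier L" for s using that by (simp add: annihilated_def)
    obtain \<tau> where "\<tau> \<in> carrier G" "x \<tau> \<noteq> \<zero>" using x(2) by blast
    then show False using automorphisms_independent[OF x(1) zero] by blast
  qed
  have mult: "x \<otimes> y \<in> isotypic (f \<otimes>\<^bsub>C.Z1\<^esub> f')"
    if "f \<in> carrier C.Z1" "f' \<in> carrier C.Z1" "x \<in> isotypic f" "y \<in> isotypic f'" for f f' x y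
    by (rule isotypic_mult[OF _ _ that(3,4)]) (use that(1,2) in simp_all)
  have direct': "\<forall>F a. finite F \<and> F \<subseteq> carrier C.Z1 \<and> a \<in> Pi F isotypic \<and> finsum L a F = \<zero> \<longrightarrow>
    (\<forall>f\<in>F. a f = \<zero>)"
  proof (rule allI, rule allI, rule impI)
    fix F a
    assume F: "finite F \<and> F \<subseteq> carrier C.Z1 \<and> a \<in> Pi F isotypic \<and> finsum L a F = \<zero>"
    have "finite F" "F \<subseteq> Z" "a \<in> Pi F isotypic" "finsum L a F = \<zero>" using F by simp_all
    from direct[OF this] show "\<forall>f\<in>F. a f = \<zero>" .
  qed
  have "\<forall>f\<in>carrier C.Z1. subalgebra K (isotypic f) L"
    by (simp add: subalgebra_isotypic)
  moreover have "\<forall>f\<in>carrier C.Z1. \<forall>f'\<in>carrier C.Z1. \<forall>x\<in>isotypic f. \<forall>y\<in>isotypic f'.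
      x \<otimes> y \<in> isotypic (f \<otimes>\<^bsub>C.Z1\<^esub> f')"
    by (intro ballI mult)
  moreover have "graded_part L isotypic (carrier C.Z1) = carrier L" using span by simp
  ultimately have "grading L K C.Z1 isotypic"
    unfolding grading_def using C.comm_group_Z1 direct' by (intro conjI)
  moreover have "isotypic f \<inter> Units L \<noteq> {}" if f: "f \<in> Z" for f
  proof -
    obtain u where "u \<in> isotypic f" "u \<noteq> \<zero>" using isotypic_nonzero[OF f] by blast
    then have "u \<in> isotypic f \<inter> Units L" using isotypic_carrier[of u f] by (simp add: field_Units)
    then show ?thesis by blast
  qed
  ultimately have "unitary_grading L K C.Z1 isotypic"
    unfolding unitary_grading_def C.Z1_simps(1) isotypic_one by (intro conjI ballI refl)
  moreover have "primary_component C.Z1 l = {\<one>\<^bsub>C.Z1\<^esub>}"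
    if l: "ring_characteristic (L\<lparr>carrier := K\<rparr>) = l" "0 < l" for l
  proof -
    have trivial: "f = \<one>\<^bsub>C.Z1\<^esub>" if f: "f \<in> Z" "f [^]\<^bsub>C.Z1\<^esub> (l ^ k) = \<one>\<^bsub>C.Z1\<^esub>" for f and k :: nat
    proof (rule C.crossed_hom_ext[OF f(1)])
      show "\<one>\<^bsub>C.Z1\<^esub> \<in> Z" using C.Z1.one_closed by simp
      fix \<phi> assume p: "\<phi> \<in> carrier G"
      have "f \<phi> [^] (l ^ k) = \<one>" using C.Z1_pow[OF f(1) p, of "l ^ k"] f(2) p by simp
      with Z_value(1)[OF f(1) p] have "f \<phi> = \<one>"
        by (rule char_power_torsion_trivial[OF subfieldE(1)[OF K_subfield] l])
      then show "f \<phi> = \<one>\<^bsub>C.Z1\<^esub> \<phi>" using p by simp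
    qed
    moreover have "\<one>\<^bsub>C.Z1\<^esub> \<in> primary_component C.Z1 l"
      unfolding primary_component_def
      by (intro CollectI conjI exI[of _ 0] C.Z1.one_closed C.Z1.nat_pow_one)
    ultimately show ?thesis
    proof (intro equalityI subsetI)
      fix f assume "f \<in> primary_component C.Z1 l"
      then obtain k where "f \<in> Z" "f [^]\<^bsub>C.Z1\<^esub> (l ^ k) = \<one>\<^bsub>C.Z1\<^esub>"
        unfolding primary_component_def C.Z1_simps(1) by (elim CollectE conjE exE) (rule that)
      then show "f \<in> {\<one>\<^bsub>C.Z1\<^esub>}" using trivial by (simp only: singleton_iff)
    qed (simp only: singleton_iff)
  qed
  moreover have "\<exists>T. subgroup T C.Z1 \<and> E = graded_part L isotypic T"
    if E: "subfield E L" "K \<subseteq> E" for E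
  proof -
    define H where "H = {\<phi> \<in> carrier G. \<forall>y\<in>E. \<phi> y = y}"
    have H_mem: "\<phi> \<in> H \<longleftrightarrow> \<phi> \<in> carrier G \<and> (\<forall>y\<in>E. \<phi> y = y)" for \<phi> by (simp add: H_def)
    then have HG: "H \<subseteq> carrier G" by blast
    have fixE: "\<phi> y = y" if "\<phi> \<in> H" "y \<in> E" for \<phi> y using that by (simp add: H_mem)
    have EL: "y \<in> carrier L" if "y \<in> E" for y using subfieldE(3)[OF E(1)] that by blast
    have H: "subgroup H G"
    proof (rule G.subgroupI)
      have "\<one>\<^bsub>G\<^esub> \<in> H" using EL by (simp add: H_mem)
      then show "H \<noteq> {}" by blast
      show "inv\<^bsub>G\<^esub> \<phi> \<in> H" if p: "\<phi> \<in> H" for \<phi>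
      proof -
        have pG: "\<phi> \<in> carrier G" using p HG by blast
        have "(inv\<^bsub>G\<^esub> \<phi>) y = y" if "y \<in> E" for y
          using G_apply_inv(2)[OF pG EL[OF that]] fixE[OF p that] by simp
        then show ?thesis using pG by (simp add: H_mem)
      qed
      show "\<phi> \<otimes>\<^bsub>G\<^esub> \<tau> \<in> H" if "\<phi> \<in> H" "\<tau> \<in> H" for \<phi> \<tau>
        using that subsetD[OF HG] EL by (simp add: H_mem)
    qed (rule HG)
    let ?T = "vanishing H"
    have T: "subgroup ?T C.Z1" by (rule vanishing_subgroup[OF HG])
    have TZ: "?T \<subseteq> Z" using subgroup.subset[OF T] by simp
    let ?H' = "common_zeros ?T"
    have H': "subgroup ?H' G" by (rule subgroup_common_zeros[OF TZ])
    note sub = subset_common_zeros_vanishing[OF HG] and van = vanishing_common_zeros_vanishing[OF HG]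
    \<comment> \<open>\<open>?H'\<close> contains \<open>H\<close> and has the same crossed
      homomorphisms vanishing on it. The two bounds meet at order G = card Z, which leaves no room
      between \<open>H\<close> and \<open>?H'\<close>; so the graded part for \<open>?T\<close> is
      the fixed field of \<open>H\<close> itself.\<close>
    have "card ?T * card ?H' \<le> card ?T * card H"
      by (rule order_trans[OF card_vanishing_le[OF H', unfolded van] card_Z_le[OF H, unfolded full]])
    moreover have "0 < card ?T"
      using subgroup.one_closed[OF T] TZ finite_Z finite_subset card_gt_0_iff by blast
    ultimately have "card ?H' \<le> card H" by simp
    moreover have "finite ?H'" using subgroup.subset[OF H'] finite_G finite_subset by blast
    ultimately have "H = ?H'" using sub by (intro card_seteq)
    then have "E = graded_part L isotypic ?T"
      using galois_correspondence[OF E, folded H_def] graded_part_isotypic[OF T] by simp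
    then show ?thesis using T by blast
  qed
  ultimately show ?thesis unfolding co_galois_grading_def by blast
qed

section \<open>Co-Galois gradings of Galois extensions\<close>

lemma (in abelian_monoid) finsum_swap:
  assumes "finite A" "finite B" "\<And>a b. a \<in> A \<Longrightarrow> b \<in> B \<Longrightarrow> h a b \<in> carrier G"
  shows "(\<Oplus>a\<in>A. \<Oplus>b\<in>B. h a b) = (\<Oplus>b\<in>B. \<Oplus>a\<in>A. h a b)"
  using assms(1,3)
proof (induction A rule: finite_induct)
  case (insert x A)
  have hx: "h x \<in> B \<rightarrow> carrier G" using insert.prems by auto
  have hA: "(\<Oplus>b\<in>B. h a b) \<in> carrier G" if "a \<in> insert x A" for a
    using that insert.prems by (intro finsum_closed) auto
  have hB: "(\<Oplus>a\<in>A. h a b) \<in> carrier G" if "b \<in> B" for b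
    using that insert.prems by (intro finsum_closed) auto
  have "(\<Oplus>a\<in>insert x A. \<Oplus>b\<in>B. h a b) = (\<Oplus>b\<in>B. h x b) \<oplus> (\<Oplus>a\<in>A. \<Oplus>b\<in>B. h a b)"
    using insert.hyps hA by (intro finsum_insert) auto
  also have "(\<Oplus>a\<in>A. \<Oplus>b\<in>B. h a b) = (\<Oplus>b\<in>B. \<Oplus>a\<in>A. h a b)"
    using insert.IH insert.prems by simp
  also have "(\<Oplus>b\<in>B. h x b) \<oplus> (\<Oplus>b\<in>B. \<Oplus>a\<in>A. h a b) = (\<Oplus>b\<in>B. h x b \<oplus> (\<Oplus>a\<in>A. h a b))"
    using hx hB by (intro finsum_addf[symmetric]) auto
  also have "\<dots> = (\<Oplus>b\<in>B. \<Oplus>a\<in>insert x A. h a b)"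
  proof (rule finsum_cong'[OF refl])
    show "(\<lambda>b. \<Oplus>a\<in>insert x A. h a b) \<in> B \<rightarrow> carrier G"
      using insert.prems by (intro Pi_I finsum_closed) auto
    show "h x b \<oplus> (\<Oplus>a\<in>A. h a b) = (\<Oplus>a\<in>insert x A. h a b)" if "b \<in> B" for b
      using that insert.hyps insert.prems by (intro finsum_insert[symmetric]) auto
  qed
  finally show ?case .
qed simp

lemma (in group) pow_card_subgroup:
  assumes "subgroup H G" "finite H" "h \<in> H"
  shows "h [^] card H = \<one>"
proof -
  interpret H: group "G\<lparr>carrier := H\<rparr>" by (rule subgroup_imp_group[OF assms(1)])
  have "h [^]\<^bsub>G\<lparr>carrier := H\<rparr>\<^esub> order (G\<lparr>carrier := H\<rparr>) = \<one>"
    using H.pow_order_eq_1[of h] assms(3) by simp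
  then show ?thesis by (simp add: order_def nat_pow_def)
qed

locale galois_graded = finite_galois L K G
  for L :: "('a, 'b) ring_scheme" (structure) and K G +
  fixes D :: "('d, 'c) monoid_scheme" and A :: "'d \<Rightarrow> 'a set"
  assumes unitary: "unitary_grading L K D A"
begin

lemma grading: "grading L K D A"
  using unitary by (simp add: unitary_grading_def)

lemma comm_group_D: "comm_group D"
  using grading by (simp add: grading_def)

sublocale D: comm_group D by (rule comm_group_D)

lemma A_one: "A \<one>\<^bsub>D\<^esub> = K"
  using unitary by (simp add: unitary_grading_def)

lemma A_subalgebra: "d \<in> carrier D \<Longrightarrow> subalgebra K (A d) L"
  using grading by (simp add: grading_def)

lemma A_carrier: "d \<in> carrier D \<Longrightarrow> x \<in> A d \<Longrightarrow> x \<in> carrier L"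
  using grading_component_subset[OF grading] by blast

lemma A_add: "d \<in> carrier D \<Longrightarrow> x \<in> A d \<Longrightarrow> y \<in> A d \<Longrightarrow> x \<oplus> y \<in> A d"
  using subgroup.m_closed[OF subalgebra.axioms(1)[OF A_subalgebra]] by simp

lemma A_zero: "d \<in> carrier D \<Longrightarrow> \<zero> \<in> A d"
  using subgroup.one_closed[OF subalgebra.axioms(1)[OF A_subalgebra]] by simp

lemma A_neg: "d \<in> carrier D \<Longrightarrow> x \<in> A d \<Longrightarrow> \<ominus> x \<in> A d"
  using subgroup.m_inv_closed[OF subalgebra.axioms(1)[OF A_subalgebra]] by (simp add: a_inv_def)

lemma A_smult: "d \<in> carrier D \<Longrightarrow> k \<in> K \<Longrightarrow> x \<in> A d \<Longrightarrow> k \<otimes> x \<in> A d"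
  using subalgebra.smult_closed[OF A_subalgebra] by simp

lemma A_mult:
  "d \<in> carrier D \<Longrightarrow> e \<in> carrier D \<Longrightarrow> x \<in> A d \<Longrightarrow> y \<in> A e \<Longrightarrow> x \<otimes> y \<in> A (d \<otimes>\<^bsub>D\<^esub> e)"
  using grading by (simp add: grading_def)

lemma A_pow: "d \<in> carrier D \<Longrightarrow> x \<in> A d \<Longrightarrow> x [^] (k::nat) \<in> A (d [^]\<^bsub>D\<^esub> k)"
  by (induction k) (simp_all add: A_one K_closed A_mult)

lemma graded_all: "graded_part L A (carrier D) = carrier L"
  using grading by (simp add: grading_def)

lemma A_direct:
  assumes "finite F" "F \<subseteq> carrier D" "a \<in> Pi F A" "finsum L a F = \<zero>" "d \<in> F"
  shows "a d = \<zero>"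
proof -
  have "\<forall>F f. finite F \<and> F \<subseteq> carrier D \<and> f \<in> Pi F A \<and> finsum L f F = \<zero> \<longrightarrow> (\<forall>d\<in>F. f d = \<zero>)"
    using grading by (simp add: grading_def)
  from this[rule_format, of F a d] assms show ?thesis by simp
qed

definition unit_of :: "'d \<Rightarrow> 'a"
  where "unit_of d = (SOME x. x \<in> A d \<inter> Units L)"

lemma unit_of:
  assumes "d \<in> carrier D"
  shows unit_of_mem: "unit_of d \<in> A d" and unit_of_closed: "unit_of d \<in> carrier L"
    and unit_of_nonzero: "unit_of d \<noteq> \<zero>"
proof -
  have "A d \<inter> Units L \<noteq> {}" using unitary assms by (simp add: unitary_grading_def)
  then have "unit_of d \<in> A d \<inter> Units L" unfolding unit_of_def by (rule some_in_eq[THEN iffD2])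
  then show "unit_of d \<in> A d" "unit_of d \<in> carrier L" "unit_of d \<noteq> \<zero>" using field_Units by auto
qed

text \<open>A homogeneous unit of the inverse degree moves both elements into \<open>K\<close>,
  where they can be divided.\<close>

lemma A_quotient:
  assumes d: "d \<in> carrier D" and x: "x \<in> A d" and y: "y \<in> A d" "y \<noteq> \<zero>"
  shows "\<exists>k\<in>K. x = k \<otimes> y"
proof -
  let ?w = "unit_of (inv\<^bsub>D\<^esub> d)"
  have w: "?w \<in> carrier L" "?w \<noteq> \<zero>" using unit_of[OF D.inv_closed[OF d]] by auto
  have c: "x \<in> carrier L" "y \<in> carrier L" using A_carrier[OF d] x y by auto
  have "x \<otimes> ?w \<in> K" "y \<otimes> ?w \<in> K"
    using A_mult[OF d D.inv_closed[OF d] _ unit_of_mem[OF D.inv_closed[OF d]]] x y d A_one by auto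
  moreover have yw: "y \<otimes> ?w \<noteq> \<zero>" using y(2) c w by (simp add: integral_iff)
  ultimately have k: "(x \<otimes> ?w) \<otimes> inv (y \<otimes> ?w) \<in> K" using K_closed(4) K_inv by blast
  define i where "i = inv (y \<otimes> ?w)"
  have i: "i \<in> carrier L" "i \<otimes> (y \<otimes> ?w) = \<one>" using c w yw by (simp_all add: i_def)
  have "(x \<otimes> ?w) \<otimes> i \<otimes> y = x \<otimes> (i \<otimes> (y \<otimes> ?w))"
    using c w i(1) by (simp add: m_ac)
  then have "x = (x \<otimes> ?w) \<otimes> i \<otimes> y" using c i(2) by simp
  then show ?thesis using k unfolding i_def by (rule_tac bexI)
qed

lemma A_inv:
  assumes d: "d \<in> carrier D" and x: "x \<in> A d" "x \<noteq> \<zero>"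
  shows "inv x \<in> A (inv\<^bsub>D\<^esub> d)"
proof -
  let ?w = "unit_of (inv\<^bsub>D\<^esub> d)"
  have d': "inv\<^bsub>D\<^esub> d \<in> carrier D" using d by simp
  have w: "?w \<in> carrier L" "?w \<noteq> \<zero>" using unit_of[OF d'] by auto
  have xL: "x \<in> carrier L" using A_carrier[OF d x(1)] .
  have k: "x \<otimes> ?w \<in> K" using A_mult[OF d d' x(1) unit_of_mem[OF d']] d A_one by simp
  have k0: "x \<otimes> ?w \<noteq> \<zero>" using x(2) xL w by (simp add: integral_iff)
  define i where "i = inv (x \<otimes> ?w)"
  have i: "i \<in> K" "i \<in> carrier L" "(x \<otimes> ?w) \<otimes> i = \<one>"
    using K_inv[OF k k0] K_subset k0 xL w by (simp_all add: i_def)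
  have "inv x = i \<otimes> ?w"
  proof (rule comm_inv_char)
    show "x \<otimes> (i \<otimes> ?w) = \<one>" using i(2,3) xL w(1) by (simp add: m_ac)
  qed (use i w xL in auto)
  then show ?thesis using A_smult[OF d' i(1) unit_of_mem[OF d']] by simp
qed

text \<open>Extend both families by zero to the union of the supports and subtract. If
  \<open>d\<close> were outside \<open>F'\<close>, the component of this relation at
  \<open>d\<close> would be the nonzero \<open>a d\<close>, against directness.\<close>

lemma component_unique:
  assumes F: "finite F" "F \<subseteq> carrier D" "a \<in> Pi F A"
    and F': "finite F'" "F' \<subseteq> carrier D" "b \<in> Pi F' A"
    and eq: "finsum L a F = finsum L b F'" and d: "d \<in> F" "a d \<noteq> \<zero>"
  shows "d \<in> F'"
proof (rule ccontr)
  assume "d \<notin> F'"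
  define a' where "a' e = (if e \<in> F then a e else \<zero>)" for e
  define b' where "b' e = (if e \<in> F' then \<ominus> b e else \<zero>)" for e
  have aL: "a e \<in> A e" "a e \<in> carrier L" if "e \<in> F" for e
    using Pi_mem[OF F(3) that] A_carrier F(2) that by auto
  have bL: "b e \<in> A e" "b e \<in> carrier L" if "e \<in> F'" for e
    using Pi_mem[OF F'(3) that] A_carrier F'(2) that by auto
  have a': "a' e \<in> A e" "a' e \<in> carrier L" if "e \<in> F \<union> F'" for e
    using that aL A_zero F(2) F'(2) by (auto simp: a'_def)
  have b': "b' e \<in> A e" "b' e \<in> carrier L" if "e \<in> F \<union> F'" for e
    using that bL A_zero A_neg F(2) F'(2) by (auto simp: b'_def)
  have "finsum L a' (F \<union> F') = finsum L a F"
    using F(1) F'(1) aL by (intro add.finprod_mono_neutral_cong_right) (auto simp: a'_def)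
  moreover have "finsum L b' (F \<union> F') = (\<Oplus>e\<in>F'. \<ominus> b e)"
    using F(1) F'(1) bL by (intro add.finprod_mono_neutral_cong_right) (auto simp: b'_def)
  moreover have "(\<Oplus>e\<in>F'. \<ominus> b e) = \<ominus> finsum L b F'"
  proof -
    have "(\<Oplus>e\<in>F'. \<ominus> b e) = (\<Oplus>e\<in>F'. \<ominus> \<one> \<otimes> b e)"
      using bL by (intro finsum_cong') (auto simp: l_minus)
    also have "\<dots> = \<ominus> \<one> \<otimes> finsum L b F'"
      using F'(1) bL by (intro finsum_rdistr[symmetric]) auto
    also have "\<dots> = \<ominus> finsum L b F'"
    proof -
      have "finsum L b F' \<in> carrier L" using bL by (intro finsum_closed) auto
      then show ?thesis by (simp add: l_minus)
    qed
    finally show ?thesis .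
  qed
  moreover have "(\<Oplus>e\<in>F \<union> F'. a' e \<oplus> b' e) = finsum L a' (F \<union> F') \<oplus> finsum L b' (F \<union> F')"
    using a'(2) b'(2) by (intro finsum_addf) auto
  moreover have "finsum L b F' \<in> carrier L" using bL by (intro finsum_closed) auto
  ultimately have "(\<Oplus>e\<in>F \<union> F'. a' e \<oplus> b' e) = \<zero>" using eq by (simp add: r_neg)
  moreover have "(\<lambda>e. a' e \<oplus> b' e) \<in> Pi (F \<union> F') A"
  proof
    fix e assume e: "e \<in> F \<union> F'"
    then have "e \<in> carrier D" using F(2) F'(2) by blast
    then show "a' e \<oplus> b' e \<in> A e" using A_add a'(1)[OF e] b'(1)[OF e] by blast
  qed
  ultimately have "a' d \<oplus> b' d = \<zero>"
    using A_direct[of "F \<union> F'" "\<lambda>e. a' e \<oplus> b' e" d] F(1,2) F'(1,2) d(1) by simp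
  then show False using d \<open>d \<notin> F'\<close> aL(2)[OF d(1)] by (simp add: a'_def b'_def)
qed

lemma A_disjoint:
  assumes "d \<in> carrier D" "e \<in> carrier D" "x \<in> A d" "x \<in> A e" "x \<noteq> \<zero>"
  shows "d = e"
proof -
  have xL: "x \<in> carrier L" using A_carrier assms by blast
  have "finsum L (\<lambda>_. x) {d} = finsum L (\<lambda>_. x) {e}" using xL by simp
  then have "d \<in> {e}"
    using assms by (intro component_unique[of "{d}" "\<lambda>_. x" "{e}" "\<lambda>_. x"]) auto
  then show ?thesis by simp
qed

lemma component_in_support:
  assumes "finite F" "F \<subseteq> carrier D" "a \<in> Pi F A" "finsum L a F \<in> graded_part L A T"
    "T \<subseteq> carrier D" "d \<in> F" "a d \<noteq> \<zero>"
  shows "d \<in> T"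
proof -
  obtain b F' where b: "finite F'" "F' \<subseteq> T" "b \<in> Pi F' A" "finsum L a F = finsum L b F'"
    using assms(4) by (auto simp: graded_part_def)
  have "d \<in> F'"
    by (rule component_unique[OF assms(1-3) b(1) _ b(3,4) assms(6,7)]) (use b(2) assms(5) in blast)
  then show ?thesis using b(2) by blast
qed

lemma A_in_graded_part: "d \<in> T \<Longrightarrow> T \<subseteq> carrier D \<Longrightarrow> x \<in> A d \<Longrightarrow> x \<in> graded_part L A T"
  using A_carrier by (intro graded_part_single) auto

lemma graded_part_shift:
  assumes y: "y \<in> graded_part L A T" and T: "T \<subseteq> carrier D" and d: "d \<in> carrier D" and x: "x \<in> A d"
  shows "y \<otimes> x \<in> graded_part L A ((\<lambda>e. e \<otimes>\<^bsub>D\<^esub> d) ` T)"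
proof -
  obtain a F where a: "finite F" "F \<subseteq> T" "a \<in> Pi F A" "y = finsum L a F"
    using y by (auto simp: graded_part_def)
  have aL: "a e \<in> A e" "a e \<in> carrier L" "e \<in> carrier D" if "e \<in> F" for e
    using Pi_mem[OF a(3) that] A_carrier a(2) T that by auto
  have "y \<otimes> x = (\<Oplus>e\<in>F. a e \<otimes> x)"
    unfolding a(4) using a(1) A_carrier[OF d x] aL(2) by (intro finsum_ldistr) auto
  moreover have "(\<lambda>e. a e \<otimes> x) \<in> Pi F (A \<circ> (\<lambda>e. e \<otimes>\<^bsub>D\<^esub> d))"
    using aL A_mult d x by auto
  ultimately have "y \<otimes> x \<in> graded_part L (A \<circ> (\<lambda>e. e \<otimes>\<^bsub>D\<^esub> d)) T"
    using a(1,2) unfolding graded_part_def by blast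
  moreover have "inj_on (\<lambda>e. e \<otimes>\<^bsub>D\<^esub> d) T" using T d by (intro inj_onI) (simp add: subset_iff)
  moreover have "A e \<subseteq> carrier L" if "e \<in> (\<lambda>e. e \<otimes>\<^bsub>D\<^esub> d) ` T" for e
    using that T d A_carrier by blast
  ultimately show ?thesis using graded_part_reindex[OF field_axioms] by metis
qed

text \<open>A dimension count: the relations \<open>\<Sum> y d \<otimes> \<tau> (unit_of d) = \<zero>\<close> turn, after applying the inverse
  of \<open>\<tau>\<close> and summing, into a relation with coefficients the traces, which lie in \<open>K\<close>.\<close>
lemma card_le_orbit:
  fixes \<kappa> :: "('a \<Rightarrow> 'a) \<Rightarrow> 'k"
  assumes F: "finite F" "F \<subseteq> carrier D"
    and \<kappa>: "\<And>\<phi> \<tau> d. \<phi> \<in> carrier G \<Longrightarrow> \<tau> \<in> carrier G \<Longrightarrow> \<kappa> \<phi> = \<kappa> \<tau> \<Longrightarrow> d \<in> F \<Longrightarrow>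
      \<phi> (unit_of d) = \<tau> (unit_of d)"
  shows "card F \<le> card (\<kappa> ` carrier G)"
proof (rule ccontr)
  assume "\<not> card F \<le> card (\<kappa> ` carrier G)"
  then have less: "card (\<kappa> ` carrier G) < card F" by simp
  have fin: "finite (\<kappa> ` carrier G)" using finite_G by simp
  \<comment> \<open>One representative for each value of \<kappa>: the system has as many equations
    as \<kappa> has values, and by hypothesis a representative acts on the units like all
    automorphisms with the same value.\<close>
  define r where "r = inv_into (carrier G) \<kappa>"
  have r: "r k \<in> carrier G" "\<kappa> (r k) = k" if "k \<in> \<kappa> ` carrier G" for k
    using that unfolding r_def by (rule inv_into_into, rule f_inv_into_f)
  have uL: "unit_of d \<in> carrier L" "unit_of d \<noteq> \<zero>" if "d \<in> F" for d
    using unit_of(2,3) F(2) that by auto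
  have "\<exists>y. y \<in> F \<rightarrow> carrier L \<and> (\<exists>d\<in>F. y d \<noteq> \<zero>) \<and>
    (\<forall>k\<in>\<kappa> ` carrier G. (\<Oplus>d\<in>F. r k (unit_of d) \<otimes> y d) = \<zero>)"
  proof (rule homogeneous_system_nontrivial_solution
      [of "\<kappa> ` carrier G" F "\<lambda>k d. r k (unit_of d)", OF fin F(1) less])
    show "r k (unit_of d) \<in> carrier L" if "k \<in> \<kappa> ` carrier G" "d \<in> F" for k d
      using r(1)[OF that(1)] uL(1)[OF that(2)] by simp
  qed
  then obtain y where y: "y \<in> F \<rightarrow> carrier L" "\<exists>d\<in>F. y d \<noteq> \<zero>"
    "\<forall>k\<in>\<kappa> ` carrier G. (\<Oplus>d\<in>F. r k (unit_of d) \<otimes> y d) = \<zero>"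
    by (elim exE conjE) (rule that)
  have yL: "y d \<in> carrier L" if "d \<in> F" for d using Pi_mem[OF y(1) that] .
  have rel: "(\<Oplus>d\<in>F. \<tau> (unit_of d) \<otimes> y d) = \<zero>" if t: "\<tau> \<in> carrier G" for \<tau>
  proof -
    have k: "\<kappa> \<tau> \<in> \<kappa> ` carrier G" using t by blast
    have "(\<Oplus>d\<in>F. \<tau> (unit_of d) \<otimes> y d) = (\<Oplus>d\<in>F. r (\<kappa> \<tau>) (unit_of d) \<otimes> y d)"
    proof (rule finsum_cong'[OF refl])
      show "\<tau> (unit_of d) \<otimes> y d = r (\<kappa> \<tau>) (unit_of d) \<otimes> y d" if "d \<in> F" for d
        using \<kappa>[OF t r(1)[OF k] r(2)[OF k, symmetric] that] by simp
    qed (use r(1)[OF k] uL yL in auto)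
    then show ?thesis using bspec[OF y(3) k] by simp
  qed
  obtain d0 where d0: "d0 \<in> F" "y d0 \<noteq> \<zero>" using y(2) by blast
  obtain b where b: "b \<in> carrier L" "trace (carrier G) b \<noteq> \<zero>"
    using trace_nonzero[OF G.subgroup_self] by blast
  \<comment> \<open>Normalized so that the resulting relation has the trace of \<open>b\<close>,
    which is nonzero, as its coefficient at \<open>d0\<close>.\<close>
  define a where "a = b \<otimes> inv (y d0)"
  have a: "a \<in> carrier L" "a \<otimes> y d0 = b"
    using b(1) d0 yL by (simp_all add: a_def m_assoc)
  have "(\<Oplus>d\<in>F. trace (carrier G) (a \<otimes> y d) \<otimes> unit_of d)
    = (\<Oplus>d\<in>F. \<Oplus>\<tau>\<in>carrier G. \<tau> (a \<otimes> y d) \<otimes> unit_of d)"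
  proof (rule finsum_cong'[OF refl])
    show "trace (carrier G) (a \<otimes> y d) \<otimes> unit_of d = (\<Oplus>\<tau>\<in>carrier G. \<tau> (a \<otimes> y d) \<otimes> unit_of d)"
      if "d \<in> F" for d
      unfolding trace_def using finite_G uL(1)[OF that] yL[OF that] a(1)
      by (intro finsum_ldistr) auto
  qed (use uL yL a(1) in \<open>auto intro!: finsum_closed\<close>)
  also have "\<dots> = (\<Oplus>\<tau>\<in>carrier G. \<Oplus>d\<in>F. \<tau> (a \<otimes> y d) \<otimes> unit_of d)"
    using F(1) finite_G uL yL a(1) by (intro finsum_swap) auto
  also have "\<dots> = (\<Oplus>\<tau>\<in>carrier G. \<zero>)"
  proof (rule finsum_cong'[OF refl])
    fix \<tau> assume t: "\<tau> \<in> carrier G"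
    let ?t = "inv\<^bsub>G\<^esub> \<tau>"
    have t': "?t \<in> carrier G" using t by simp
    have "(\<Oplus>d\<in>F. \<tau> (a \<otimes> y d) \<otimes> unit_of d) = (\<Oplus>d\<in>F. \<tau> a \<otimes> \<tau> (?t (unit_of d) \<otimes> y d))"
      using t t' uL yL a(1) by (intro finsum_cong') (auto simp: m_ac)
    also have "\<dots> = \<tau> a \<otimes> (\<Oplus>d\<in>F. \<tau> (?t (unit_of d) \<otimes> y d))"
      using t t' F(1) uL yL a(1) by (intro finsum_rdistr[symmetric]) auto
    also have "(\<Oplus>d\<in>F. \<tau> (?t (unit_of d) \<otimes> y d)) = \<tau> (\<Oplus>d\<in>F. ?t (unit_of d) \<otimes> y d)"
      using t' uL yL by (intro G_finsum[OF t, symmetric]) auto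
    finally show "(\<Oplus>d\<in>F. \<tau> (a \<otimes> y d) \<otimes> unit_of d) = \<zero>"
      using rel[OF t'] t a(1) by simp
  qed simp
  also have "\<dots> = \<zero>" by simp
  finally have zero: "(\<Oplus>d\<in>F. trace (carrier G) (a \<otimes> y d) \<otimes> unit_of d) = \<zero>" .
  have "(\<lambda>d. trace (carrier G) (a \<otimes> y d) \<otimes> unit_of d) \<in> Pi F A"
    using F(2) yL a(1) A_smult trace_in_K unit_of_mem by (intro Pi_I) (simp add: subset_iff)
  from A_direct[OF F this zero d0(1)] have "trace (carrier G) b \<otimes> unit_of d0 = \<zero>"
    by (simp add: a(2))
  then show False using b uL[OF d0(1)] by (simp add: integral_iff)
qed

lemma finite_D: "finite (carrier D)"
proof (rule ccontr)
  assume "infinite (carrier D)"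
  then obtain F where F: "F \<subseteq> carrier D" "finite F" "card F = Suc (order G)"
    using infinite_arbitrarily_large by blast
  have "card F \<le> order G"
    using card_le_orbit[OF F(2,1), of "\<lambda>\<phi>. \<phi>"] by (simp add: order_def)
  then show False using F(3) by simp
qed

lemma subspace_all:
  assumes V: "V \<subseteq> carrier L" "\<zero> \<in> V" "\<And>s t. s \<in> V \<Longrightarrow> t \<in> V \<Longrightarrow> s \<oplus> t \<in> V"
    "\<And>k s. k \<in> K \<Longrightarrow> s \<in> V \<Longrightarrow> k \<otimes> s \<in> V" "\<And>d. d \<in> carrier D \<Longrightarrow> unit_of d \<in> V"
    and x: "x \<in> carrier L"
  shows "x \<in> V"
proof -
  obtain a F where a: "finite F" "F \<subseteq> carrier D" "a \<in> Pi F A" "x = finsum L a F"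
    using x unfolding graded_all[symmetric] by (auto simp: graded_part_def)
  have "a d \<in> V" if d: "d \<in> F" for d
  proof -
    have dD: "d \<in> carrier D" using d a(2) by blast
    obtain k where "k \<in> K" "a d = k \<otimes> unit_of d"
      using A_quotient[OF dD Pi_mem[OF a(3) d] unit_of_mem[OF dD] unit_of_nonzero[OF dD]] by blast
    then show ?thesis using V(4,5) dD by simp
  qed
  then show ?thesis unfolding a(4) by (intro finsum_mem_closed V) auto
qed

text \<open>Were there fewer degrees than automorphisms, some nonzero family of coefficients would
  annihilate a unit in each degree, hence \<open>L\<close>, against independence.\<close>

lemma order_G_le: "order G \<le> card (carrier D)"
proof (rule ccontr)
  assume "\<not> ?thesis"
  then have less: "card (carrier D) < card (carrier G)" by (simp add: order_def)
  have "\<exists>x. x \<in> carrier G \<rightarrow> carrier L \<and> (\<exists>\<phi>\<in>carrier G. x \<phi> \<noteq> \<zero>) \<and>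
    (\<forall>d\<in>carrier D. (\<Oplus>\<phi>\<in>carrier G. \<phi> (unit_of d) \<otimes> x \<phi>) = \<zero>)"
  proof (rule homogeneous_system_nontrivial_solution
      [of "carrier D" "carrier G" "\<lambda>d \<phi>. \<phi> (unit_of d)", OF finite_D finite_G less])
    show "\<phi> (unit_of d) \<in> carrier L" if "d \<in> carrier D" "\<phi> \<in> carrier G" for d \<phi>
      using that unit_of_closed by simp
  qed
  then obtain x where x: "x \<in> carrier G \<rightarrow> carrier L" "\<exists>\<phi>\<in>carrier G. x \<phi> \<noteq> \<zero>"
    "\<forall>d\<in>carrier D. (\<Oplus>\<phi>\<in>carrier G. \<phi> (unit_of d) \<otimes> x \<phi>) = \<zero>"
    by (elim exE conjE) (rule that)
  have "s \<in> annihilated x" if "s \<in> carrier L" for s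
  proof (rule subspace_all[OF _ annihilated_closed[OF x(1)] _ that])
    show "annihilated x \<subseteq> carrier L" by (auto simp: annihilated_def)
    show "unit_of d \<in> annihilated x" if d: "d \<in> carrier D" for d
    proof -
      have "(\<Oplus>\<phi>\<in>carrier G. x \<phi> \<otimes> \<phi> (unit_of d)) = (\<Oplus>\<phi>\<in>carrier G. \<phi> (unit_of d) \<otimes> x \<phi>)"
        using x(1) unit_of_closed[OF d] by (intro finsum_cong') (auto simp: Pi_iff m_comm)
      then show ?thesis using bspec[OF x(3) d] unit_of_closed[OF d] by (simp add: annihilated_def)
    qed
  qed
  then have zero: "(\<Oplus>\<phi>\<in>carrier G. x \<phi> \<otimes> \<phi> s) = \<zero>" if "s \<in> carrier L" for s
    using that by (simp add: annihilated_def)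
  obtain \<tau> where "\<tau> \<in> carrier G" "x \<tau> \<noteq> \<zero>" using x(2) by blast
  then show False using automorphisms_independent[OF x(1) zero] by blast
qed

text \<open>A conjugate of \<open>y\<close> is \<phi>(y) / y times \<open>y\<close>, and this factor
  is an \<open>m\<close>-th root of unity because \<open>G\<close> fixes y ^ m.\<close>

lemma card_orbit_le:
  assumes y: "y \<in> carrier L" "y \<noteq> \<zero>" and m: "0 < m" "y [^] m \<in> K"
  shows "card ((\<lambda>\<phi>. \<phi> y) ` carrier G) \<le> card (roots_of_one m L)"
proof -
  have "(\<lambda>\<phi>. \<phi> y) ` carrier G \<subseteq> (\<lambda>z. z \<otimes> y) ` roots_of_one m L"
  proof
    fix z assume "z \<in> (\<lambda>\<phi>. \<phi> y) ` carrier G"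
    then obtain \<phi> where p: "\<phi> \<in> carrier G" "z = \<phi> y" by blast
    have "(\<phi> y \<otimes> inv y) [^] m = \<phi> y [^] m \<otimes> inv y [^] m"
      using p y by (simp add: nat_pow_distrib)
    also have "\<phi> y [^] m = y [^] m" using G_fixes_K[OF p(1) m(2)] p(1) y(1) by simp
    also have "y [^] m \<otimes> inv y [^] m = (y \<otimes> inv y) [^] m"
      using y by (intro nat_pow_distrib[symmetric]) simp_all
    finally have "\<phi> y \<otimes> inv y \<in> roots_of_one m L" using p y m(1) by (simp add: roots_of_one_eq)
    moreover have "z = \<phi> y \<otimes> inv y \<otimes> y" using p y by (simp add: m_assoc)
    ultimately show "z \<in> (\<lambda>z. z \<otimes> y) ` roots_of_one m L" by blast
  qed
  then show ?thesis using finite_roots_of_one[OF m(1)] by (rule surj_card_le[rotated])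
qed

lemma card_orbit_le_exponent:
  assumes "y \<in> carrier L" "y \<noteq> \<zero>" "0 < m" "y [^] m \<in> K"
  shows "card ((\<lambda>\<phi>. \<phi> y) ` carrier G) \<le> m"
  using card_orbit_le[OF assms] card_roots_of_one_le[OF assms(3)] by linarith

text \<open>The powers of \<open>unit_of d\<close> are homogeneous in the distinct powers of
  \<open>d\<close>, and their images under \<phi> depend only on that of \<open>unit_of d\<close>.
  So the order of \<open>d\<close> is at most the number of conjugates of \<open>unit_of d\<close>,
  which \<open>card_orbit_le\<close> bounds by the number of roots of unity of this order.\<close>

lemma card_roots_of_one_ord:
  assumes d: "d \<in> carrier D"
  shows "card (roots_of_one (D.ord d) L) = D.ord d"
proof -
  let ?m = "D.ord d" and ?y = "unit_of d"
  have y: "?y \<in> carrier L" "?y \<noteq> \<zero>" "?y \<in> A d" using unit_of[OF d] by auto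
  have m: "0 < ?m" using D.ord_ge_1[OF finite_D d] by simp
  let ?F = "(\<lambda>j::nat. d [^]\<^bsub>D\<^esub> j) ` {0..?m - 1}"
  have "?m = card ?F" using D.ord_inj[OF d] m by (simp add: card_image)
  also have "\<dots> \<le> card ((\<lambda>\<phi>. \<phi> ?y) ` carrier G)"
  proof (rule card_le_orbit)
    show "?F \<subseteq> carrier D" using d by auto
    fix \<phi> \<tau> e assume p: "\<phi> \<in> carrier G" "\<tau> \<in> carrier G" and eq: "\<phi> ?y = \<tau> ?y" and "e \<in> ?F"
    then obtain j :: nat where e: "e = d [^]\<^bsub>D\<^esub> j" by blast
    have eD: "e \<in> carrier D" using e d by simp
    have "?y [^] j \<noteq> \<zero>" using y(1,2) by (induction j) (simp_all add: integral_iff)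
    then obtain k where k: "k \<in> K" "unit_of e = k \<otimes> ?y [^] j"
      using A_quotient[OF eD unit_of_mem[OF eD]] A_pow[OF d y(3)] e by blast
    have kL: "k \<in> carrier L" using K_subset k(1) .
    show "\<phi> (unit_of e) = \<tau> (unit_of e)"
      using p y(1) eq kL k(1) by (simp add: k(2) G_fixes_K)
  qed simp
  also have "\<dots> \<le> card (roots_of_one ?m L)"
  proof (rule card_orbit_le[OF y(1,2) m])
    show "?y [^] ?m \<in> K" using A_pow[OF d y(3), of ?m] d A_one by simp
  qed
  finally show ?thesis using card_roots_of_one_le[OF m] by simp
qed

end

section \<open>Degrees of intermediate fields, and roots of unity in the base field\<close>

locale galois_co_galois = galois_graded L K G D A
  for L :: "('a, 'b) ring_scheme" (structure) and K G and D :: "('d, 'c) monoid_scheme" and A +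
  assumes subfield_graded: "\<And>E. subfield E L \<Longrightarrow> K \<subseteq> E \<Longrightarrow>
    \<exists>D'. subgroup D' D \<and> E = graded_part L A D'"
begin

text \<open>The field generated by \<open>y\<close>, in the guise of the fixed field of its stabilizer.\<close>
lemma generated_subgroup:
  assumes y: "y \<in> carrier L"
  obtains D' where "subgroup D' D" "y \<in> graded_part L A D'"
    "card D' \<le> card ((\<lambda>\<phi>. \<phi> y) ` carrier G)" "finite D'"
proof -
  define H where "H = {\<phi> \<in> carrier G. \<phi> y = y}"
  let ?E = "{x \<in> carrier L. \<forall>\<phi>\<in>H. \<phi> x = x}"
  have H: "H \<subseteq> carrier G" by (auto simp: H_def)
  have "K \<subseteq> ?E" using K_subset G_fixes_K H by (simp add: subset_iff)
  then obtain D' where D': "subgroup D' D" "?E = graded_part L A D'"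
    using subfield_graded[OF fixed_field[OF H]] by blast
  have D'D: "D' \<subseteq> carrier D" using subgroup.subset[OF D'(1)] .
  have fin: "finite D'" using D'D finite_D finite_subset by blast
  have "y \<in> ?E" using y by (simp add: H_def)
  moreover have "card D' \<le> card ((\<lambda>\<phi>. \<phi> y) ` carrier G)"
  proof (rule card_le_orbit[OF fin D'D])
    fix \<phi> \<tau> d assume p: "\<phi> \<in> carrier G" "\<tau> \<in> carrier G" and eq: "\<phi> y = \<tau> y" and d: "d \<in> D'"
    have dD: "d \<in> carrier D" using d D'D by blast
    \<comment> \<open>If \<phi> and \<tau> agree at \<open>y\<close>, this quotient fixes
      \<open>y\<close>, hence \<open>?E\<close>, hence the homogeneous elements with degree in
      \<open>D'\<close>.\<close>
    let ?r = "inv\<^bsub>G\<^esub> \<tau> \<otimes>\<^bsub>G\<^esub> \<phi>"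
    have "?r y = y" using p eq y by simp
    then have "?r \<in> H" using p by (simp add: H_def)
    moreover have "unit_of d \<in> ?E"
      unfolding D'(2) by (rule A_in_graded_part[OF d D'D unit_of_mem[OF dD]])
    ultimately have "?r (unit_of d) = unit_of d" by blast
    then have "\<tau> (?r (unit_of d)) = \<tau> (unit_of d)" by simp
    then show "\<phi> (unit_of d) = \<tau> (unit_of d)" using p unit_of_closed[OF dD] by simp
  qed
  ultimately show ?thesis using that[OF D'(1) _ _ fin] D'(2) by simp
qed

lemma pow_card_bound:
  assumes D': "subgroup D' D" "finite D'" "card D' \<le> m" and d: "d \<in> D'"
  obtains k :: nat where "0 < k" "k \<le> m" "d [^]\<^bsub>D\<^esub> k = \<one>\<^bsub>D\<^esub>"
proof (rule that[of "card D'"])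
  show "0 < card D'" using D'(2) d card_gt_0_iff by blast
  show "d [^]\<^bsub>D\<^esub> card D' = \<one>\<^bsub>D\<^esub>" by (rule D.pow_card_subgroup[OF D'(1,2) d])
qed (rule D'(3))

lemma exists_ord_eq:
  assumes "m dvd group_exponent D" "0 < m"
  shows "\<exists>d\<in>carrier D. D.ord d = m"
proof -
  obtain d0 where d0: "d0 \<in> carrier D" "D.ord d0 = group_exponent D"
    using D.exists_ord_eq_group_exponent[OF finite_D] by blast
  obtain q where q: "group_exponent D = m * q" using assms(1) ..
  then have "0 < q" using D.group_exponent_pos[OF finite_D] by (metis gr0I mult_0_right less_irrefl)
  then have "D.ord (d0 [^]\<^bsub>D\<^esub> q) = m" using d0 q by (subst D.ord_pow) auto
  then show ?thesis using d0(1) by blast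
qed

text \<open>The degree group \<open>D1\<close> of \<zeta> has at most p - 1 elements, so a
  nontrivial degree \<open>e\<close> in the support of \<zeta> has order prime to \<open>p\<close>.
  The degree group \<open>D2\<close> of \<zeta> x contains e d, whose order is then a proper
  multiple of \<open>p\<close>, although \<open>D2\<close> has at most \<open>p\<close>
  elements.\<close>

lemma prime_roots_of_one_in_K:
  assumes p: "prime p" "p dvd group_exponent D"
  shows "roots_of_one p L \<subseteq> K"
proof (rule subsetI, rule ccontr)
  fix \<zeta> assume z: "\<zeta> \<in> roots_of_one p L" and zK: "\<zeta> \<notin> K"
  have p0: "0 < p" using p(1) prime_gt_0_nat by blast
  have zL: "\<zeta> \<in> carrier L" "\<zeta> \<noteq> \<zero>" "\<zeta> [^] p = \<one>" using z by (auto simp: roots_of_one_def)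
  obtain d where d: "d \<in> carrier D" "D.ord d = p" using exists_ord_eq[OF p(2) p0] by blast
  let ?x = "unit_of d"
  have x: "?x \<in> carrier L" "?x \<noteq> \<zero>" "?x \<in> A d" using unit_of[OF d(1)] by auto
  have d_pow: "d [^]\<^bsub>D\<^esub> j = \<one>\<^bsub>D\<^esub> \<longleftrightarrow> p dvd j" for j :: nat using D.pow_eq_id[OF d(1), of j] d(2) by simp
  obtain D1 where D1: "subgroup D1 D" "\<zeta> \<in> graded_part L A D1"
    "card D1 \<le> card ((\<lambda>\<phi>. \<phi> \<zeta>) ` carrier G)" "finite D1"
    using generated_subgroup[OF zL(1)] .
  have D1D: "D1 \<subseteq> carrier D" using subgroup.subset[OF D1(1)] .
  \<comment> \<open>1 is not a conjugate of \<zeta>. The bound p - 1 in place of \<open>p\<close> is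
    what makes the orders in \<open>D1\<close> prime to \<open>p\<close>.\<close>
  have "card ((\<lambda>\<phi>. \<phi> \<zeta>) ` carrier G) < p"
  proof -
    have "(\<lambda>\<phi>. \<phi> \<zeta>) ` carrier G \<subseteq> roots_of_one p L - {\<one>}"
    proof
      fix t assume "t \<in> (\<lambda>\<phi>. \<phi> \<zeta>) ` carrier G"
      then obtain \<phi> where \<phi>: "\<phi> \<in> carrier G" "t = \<phi> \<zeta>" by blast
      have "t [^] p = \<phi> (\<zeta> [^] p)" using \<phi> zL(1) by simp
      then have "t \<in> roots_of_one p L" using \<phi> zL p0 by (simp add: roots_of_one_eq)
      moreover have "t \<noteq> \<one>"
        using G_inj[OF \<phi>(1) zL(1) one_closed] \<phi> zK K_closed(1) by auto
      ultimately show "t \<in> roots_of_one p L - {\<one>}" by simp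
    qed
    then have "card ((\<lambda>\<phi>. \<phi> \<zeta>) ` carrier G) \<le> card (roots_of_one p L - {\<one>})"
      using finite_roots_of_one[OF p0] by (intro card_mono) auto
    also have "\<dots> < card (roots_of_one p L)"
      using finite_roots_of_one[OF p0] p0 by (intro card_Diff1_less) (auto simp: roots_of_one_eq)
    also have "\<dots> \<le> p" by (rule card_roots_of_one_le[OF p0])
    finally show ?thesis .
  qed
  then have D1p: "card D1 \<le> p - 1" using D1(3) by linarith
  obtain a F where a: "finite F" "F \<subseteq> D1" "a \<in> Pi F A" "\<zeta> = finsum L a F"
    using D1(2) by (auto simp: graded_part_def)
  have FD: "F \<subseteq> carrier D" using a(2) D1D by blast
  have "\<exists>e\<in>F. e \<noteq> \<one>\<^bsub>D\<^esub> \<and> a e \<noteq> \<zero>"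
  proof (rule ccontr)
    assume *: "\<not> ?thesis"
    have aK: "a e \<in> K" if "e \<in> F" for e
    proof (cases "e = \<one>\<^bsub>D\<^esub>")
      case True
      then show ?thesis using Pi_mem[OF a(3) that] A_one by simp
    next
      case False
      then show ?thesis using * that K_closed(2) by auto
    qed
    have "finsum L a F \<in> K"
      by (rule finsum_mem_closed) (use aK K_closed(2,3) K_subset in auto)
    then show False using a(4) zK by simp
  qed
  then obtain e where e: "e \<in> F" "e \<noteq> \<one>\<^bsub>D\<^esub>" "a e \<noteq> \<zero>" by blast
  have eD: "e \<in> carrier D" using e(1) FD by blast
  have zx: "\<zeta> \<otimes> ?x \<in> carrier L" "\<zeta> \<otimes> ?x \<noteq> \<zero>" using zL x by (simp_all add: integral_iff)
  obtain D2 where D2: "subgroup D2 D" "\<zeta> \<otimes> ?x \<in> graded_part L A D2"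
    "card D2 \<le> card ((\<lambda>\<phi>. \<phi> (\<zeta> \<otimes> ?x)) ` carrier G)" "finite D2"
    using generated_subgroup[OF zx(1)] .
  have D2D: "D2 \<subseteq> carrier D" using subgroup.subset[OF D2(1)] .
  have "(\<zeta> \<otimes> ?x) [^] p \<in> K"
    using A_pow[OF d(1) x(3), of p] A_one d_pow[of p] zL x by (simp add: nat_pow_distrib)
  then have D2p: "card D2 \<le> p" using D2(3) card_orbit_le_exponent[OF zx p0] by linarith
  have d': "inv\<^bsub>D\<^esub> d \<in> carrier D" using d(1) by simp
  \<comment> \<open>Division by \<open>?x\<close> shifts the degrees back, so that the component of
    \<zeta> at \<open>e\<close> forces e d into \<open>D2\<close>.\<close>
  have "(\<zeta> \<otimes> ?x) \<otimes> inv ?x \<in> graded_part L A ((\<lambda>e. e \<otimes>\<^bsub>D\<^esub> inv\<^bsub>D\<^esub> d) ` D2)"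
    by (rule graded_part_shift[OF D2(2) D2D d' A_inv[OF d(1) x(3,2)]])
  then have "finsum L a F \<in> graded_part L A ((\<lambda>e. e \<otimes>\<^bsub>D\<^esub> inv\<^bsub>D\<^esub> d) ` D2)"
    using zL x by (simp add: m_assoc flip: a(4))
  then have "e \<in> (\<lambda>e. e \<otimes>\<^bsub>D\<^esub> inv\<^bsub>D\<^esub> d) ` D2"
    by (rule component_in_support[OF a(1) FD a(3) _ _ e(1,3)]) (use D2D d' in auto)
  then obtain c where c: "c \<in> D2" "e = c \<otimes>\<^bsub>D\<^esub> inv\<^bsub>D\<^esub> d" by blast
  have cD: "c \<in> carrier D" using c(1) D2D by blast
  have c_eq: "c = e \<otimes>\<^bsub>D\<^esub> d" using c(2) cD d(1) by (simp add: D.m_assoc)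
  obtain k where k: "0 < k" "k \<le> p" "c [^]\<^bsub>D\<^esub> k = \<one>\<^bsub>D\<^esub>"
    using pow_card_bound[OF D2(1,4) D2p c(1)] .
  have "e \<in> D1" using e(1) a(2) by blast
  then obtain m where m: "0 < m" "m \<le> p - 1" "e [^]\<^bsub>D\<^esub> m = \<one>\<^bsub>D\<^esub>"
    using pow_card_bound[OF D1(1,4) D1p] by blast
  have cop: "coprime m p"
    using m(1,2) p0 p(1) by (metis coprime_commute prime_imp_coprime nat_dvd_not_less diff_less le_less_trans zero_less_one)
  have ek: "e [^]\<^bsub>D\<^esub> k \<otimes>\<^bsub>D\<^esub> d [^]\<^bsub>D\<^esub> k = \<one>\<^bsub>D\<^esub>"
    using k(3) eD d(1) by (simp add: c_eq D.nat_pow_distrib)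
  then have "(e [^]\<^bsub>D\<^esub> k \<otimes>\<^bsub>D\<^esub> d [^]\<^bsub>D\<^esub> k) [^]\<^bsub>D\<^esub> m = \<one>\<^bsub>D\<^esub>" by simp
  then have "(e [^]\<^bsub>D\<^esub> m) [^]\<^bsub>D\<^esub> k \<otimes>\<^bsub>D\<^esub> d [^]\<^bsub>D\<^esub> (k * m) = \<one>\<^bsub>D\<^esub>"
    using eD d(1) by (simp add: D.nat_pow_distrib D.nat_pow_pow mult.commute)
  then have "d [^]\<^bsub>D\<^esub> (k * m) = \<one>\<^bsub>D\<^esub>" using m(3) d(1) by simp
  then have "p dvd k" using d_pow cop by (simp add: coprime_dvd_mult_left_iff coprime_commute)
  then have "k = p" using k(1,2) by (simp add: dvd_imp_le le_antisym)
  then have "e [^]\<^bsub>D\<^esub> p = \<one>\<^bsub>D\<^esub>" using ek d_pow[of p] eD by simp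
  then have "D.ord e dvd p" "D.ord e dvd m" using m(3) eD by (simp_all add: D.pow_eq_id)
  then have "D.ord e = 1" using cop by (meson coprime_common_divisor_nat coprime_common_divisor nat_dvd_1_iff_1)
  then show False using D.ord_eq_1[OF eD] e(2) by simp
qed

end

text \<open>An automorphism acts on all \<open>n\<close>-th roots of unity by a single exponent
  \<open>s\<close>. So the conditions at the primes and at 4 combine to s = 1 modulo er(n), instead
  of decomposing a root of unity into its primary parts.\<close>

lemma (in finite_galois) reduced_roots_of_one_in_K:
  assumes n: "0 < n" "card (roots_of_one n L) = n"
    and prime: "\<And>p. prime p \<Longrightarrow> p dvd n \<Longrightarrow> roots_of_one p L \<subseteq> K"
    and four: "4 dvd n \<Longrightarrow> roots_of_one 4 L \<subseteq> K"
  shows "roots_of_one (extended_reduction n) L \<subseteq> K"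
proof
  fix z assume z: "z \<in> roots_of_one (extended_reduction n) L"
  obtain q where q: "n = extended_reduction n * q" using extended_reduction_dvd[OF n(1)] ..
  have zL: "z \<in> carrier L" "z \<noteq> \<zero>" "z [^] extended_reduction n = \<one>"
    using z by (auto simp: roots_of_one_def)
  have "z [^] (extended_reduction n * q) = \<one>" using zL by (simp flip: nat_pow_pow)
  then have "z [^] n = \<one>" by (simp only: flip: q)
  then have zn: "z \<in> roots_of_one n L" using zL by (simp add: roots_of_one_def)
  have "\<phi> z = z" if p: "\<phi> \<in> carrier G" for \<phi>
  proof -
    obtain s :: nat where s: "0 < s" "\<forall>z\<in>roots_of_one n L. \<phi> z = z [^] s"
      "\<forall>q. q dvd n \<longrightarrow> roots_of_one q L \<subseteq> K \<longrightarrow> q dvd s - 1"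
      using roots_of_one_exponent[OF n p] by blast
    have "extended_reduction n dvd s - 1"
      unfolding extended_reduction_dvd_iff[OF n(1)] using s(3) prime four by blast
    then obtain c where c: "s - 1 = extended_reduction n * c" ..
    have "s = 1 + extended_reduction n * c" using c s(1) by simp
    then have "z [^] s = z \<otimes> (z [^] extended_reduction n) [^] c"
      using zL(1) by (simp add: nat_pow_pow m_comm flip: nat_pow_mult)
    then have "z [^] s = z" using zL by simp
    then show ?thesis using bspec[OF s(2) zn] by simp
  qed
  then show "z \<in> K" using fixed_iff_K[OF zL(1)] by blast
qed

lemma (in galois_graded) graded_part_pair:
  assumes d: "d \<in> carrier D" "e \<in> carrier D" "d \<noteq> e" and x: "x \<in> graded_part L A {d, e}"
  shows "\<exists>a\<in>A d. \<exists>b\<in>A e. x = a \<oplus> b"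
proof -
  obtain a F where a: "finite F" "F \<subseteq> {d, e}" "a \<in> Pi F A" "x = finsum L a F"
    using x by (auto simp: graded_part_def)
  define b where "b c = (if c \<in> F then a c else \<zero>)" for c
  have b: "b c \<in> A c" "b c \<in> carrier L" if "c \<in> {d, e}" for c
    using that a(3) d A_zero A_carrier by (auto simp: b_def Pi_iff)
  have "x = finsum L b {d, e}"
    unfolding a(4) using a(2) b by (intro add.finprod_mono_neutral_cong_left) (auto simp: b_def)
  also have "\<dots> = b d \<oplus> b e" using d(3) b(2) by (subst finsum_insert) auto
  finally show ?thesis using b(1) by blast
qed

context galois_co_galois
begin

text \<open>If \<open>i\<close> is not in \<open>K\<close>, then it is homogeneous, and \<open>(1 + i) x\<close> for \<open>x\<close> homogeneous of order 4
  generates a field that is too large, as its fourth power lies in \<open>K\<close>.\<close>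
lemma fourth_roots_of_one_in_K:
  assumes four: "4 dvd group_exponent D"
  shows "roots_of_one 4 L \<subseteq> K"
proof (rule subsetI, rule ccontr)
  fix i assume i4: "i \<in> roots_of_one 4 L" and iK: "i \<notin> K"
  have iL: "i \<in> carrier L" "i \<noteq> \<zero>" "i [^] (4::nat) = \<one>" using i4 by (auto simp: roots_of_one_def)
  have one_neg: "\<ominus> \<one> \<in> K" using K_closed by blast
  have i_ne: "i \<noteq> \<one>" "i \<noteq> \<ominus> \<one>" using iK one_neg K_closed(1) by blast+
  have ii1: "i \<otimes> i \<noteq> \<one>"
  proof
    assume "i \<otimes> i = \<one>"
    have "(i \<ominus> \<one>) \<otimes> (i \<oplus> \<one>) = i \<otimes> i \<ominus> \<one>" using iL(1) by algebra
    then have "(i \<ominus> \<one>) \<otimes> (i \<oplus> \<one>) = \<zero>" using \<open>i \<otimes> i = \<one>\<close> by (simp add: minus_eq r_neg)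
    then have "i \<ominus> \<one> = \<zero> \<or> i \<oplus> \<one> = \<zero>" using iL(1) integral_iff by simp
    then show False
    proof
      assume "i \<oplus> \<one> = \<zero>"
      then have "i = \<ominus> \<one>" using iL(1) minus_equality[of i \<one>] by simp
      then show False using i_ne by simp
    qed (use iL(1) i_ne in simp)
  qed
  have ii: "i \<otimes> i = \<ominus> \<one>"
  proof -
    have sq: "(i \<otimes> i) \<otimes> (i \<otimes> i) = \<one>"
      using iL(1,3) by (simp add: numeral_eq_Suc m_ac)
    have "(i \<otimes> i \<ominus> \<one>) \<otimes> (i \<otimes> i \<oplus> \<one>) = (i \<otimes> i) \<otimes> (i \<otimes> i) \<ominus> \<one>" using iL(1) by algebra
    also have "\<dots> = \<zero>" unfolding sq by (simp add: minus_eq r_neg)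
    finally have "(i \<otimes> i \<ominus> \<one>) \<otimes> (i \<otimes> i \<oplus> \<one>) = \<zero>" .
    then have "i \<otimes> i \<oplus> \<one> = \<zero>" using iL(1) ii1 integral_iff by simp
    then show ?thesis using iL(1) minus_equality[of "i \<otimes> i" \<one>] by simp
  qed
  \<comment> \<open>Otherwise -1 = 1, and \<open>i\<close> would square to 1.\<close>
  have two: "\<one> \<oplus> \<one> \<noteq> \<zero>"
  proof
    assume "\<one> \<oplus> \<one> = \<zero>"
    then have "\<ominus> \<one> = \<one>" by (intro minus_equality) auto
    then show False using ii ii1 by simp
  qed
  obtain D1 where D1: "subgroup D1 D" "i \<in> graded_part L A D1"
    "card D1 \<le> card ((\<lambda>\<phi>. \<phi> i) ` carrier G)" "finite D1"
    using generated_subgroup[OF iL(1)] .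
  have D1D: "D1 \<subseteq> carrier D" using subgroup.subset[OF D1(1)] .
  \<comment> \<open>So \<open>i\<close> has at most two conjugates, and its degree group is the
    trivial degree together with one degree \<open>e\<close> of order 2.\<close>
  have "i [^] (2::nat) \<in> K" using ii one_neg iL(1) by (simp add: numeral_eq_Suc)
  then have D1_card: "card D1 \<le> 2"
    using D1(3) card_orbit_le_exponent[OF iL(1,2), of 2] by simp
  have "\<exists>e. e \<in> D1 \<and> e \<noteq> \<one>\<^bsub>D\<^esub>"
  proof (rule ccontr)
    assume "\<not> ?thesis"
    then have sub: "D1 \<subseteq> {\<one>\<^bsub>D\<^esub>}" by blast
    obtain a F where a: "finite F" "F \<subseteq> D1" "a \<in> Pi F A" "i = finsum L a F"
      using D1(2) by (auto simp: graded_part_def)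
    have "a \<in> F \<rightarrow> K" using a(2,3) sub A_one by auto
    then have "finsum L a F \<in> K"
      using K_closed(2,3) K_subset by (intro finsum_mem_closed) auto
    then show False using a(4) iK by simp
  qed
  then obtain e where e: "e \<in> D1" "e \<noteq> \<one>\<^bsub>D\<^esub>" by blast
  have eD: "e \<in> carrier D" using e(1) D1D by blast
  have "card {\<one>\<^bsub>D\<^esub>, e} = 2" using e(2) by simp
  moreover have "{\<one>\<^bsub>D\<^esub>, e} \<subseteq> D1" using e(1) subgroup.one_closed[OF D1(1)] by simp
  ultimately have D1_eq: "D1 = {\<one>\<^bsub>D\<^esub>, e}" using D1(4) D1_card by (metis card_seteq)
  then have "card D1 = 2" using e(2) by simp
  then have "e [^]\<^bsub>D\<^esub> (2::nat) = \<one>\<^bsub>D\<^esub>" using D.pow_card_subgroup[OF D1(1,4) e(1)] by simp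
  then have e2: "e \<otimes>\<^bsub>D\<^esub> e = \<one>\<^bsub>D\<^esub>" using eD by (simp add: numeral_eq_Suc)
  have e_ord: "D.ord e = 2"
  proof -
    have "D.ord e dvd 2" using \<open>e [^]\<^bsub>D\<^esub> (2::nat) = \<one>\<^bsub>D\<^esub>\<close> eD by (simp flip: D.pow_eq_id)
    then have "D.ord e = 1 \<or> D.ord e = 2" using two_is_prime_nat prime_nat_iff by blast
    then show ?thesis using D.ord_eq_1[OF eD] e(2) by simp
  qed
  obtain \<alpha> b where ab: "\<alpha> \<in> A \<one>\<^bsub>D\<^esub>" "b \<in> A e" "i = \<alpha> \<oplus> b"
    using graded_part_pair[OF D.one_closed eD e(2)[symmetric]] D1(2) D1_eq by blast
  have \<alpha>K: "\<alpha> \<in> K" and abL: "\<alpha> \<in> carrier L" "b \<in> carrier L"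
    using ab A_one A_carrier eD K_subset by auto
  have b0: "b \<noteq> \<zero>" using ab(3) iK \<alpha>K abL(1) by auto
  have bb: "b \<otimes> b \<in> K" using A_mult[OF eD eD ab(2) ab(2)] e2 A_one by simp
  \<comment> \<open>Squaring i = \<alpha> + b shows that 2 \<alpha> b, which has degree
    \<open>e\<close>, also lies in \<open>K\<close>. As 2 and \<open>b\<close> are nonzero, \<alpha>
    must vanish.\<close>
  have "\<alpha> = \<zero>"
  proof (rule ccontr)
    assume "\<alpha> \<noteq> \<zero>"
    let ?w = "\<alpha> \<otimes> b \<oplus> \<alpha> \<otimes> b"
    have "?w \<in> A e" using A_add A_smult ab(2) \<alpha>K eD by simp
    moreover have "?w = i \<otimes> i \<ominus> \<alpha> \<otimes> \<alpha> \<ominus> b \<otimes> b" unfolding ab(3) using abL by algebra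
    then have "?w \<in> A \<one>\<^bsub>D\<^esub>"
      unfolding A_one ii using K_closed \<alpha>K bb by (simp add: minus_eq)
    moreover have "?w = (\<one> \<oplus> \<one>) \<otimes> \<alpha> \<otimes> b" using abL by (simp add: l_distr)
    then have "?w \<noteq> \<zero>" using two \<open>\<alpha> \<noteq> \<zero>\<close> b0 abL by (simp add: integral_iff)
    ultimately show False using A_disjoint[OF eD D.one_closed] e(2) by blast
  qed
  then have iA: "i \<in> A e" using ab abL by simp
  obtain d where d: "d \<in> carrier D" "D.ord d = 4" using exists_ord_eq[OF four] by auto
  have d_pow: "d [^]\<^bsub>D\<^esub> j = \<one>\<^bsub>D\<^esub> \<longleftrightarrow> 4 dvd j" for j :: nat using D.pow_eq_id[OF d(1), of j] d(2) by simp
  let ?x = "unit_of d"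
  have x: "?x \<in> carrier L" "?x \<noteq> \<zero>" "?x \<in> A d" using unit_of[OF d(1)] by auto
  have ed: "e \<otimes>\<^bsub>D\<^esub> d \<in> carrier D" using eD d(1) by simp
  have ed_ne: "e \<otimes>\<^bsub>D\<^esub> d \<noteq> d" using eD d(1) e(2) D.r_cancel_one by simp
  have ix: "i \<otimes> ?x \<in> A (e \<otimes>\<^bsub>D\<^esub> d)" "i \<otimes> ?x \<noteq> \<zero>" "i \<otimes> ?x \<in> carrier L"
    using A_mult[OF eD d(1) iA x(3)] iL x by (simp_all add: integral_iff)
  \<comment> \<open>(1 + i) x, whose square 2 i x^2 is homogeneous of degree e d^2, although it has
    itself components in the two degrees \<open>d\<close> and e d.\<close>
  let ?y = "?x \<oplus> i \<otimes> ?x"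
  have yL: "?y \<in> carrier L" using x ix by simp
  have y_eq: "?y = (\<one> \<oplus> i) \<otimes> ?x" using x iL(1) by (simp add: l_distr)
  have "\<one> \<oplus> i \<noteq> \<zero>"
  proof
    assume "\<one> \<oplus> i = \<zero>"
    then have "i \<oplus> \<one> = \<zero>" using iL(1) by (simp add: a_comm)
    then have "\<ominus> \<one> = i" using iL(1) by (intro minus_equality) auto
    then show False using i_ne by simp
  qed
  then have y0: "?y \<noteq> \<zero>" unfolding y_eq using x iL(1) by (simp add: integral_iff)
  have yy: "?y \<otimes> ?y = (\<one> \<oplus> \<one>) \<otimes> (i \<otimes> (?x \<otimes> ?x))"
  proof -
    have "?y \<otimes> ?y = (\<one> \<oplus> i \<otimes> i) \<otimes> (?x \<otimes> ?x) \<oplus> (\<one> \<oplus> \<one>) \<otimes> (i \<otimes> (?x \<otimes> ?x))"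
      using x(1) iL(1) by algebra
    then show ?thesis using ii x(1) iL(1) by (simp add: r_neg)
  qed
  have two_K: "\<one> \<oplus> \<one> \<in> K" using K_closed by blast
  have x2: "?x \<otimes> ?x \<in> A (d \<otimes>\<^bsub>D\<^esub> d)" using A_mult[OF d(1,1) x(3,3)] .
  have yyA: "?y \<otimes> ?y \<in> A (e \<otimes>\<^bsub>D\<^esub> (d \<otimes>\<^bsub>D\<^esub> d))"
    unfolding yy using A_smult[OF _ two_K] A_mult[OF eD _ iA x2] eD d(1) by simp
  have d4: "(d \<otimes>\<^bsub>D\<^esub> d) \<otimes>\<^bsub>D\<^esub> (d \<otimes>\<^bsub>D\<^esub> d) = \<one>\<^bsub>D\<^esub>"
    using d_pow[of 4] d(1) by (simp add: numeral_eq_Suc D.m_assoc)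
  have "(e \<otimes>\<^bsub>D\<^esub> (d \<otimes>\<^bsub>D\<^esub> d)) \<otimes>\<^bsub>D\<^esub> (e \<otimes>\<^bsub>D\<^esub> (d \<otimes>\<^bsub>D\<^esub> d))
    = (e \<otimes>\<^bsub>D\<^esub> e) \<otimes>\<^bsub>D\<^esub> ((d \<otimes>\<^bsub>D\<^esub> d) \<otimes>\<^bsub>D\<^esub> (d \<otimes>\<^bsub>D\<^esub> d))"
    using eD d(1) by (simp add: D.m_ac)
  then have "(?y \<otimes> ?y) \<otimes> (?y \<otimes> ?y) \<in> K"
    using A_mult[OF _ _ yyA yyA] eD d(1) e2 d4 A_one by simp
  moreover have "?y [^] (4::nat) = (?y \<otimes> ?y) \<otimes> (?y \<otimes> ?y)"
  proof -
    have "u [^] (4::nat) = (u \<otimes> u) \<otimes> (u \<otimes> u)" if "u \<in> carrier L" for u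
      using that by (simp add: numeral_eq_Suc m_assoc)
    then show ?thesis using yL by blast
  qed
  ultimately have y4: "?y [^] (4::nat) \<in> K" by simp
  obtain D2 where D2: "subgroup D2 D" "?y \<in> graded_part L A D2"
    "card D2 \<le> card ((\<lambda>\<phi>. \<phi> ?y) ` carrier G)" "finite D2"
    using generated_subgroup[OF yL] .
  have D2D: "D2 \<subseteq> carrier D" using subgroup.subset[OF D2(1)] .
  define c where "c t = (if t = d then ?x else i \<otimes> ?x)" for t
  have c_simps: "c d = ?x" "c (e \<otimes>\<^bsub>D\<^esub> d) = i \<otimes> ?x" using ed_ne by (simp_all add: c_def)
  have c_sum: "finsum L c {d, e \<otimes>\<^bsub>D\<^esub> d} = ?y"
    using x(1) ix(3) ed_ne[symmetric] c_simps by (subst finsum_insert) auto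
  have c_Pi: "c \<in> Pi {d, e \<otimes>\<^bsub>D\<^esub> d} A" using c_simps x(3) ix(1) by auto
  have in_D2: "t \<in> D2" if "t \<in> {d, e \<otimes>\<^bsub>D\<^esub> d}" for t
  proof (rule component_in_support[OF _ _ c_Pi _ D2D that])
    show "finsum L c {d, e \<otimes>\<^bsub>D\<^esub> d} \<in> graded_part L A D2" unfolding c_sum by (rule D2(2))
    show "c t \<noteq> \<zero>" using that c_simps x(2) ix(2) by auto
  qed (use d(1) ed in auto)
  have dD2: "d \<in> D2" using in_D2 by blast
  have "(e \<otimes>\<^bsub>D\<^esub> d) \<otimes>\<^bsub>D\<^esub> inv\<^bsub>D\<^esub> d \<in> D2"
    using in_D2 dD2 subgroup.m_closed[OF D2(1)] subgroup.m_inv_closed[OF D2(1)] by blast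
  then have eD2: "e \<in> D2" using eD d(1) by (simp add: D.m_assoc)
  let ?P = "(\<lambda>j::nat. d [^]\<^bsub>D\<^esub> j) ` {0..D.ord d - 1}"
  have P: "?P \<subseteq> D2"
  proof -
    have "d [^]\<^bsub>D\<^esub> j \<in> D2" for j :: nat
      by (induction j) (simp_all add: subgroup.one_closed[OF D2(1)] subgroup.m_closed[OF D2(1)] dD2)
    then show ?thesis by blast
  qed
  have P_card: "card ?P = 4" using D.ord_inj[OF d(1)] d(2) by (simp add: card_image)
  \<comment> \<open>The bound 4 alone is no contradiction, as the powers of \<open>d\<close> may
    fill \<open>D2\<close>. But then e = d^2, the square of \<open>?y\<close> has degree d^4 = 1 and
    lies in \<open>K\<close>, and the bound drops to 2.\<close>
  have "card D2 \<le> 4" using D2(3) card_orbit_le_exponent[OF yL y0 _ y4] by simp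
  then have "?P = D2" using card_seteq[OF D2(4) P] P_card by simp
  then obtain j :: nat where j: "j \<in> {0..3}" "e = d [^]\<^bsub>D\<^esub> j" using eD2 d(2) by auto
  have "d [^]\<^bsub>D\<^esub> (j + j) = \<one>\<^bsub>D\<^esub>" using e2 j(2) d(1) by (simp add: D.nat_pow_mult)
  then have "4 dvd j + j" using d_pow by blast
  then have "2 dvd j" by presburger
  moreover have "j \<noteq> 0" using e(2) j(2) by (cases j) auto
  moreover have "j \<le> 3" using j(1) by simp
  ultimately have "j = 2" by presburger
  then have "e = d \<otimes>\<^bsub>D\<^esub> d" using j(2) d(1) by (simp add: numeral_eq_Suc)
  then have "?y \<otimes> ?y \<in> K" using yyA d4 A_one by simp
  moreover have "?y [^] (2::nat) = ?y \<otimes> ?y"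
  proof -
    have "u [^] (2::nat) = u \<otimes> u" if "u \<in> carrier L" for u
      using that by (simp add: numeral_eq_Suc)
    then show ?thesis using yL by blast
  qed
  ultimately have "card D2 \<le> 2"
    using D2(3) card_orbit_le_exponent[OF yL y0, of 2] by simp
  then show False using card_mono[OF D2(4) P] P_card by simp
qed

lemma cyclotomic_exponent: "finite_galois_cyclotomic L K G (group_exponent D)"
proof (intro finite_galois_cyclotomic.intro finite_galois_roots.intro finite_galois_axioms
    finite_galois_roots_axioms.intro finite_galois_cyclotomic_axioms.intro)
  show pos: "0 < group_exponent D" by (rule D.group_exponent_pos[OF finite_D])
  obtain d where "d \<in> carrier D" "D.ord d = group_exponent D"
    using exists_ord_eq[OF dvd_refl pos] by blast
  then show card: "card (roots_of_one (group_exponent D) L) = group_exponent D"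
    using card_roots_of_one_ord by metis
  show "roots_of_one (extended_reduction (group_exponent D)) L \<subseteq> K"
    by (rule reduced_roots_of_one_in_K[OF pos card prime_roots_of_one_in_K fourth_roots_of_one_in_K])
qed

end

section \<open>Kummer cocycles of homogeneous units\<close>

locale galois_co_galois_exponent = galois_co_galois L K G D A +
    finite_galois_cyclotomic L K G "group_exponent D"
  for L :: "('a, 'b) ring_scheme" (structure) and K G and D :: "('d, 'c) monoid_scheme" and A
begin

abbreviation N where "N \<equiv> group_exponent D"

text \<open>As \<open>G\<close> fixes \<open>K\<close> and a component is a line over
  \<open>K\<close>, another choice of \<open>unit_of d\<close> would give the same cocycle.\<close>

definition kummer :: "'d \<Rightarrow> ('a \<Rightarrow> 'a) \<Rightarrow> 'a"
  where "kummer d = (\<lambda>\<phi>\<in>carrier G. \<phi> (unit_of d) \<otimes> inv (unit_of d))"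

lemma unit_of_pow: "d \<in> carrier D \<Longrightarrow> unit_of d [^] N \<in> K"
  using A_pow[OF _ unit_of_mem, of d N] D.pow_group_exponent[OF finite_D] A_one by simp

lemma kummer_mem:
  assumes d: "d \<in> carrier D"
  shows "kummer d \<in> Z"
  unfolding kummer_def
proof (rule C.crossed_homI)
  let ?u = "unit_of d"
  have u: "?u \<in> carrier L" "?u \<noteq> \<zero>" using unit_of[OF d] by auto
  show "\<phi> ?u \<otimes> inv ?u \<in> carrier (roots_of_one_group N L)" if p: "\<phi> \<in> carrier G" for \<phi>
  proof -
    have "(\<phi> ?u \<otimes> inv ?u) [^] N = \<phi> (?u [^] N) \<otimes> inv ?u [^] N"
      using p u by (simp add: nat_pow_distrib)
    also have "\<dots> = (?u \<otimes> inv ?u) [^] N"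
      using u by (simp add: G_fixes_K[OF p unit_of_pow[OF d]] nat_pow_distrib del: inv_nonzero(2,3))
    finally show ?thesis using p u n_pos by (simp add: roots_of_one_eq)
  qed
  show "(\<phi> \<otimes>\<^bsub>G\<^esub> \<tau>) ?u \<otimes> inv ?u = \<phi> ?u \<otimes> inv ?u \<otimes>\<^bsub>roots_of_one_group N L\<^esub> \<phi> (\<tau> ?u \<otimes> inv ?u)"
    if p: "\<phi> \<in> carrier G" "\<tau> \<in> carrier G" for \<phi> \<tau>
  proof -
    define v w i where "v = \<phi> ?u" and "w = \<phi> (\<tau> ?u)" and "i = inv ?u"
    have c: "v \<in> carrier L" "v \<noteq> \<zero>" "w \<in> carrier L" "i \<in> carrier L"
      using p u by (simp_all add: v_def w_def i_def)
    have "v \<otimes> i \<otimes> (w \<otimes> inv v) = w \<otimes> i \<otimes> (v \<otimes> inv v)"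
      using c inv_nonzero(1)[OF c(1,2)] by (simp add: m_ac del: inv_nonzero)
    then have "v \<otimes> i \<otimes> (w \<otimes> inv v) = w \<otimes> i" using c by simp
    then show ?thesis using p u by (simp add: v_def w_def i_def)
  qed
qed

text \<open>From (\<phi>(u) / u) ^ k u ^ k = \<phi>(u ^ k). It trades a power of the cocycle for a
  power of the unit, for k = 1 and for \<open>k\<close> the exponent of \<open>G\<close>.\<close>

lemma kummer_eq_one_iff:
  assumes d: "d \<in> carrier D" and p: "\<phi> \<in> carrier G"
  shows "kummer d \<phi> [^] k = \<one> \<longleftrightarrow> \<phi> (unit_of d [^] k) = unit_of d [^] (k::nat)"
proof -
  let ?u = "unit_of d"
  have u: "?u \<in> carrier L" "?u \<noteq> \<zero>" using unit_of[OF d] by auto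
  have uk: "?u [^] k \<in> carrier L" "?u [^] k \<noteq> \<zero>"
    using u by (simp, induction k) (simp_all add: integral_iff)
  have "(kummer d \<phi> \<otimes> ?u) [^] k = (\<phi> ?u) [^] k"
    using p u by (simp add: kummer_def m_assoc)
  then have eq: "kummer d \<phi> [^] k \<otimes> ?u [^] k = \<phi> (?u [^] k)"
    using p u by (simp add: kummer_def nat_pow_distrib del: inv_nonzero(2,3))
  have c: "kummer d \<phi> [^] k \<in> carrier L" using p u by (simp add: kummer_def)
  have "kummer d \<phi> [^] k = \<one> \<longleftrightarrow> kummer d \<phi> [^] k \<otimes> ?u [^] k = \<one> \<otimes> ?u [^] k"
    using m_rcancel[OF uk(2,1) c one_closed] by simp
  then show ?thesis using eq uk(1) by simp
qed

text \<open>If two units have the same cocycle, their quotient is fixed by \<open>G\<close>, hence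
  lies in \<open>K\<close>, and their degrees agree.\<close>

lemma inj_kummer: "inj_on kummer (carrier D)"
proof (rule inj_onI)
  fix d e assume d: "d \<in> carrier D" and e: "e \<in> carrier D" and eq: "kummer d = kummer e"
  let ?u = "unit_of d" and ?v = "unit_of e"
  have u: "?u \<in> carrier L" "?u \<noteq> \<zero>" "?v \<in> carrier L" "?v \<noteq> \<zero>" using unit_of[OF d] unit_of[OF e] by auto
  have "\<phi> (?u \<otimes> inv ?v) = ?u \<otimes> inv ?v" if p: "\<phi> \<in> carrier G" for \<phi>
  proof -
    have "\<phi> ?u \<otimes> inv ?u = \<phi> ?v \<otimes> inv ?v" using fun_cong[OF eq, of \<phi>] p by (simp add: kummer_def)
    then have "\<phi> ?u \<otimes> inv ?u \<otimes> (?u \<otimes> inv (\<phi> ?v)) = \<phi> ?v \<otimes> inv ?v \<otimes> (?u \<otimes> inv (\<phi> ?v))" by simp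
    moreover have "\<phi> ?u \<otimes> inv ?u \<otimes> (?u \<otimes> inv (\<phi> ?v)) = \<phi> ?u \<otimes> (inv ?u \<otimes> ?u) \<otimes> inv (\<phi> ?v)"
    proof -
      have "inv ?u \<in> carrier L" "inv (\<phi> ?v) \<in> carrier L" "\<phi> ?u \<in> carrier L" using p u by simp_all
      then show ?thesis using u(1) by (simp only: m_assoc m_closed)
    qed
    moreover have "\<phi> ?v \<otimes> inv ?v \<otimes> (?u \<otimes> inv (\<phi> ?v)) = ?u \<otimes> inv ?v \<otimes> (\<phi> ?v \<otimes> inv (\<phi> ?v))"
    proof -
      have "inv ?v \<in> carrier L" "inv (\<phi> ?v) \<in> carrier L" "\<phi> ?v \<in> carrier L" using p u by simp_all
      then show ?thesis using u(1) by (simp only: m_ac m_closed)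
    qed
    ultimately show ?thesis using p u by simp
  qed
  then have "?u \<otimes> inv ?v \<in> K" using fixed_iff_K[of "?u \<otimes> inv ?v"] u by simp
  then have "(?u \<otimes> inv ?v) \<otimes> ?v \<in> A e" using A_smult[OF e _ unit_of_mem[OF e]] by blast
  then have "?u \<in> A e" using u by (simp add: m_assoc)
  then show "d = e" using A_disjoint[OF d e unit_of_mem[OF d]] u(2) by blast
qed

text \<open>The chain order G <= card D <= card Z <= order G closes, by \<open>order_G_le\<close>,
  \<open>inj_kummer\<close> and the bound at H = G.\<close>

lemma card_Z: "card Z = order G"
proof (rule antisym)
  show "card Z \<le> order G"
    using card_Z_le[OF G.subgroup_self] vanishing_G by (simp add: order_def)
  have "card (carrier D) = card (kummer ` carrier D)" using inj_kummer by (simp add: card_image)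
  also have "\<dots> \<le> card Z" using kummer_mem by (intro card_mono finite_Z) blast
  finally show "order G \<le> card Z" using order_G_le by linarith
qed

text \<open>\<open>crossed_hom_pow_eq_one_iff\<close> lets an exponent pass between \<open>G\<close>
  and the cocycles. Since \<open>N\<close> kills the values of the cocycles, \<phi> ^ N fixes every
  \<open>unit_of d\<close> and is the identity. Since exp(G) kills \<open>G\<close>, the power of
  \<open>unit_of d\<close> with this exponent is fixed and lies in \<open>K\<close>, so its degree
  is trivial.\<close>

lemma exponent_G: "group_exponent G = N"
proof (rule dvd_antisym)
  show "group_exponent G dvd N"
  proof (rule G.group_exponent_dvd[OF finite_G])
    fix \<phi> assume p: "\<phi> \<in> carrier G"
    let ?t = "\<phi> [^]\<^bsub>G\<^esub> N"
    have t: "?t \<in> carrier G" using p by simp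
    have fix_u: "?t (unit_of d) = unit_of d" if d: "d \<in> carrier D" for d
    proof -
      have "kummer d \<phi> [^] N = \<one>"
        using Z_closed[OF kummer_mem[OF d] p] by (simp add: roots_of_one_def)
      then have "kummer d ?t = \<one>" using crossed_hom_pow_eq_one_iff[OF kummer_mem[OF d] p] by simp
      then have "kummer d ?t [^] (1::nat) = \<one>" by simp
      then show ?thesis using kummer_eq_one_iff[OF d t, of 1] unit_of_closed[OF d] by simp
    qed
    have "x \<in> {x \<in> carrier L. ?t x = x}" if "x \<in> carrier L" for x
      by (rule subspace_all[OF _ _ _ _ _ that])
        (use t fix_u unit_of_closed K_subset in \<open>simp_all add: G_fixes_K\<close>)
    then show "?t = \<one>\<^bsub>G\<^esub>" using t by (intro G_ext) simp_all
  qed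
  show "N dvd group_exponent G"
  proof (rule D.group_exponent_dvd[OF finite_D])
    fix d assume d: "d \<in> carrier D"
    let ?e = "group_exponent G"
    have "\<phi> (unit_of d [^] ?e) = unit_of d [^] ?e" if p: "\<phi> \<in> carrier G" for \<phi>
    proof -
      have "\<phi> [^]\<^bsub>G\<^esub> ?e = \<one>\<^bsub>G\<^esub>" by (rule G.pow_group_exponent[OF finite_G p])
      then have "kummer d (\<phi> [^]\<^bsub>G\<^esub> ?e) = \<one>" using Z_one[OF kummer_mem[OF d]] by simp
      then show ?thesis
        using crossed_hom_pow_eq_one_iff[OF kummer_mem[OF d] p] kummer_eq_one_iff[OF d p] by simp
    qed
    then have "unit_of d [^] ?e \<in> A \<one>\<^bsub>D\<^esub>"
      using fixed_iff_K[of "unit_of d [^] ?e"] unit_of_closed[OF d] A_one by simp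
    moreover have "unit_of d [^] ?e \<in> A (d [^]\<^bsub>D\<^esub> ?e)" by (rule A_pow[OF d unit_of_mem[OF d]])
    moreover have "unit_of d [^] j \<noteq> \<zero>" for j :: nat
      using unit_of_closed[OF d] unit_of_nonzero[OF d] by (induction j) (simp_all add: integral_iff)
    ultimately show "d [^]\<^bsub>D\<^esub> ?e = \<one>\<^bsub>D\<^esub>"
      using A_disjoint[OF D.nat_pow_closed[OF d] D.one_closed] by blast
  qed
qed

end

section \<open>Both directions of the equivalence\<close>

lemma (in field) card_roots_of_one_dvd:
  assumes n: "0 < n" "card (roots_of_one n R) = n" and m: "m dvd n"
  shows "card (roots_of_one m R) = m"
proof (rule antisym)
  interpret M: comm_group "roots_of_one_group n R" by (rule comm_group_roots_of_one)
  obtain q where q: "n = m * q" using m ..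
  have q0: "0 < q" "0 < m" using q n(1) by auto
  show "card (roots_of_one m R) \<le> m" by (rule card_roots_of_one_le[OF q0(2)])
  obtain \<zeta> where \<zeta>: "\<zeta> \<in> roots_of_one n R" "\<And>k::nat. \<zeta> [^] k = \<one> \<longleftrightarrow> n dvd k"
    by (rule roots_of_one_cyclic[OF n]) blast
  let ?w = "\<zeta> [^] q"
  have z: "\<zeta> \<in> carrier R" using \<zeta>(1) by (simp add: roots_of_one_def)
  have w: "?w \<in> carrier (roots_of_one_group n R)" using M.nat_pow_closed[of \<zeta> q] \<zeta>(1) by simp
  have w_pow: "?w [^] j = \<one> \<longleftrightarrow> m dvd j" for j :: nat
    using z \<zeta>(2) q0(1) by (simp add: nat_pow_pow q mult.commute)
  have "M.ord ?w = m" using M.ord_unique[OF w, of m] w_pow by simp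
  then have "m = card ((\<lambda>j::nat. ?w [^] j) ` {0..m - 1})"
    using M.ord_inj[OF w] q0(2) by (simp add: card_image)
  also have "\<dots> \<le> card (roots_of_one m R)"
  proof (rule card_mono[OF finite_roots_of_one[OF q0(2)]], rule image_subsetI)
    fix j :: nat
    have "(?w [^] j) [^] m = \<one>" using z w_pow[of "j * m"] by (simp add: nat_pow_pow mult.assoc)
    then show "?w [^] j \<in> roots_of_one m R" using z q0(2) by (simp add: roots_of_one_eq)
  qed
  finally show "m \<le> card (roots_of_one m R)" .
qed

theorem theorem4p3:
  fixes L :: "('a, 'b) ring_scheme" and K :: "'a set"
    and G :: "('a \<Rightarrow> 'a) monoid" and n :: nat
  assumes "finite_galois_extension L K"
    and "G = galois_group L K"
    and "n = group_exponent G"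
  shows "has_co_galois_grading L K \<longleftrightarrow>
    (card (roots_of_one n L) = n \<and>
     card (roots_of_one (extended_reduction n) (L\<lparr>carrier := K\<rparr>)) = extended_reduction n) \<and>
    (of_nat (Coset.order (H1 G (roots_of_one_group n L) (\<lambda>\<sigma> x. \<sigma> x))) :: rat) =
      of_nat (card (roots_of_one n (L\<lparr>carrier := K\<rparr>))) * of_nat (Coset.order G) / of_nat n"
proof -
  have fL: "field L" using assms(1) by (simp add: finite_galois_extension_def)
  interpret finite_galois L K G
    by (intro finite_galois.intro finite_galois_axioms.intro fL assms(1,2))
  have n: "0 < n" unfolding assms(3) by (rule G.group_exponent_pos[OF finite_G])
  interpret R: finite_galois_roots L K G n
    by (intro finite_galois_roots.intro finite_galois_axioms finite_galois_roots_axioms.intro n)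
  let ?er = "extended_reduction n"
  have er: "?er dvd n" "0 < ?er" using extended_reduction_dvd[OF n] n by (auto intro: dvd_pos_nat)
  show ?thesis
  proof
    assume "has_co_galois_grading L K"
    then obtain D :: "'a monoid" and A where co: "co_galois_grading L K D A"
      unfolding has_co_galois_grading_def by blast
    interpret CG: galois_co_galois L K G D A
    proof (intro galois_co_galois.intro galois_graded.intro finite_galois_axioms
        galois_graded_axioms.intro galois_co_galois_axioms.intro)
      show "unitary_grading L K D A" using co by (simp add: co_galois_grading_def)
      show "\<exists>D'. subgroup D' D \<and> E = graded_part L A D'" if "subfield E L" "K \<subseteq> E" for E
        using co that by (simp add: co_galois_grading_def)
    qed
    interpret E: galois_co_galois_exponent L K G D A
      by (intro galois_co_galois_exponent.intro CG.galois_co_galois_axioms CG.cyclotomic_exponent)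
    have N: "group_exponent D = n" using E.exponent_G assms(3) by simp
    have card: "card (roots_of_one n L) = n" using E.card_roots N by simp
    have "roots_of_one ?er (L\<lparr>carrier := K\<rparr>) = roots_of_one ?er L"
      unfolding R.roots_of_one_K using E.reduced_roots N by auto
    then have "card (roots_of_one ?er (L\<lparr>carrier := K\<rparr>)) = ?er"
      using card_roots_of_one_dvd[OF n card er(1)] by simp
    moreover have "card R.Z = order G" using E.card_Z N by simp
    ultimately show "(card (roots_of_one n L) = n \<and>
        card (roots_of_one ?er (L\<lparr>carrier := K\<rparr>)) = ?er) \<and>
      (of_nat (order (H1 G (roots_of_one_group n L) (\<lambda>\<sigma> x. \<sigma> x))) :: rat) =
        of_nat (card (roots_of_one n (L\<lparr>carrier := K\<rparr>))) * of_nat (order G) / of_nat n"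
      using card R.order_H1_iff[OF card] by simp
  next
    assume *: "(card (roots_of_one n L) = n \<and>
        card (roots_of_one ?er (L\<lparr>carrier := K\<rparr>)) = ?er) \<and>
      (of_nat (order (H1 G (roots_of_one_group n L) (\<lambda>\<sigma> x. \<sigma> x))) :: rat) =
        of_nat (card (roots_of_one n (L\<lparr>carrier := K\<rparr>))) * of_nat (order G) / of_nat n"
    then have card: "card (roots_of_one n L) = n" by blast
    \<comment> \<open>\<open>K\<close> contains er(n) of these roots by condition 1, and a field has
      no more than that.\<close>
    have "roots_of_one ?er L \<inter> K = roots_of_one ?er L"
    proof (rule card_seteq)
      show "card (roots_of_one ?er L) \<le> card (roots_of_one ?er L \<inter> K)"
        using * card_roots_of_one_le[OF er(2)] by (simp add: R.roots_of_one_K)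
    qed (use finite_roots_of_one[OF er(2)] in auto)
    then interpret C: finite_galois_cyclotomic L K G n
      using card by unfold_locales auto
    have "card R.Z = order G" using * R.order_H1_iff[OF card] by blast
    from has_co_galois_gradingI[OF fL C.co_galois_grading_isotypic[OF this]]
    show "has_co_galois_grading L K" .
  qed
qed

end
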